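(* Let $X=\mathbb{P}^n_M$ be a projective space over a totally ordered idempotent semifield $M$. Then: (1) $\mathcal{O}_X(l)\otimes_{\mathcal{O}_X}\mathcal{O}_X(m)\simeq\mathcal{O}_X(l+m)$ for all $l,m\in\mathbb{Z}$. (2) Any invertible sheaf $\mathcal{L}$ on $X$ is isomorphic to $\mathcal{O}_X(m)$ for some $m\in\mathbb{Z}$.
   Context: Semirings are commutative with $0\neq1$ and absorbing $0$. A semifield is a semiring whose nonzero elements form a multiplicative group. A semiring is idempotent if $x+x=x$ for all $x$; it then carries the partial order $x\le y\iff x+y=y$, and is called totally ordered if this order is total. $\operatorname{Spec} A$ of a semiring $A$ is the set of prime ideals (proper ideals $\mathfrak p$ with $xy\in\mathfrak p\Rightarrow x\in\mathfrak p$ or $y\in\mathfrak p$) with Zariski topology and the usual structure sheaf, with $\mathcal O(D(f))\simeq A_f$; a semiring scheme is a locally semiringed space locally isomorphic to such affine ones. A sheaf of $\mathcal{O}_X$-semimodules is a sheaf $\mathcal F$ with each $\mathcal F(U)$ an $\mathcal O_X(U)$-semimodule, compatibly with restrictions; it is invertible if it is locally isomorphic to $\mathcal{O}_X$. The tensor product $\mathcal F\otimes_{\mathcal O_X}\mathcal G$ is the sheafification of $U\mapsto \mathcal F(U)\otimes_{\mathcal O_X(U)}\mathcal G(U)$, where the tensor product of semimodules is the one universal for bilinear maps into arbitrary semimodules (so $R\otimes_R N\simeq N$ and $\operatorname{Hom}(N\otimes_R N',P)\simeq\operatorname{Hom}(N,\operatorname{Hom}(N',P))$). $\mathbb{P}^n_M=\operatorname{Proj}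 S$, $S=M[x_0,\dots,x_n]$, is glued in the usual way from the affine charts $D(x_i)=\operatorname{Spec} M[\frac{x_0}{x_i},\dots,\frac{x_n}{x_i}]$, $i=0,\dots,n$. $\mathcal{O}_X(m)=\widetilde{S(m)}$ where $S(m)$ is the graded $S$-semimodule with $S(m)_d=S_{m+d}$; thus $\mathcal O_X(m)(D(x_i))$ is the set of homogeneous elements of degree $m$ of $S_{x_i}$. *)

theory Defs
  imports
    "HOL-Analysis.Sum_Topology"
    "HOL-Library.Multiset"
    "HOL-Library.Poly_Mapping"
    "HOL-Library.FuncSet"
    "HOL-Algebra.Module"
begin

section \<open>Semirings and semimodules\<close>

text \<open>
  The condition \<open>0 \<noteq> 1\<close> is not part of this locale, because the semiring of sections of
  a sheaf over the empty set is the zero semiring.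
\<close>

locale csemiring = semiring R + comm_monoid R for R (structure)

locale semimodule = R?: csemiring R + M?: abelian_monoid M
  for R :: "('a, 'x) ring_scheme" (structure) and M :: "('a, 'b, 'y) module_scheme" (structure) +
  assumes smult_closed:
      "\<lbrakk>a \<in> carrier R; x \<in> carrier M\<rbrakk> \<Longrightarrow> a \<odot>\<^bsub>M\<^esub> x \<in> carrier M"
    and smult_l_distr:
      "\<lbrakk>a \<in> carrier R; b \<in> carrier R; x \<in> carrier M\<rbrakk> \<Longrightarrow>
        (a \<oplus>\<^bsub>R\<^esub> b) \<odot>\<^bsub>M\<^esub> x = a \<odot>\<^bsub>M\<^esub> x \<oplus>\<^bsub>M\<^esub> b \<odot>\<^bsub>M\<^esub> x"
    and smult_r_distr:
      "\<lbrakk>a \<in> carrier R; x \<in> carrier M; y \<in> carrier M\<rbrakk> \<Longrightarrow>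
        a \<odot>\<^bsub>M\<^esub> (x \<oplus>\<^bsub>M\<^esub> y) = a \<odot>\<^bsub>M\<^esub> x \<oplus>\<^bsub>M\<^esub> a \<odot>\<^bsub>M\<^esub> y"
    and smult_assoc:
      "\<lbrakk>a \<in> carrier R; b \<in> carrier R; x \<in> carrier M\<rbrakk> \<Longrightarrow>
        (a \<otimes>\<^bsub>R\<^esub> b) \<odot>\<^bsub>M\<^esub> x = a \<odot>\<^bsub>M\<^esub> (b \<odot>\<^bsub>M\<^esub> x)"
    and smult_one: "x \<in> carrier M \<Longrightarrow> \<one>\<^bsub>R\<^esub> \<odot>\<^bsub>M\<^esub> x = x"
    and smult_zero_left: "x \<in> carrier M \<Longrightarrow> \<zero>\<^bsub>R\<^esub> \<odot>\<^bsub>M\<^esub> x = \<zero>\<^bsub>M\<^esub>"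
    and smult_zero_right: "a \<in> carrier R \<Longrightarrow> a \<odot>\<^bsub>M\<^esub> \<zero>\<^bsub>M\<^esub> = \<zero>\<^bsub>M\<^esub>"

text \<open>A semiring as a semimodule over itself.\<close>

definition regular :: "('a, 'x) ring_scheme \<Rightarrow> ('a, 'a) module" where
  "regular R = \<lparr>carrier = carrier R, monoid.mult = monoid.mult R, one = one R,
     zero = zero R, add = add R, smult = monoid.mult R\<rparr>"

text \<open>The canonical order of an idempotent semiring.\<close>

definition idem_le :: "'m::comm_semiring_1 \<Rightarrow> 'm \<Rightarrow> bool" where
  "idem_le x y \<longleftrightarrow> x + y = y"


section \<open>Tensor products of semimodules\<close>

text \<open>
  \<open>M \<otimes>\<^sub>R N\<close> is the free commutative monoid on \<open>M \<times> N\<close>, that is, the monoid of finite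
  multisets of pairs, modulo the congruence generated by the bilinearity relations.  Additive maps
  between semimodules preserve \<open>0\<close>, so pairs with a zero entry are identified with the empty
  multiset.  The ring-multiplication fields of module records carry no meaning.
\<close>

inductive tensor_rel ::
  "('a, 'x) ring_scheme \<Rightarrow> ('a, 'b, 'y) module_scheme \<Rightarrow> ('a, 'c, 'z) module_scheme \<Rightarrow>
   ('b \<times> 'c) multiset \<Rightarrow> ('b \<times> 'c) multiset \<Rightarrow> bool"
  for R M N where
  refl: "set_mset u \<subseteq> carrier M \<times> carrier N \<Longrightarrow> tensor_rel R M N u u"
| sym: "tensor_rel R M N u v \<Longrightarrow> tensor_rel R M N v u"
| trans: "\<lbrakk>tensor_rel R M N u v; tensor_rel R M N v w\<rbrakk> \<Longrightarrow> tensor_rel R M N u w"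
| plus: "\<lbrakk>tensor_rel R M N u v; tensor_rel R M N u' v'\<rbrakk> \<Longrightarrow>
    tensor_rel R M N (u + u') (v + v')"
| add_left: "\<lbrakk>x \<in> carrier M; x' \<in> carrier M; y \<in> carrier N\<rbrakk> \<Longrightarrow>
    tensor_rel R M N {#(x \<oplus>\<^bsub>M\<^esub> x', y)#} {#(x, y), (x', y)#}"
| add_right: "\<lbrakk>x \<in> carrier M; y \<in> carrier N; y' \<in> carrier N\<rbrakk> \<Longrightarrow>
    tensor_rel R M N {#(x, y \<oplus>\<^bsub>N\<^esub> y')#} {#(x, y), (x, y')#}"
| zero_left: "y \<in> carrier N \<Longrightarrow> tensor_rel R M N {#(\<zero>\<^bsub>M\<^esub>, y)#} {#}"
| zero_right: "x \<in> carrier M \<Longrightarrow> tensor_rel R M N {#(x, \<zero>\<^bsub>N\<^esub>)#} {#}"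
| scalar: "\<lbrakk>a \<in> carrier R; x \<in> carrier M; y \<in> carrier N\<rbrakk> \<Longrightarrow>
    tensor_rel R M N {#(a \<odot>\<^bsub>M\<^esub> x, y)#} {#(x, a \<odot>\<^bsub>N\<^esub> y)#}"

definition tensor_module ::
  "('a, 'x) ring_scheme \<Rightarrow> ('a, 'b, 'y) module_scheme \<Rightarrow> ('a, 'c, 'z) module_scheme \<Rightarrow>
   ('a, ('b \<times> 'c) multiset set) module" where
  "tensor_module R M N = \<lparr>
     carrier = {{v. tensor_rel R M N u v} | u. set_mset u \<subseteq> carrier M \<times> carrier N},
     monoid.mult = undefined, one = undefined,
     zero = {v. tensor_rel R M N {#} v},
     add = (\<lambda>A B. {w. \<exists>u\<in>A. \<exists>v\<in>B. tensor_rel R M N (u + v) w}),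
     smult = (\<lambda>a A. {w. \<exists>u\<in>A.
       tensor_rel R M N (image_mset (\<lambda>(x, y). (a \<odot>\<^bsub>M\<^esub> x, y)) u) w})\<rparr>"


section \<open>Sheaves\<close>

text \<open>
  The parameter \<open>'x\<close> extends the algebraic structure of the sections: \<open>unit\<close> gives presheaves of
  semirings, the extension by a scalar multiplication gives presheaves of semimodules.
  \<open>res F U V\<close> is the restriction from \<open>U\<close> to \<open>V\<close>.  Values at sets that are not open are
  irrelevant.
\<close>

record ('p, 's, 'x) presheaf =
  sec :: "'p set \<Rightarrow> ('s, 'x) ring_scheme"
  res :: "'p set \<Rightarrow> 'p set \<Rightarrow> 's \<Rightarrow> 's"

type_synonym ('p, 's) ring_presheaf = "('p, 's, unit) presheaf"
type_synonym ('p, 'a, 's) mod_presheaf = "('p, 's, ('a, 's, unit) module_ext) presheaf"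

definition is_presheaf :: "'p topology \<Rightarrow> ('p, 's, 'x) presheaf \<Rightarrow> bool" where
  "is_presheaf X F \<longleftrightarrow>
     (\<forall>U V. openin X U \<longrightarrow> openin X V \<longrightarrow> V \<subseteq> U \<longrightarrow>
        res F U V \<in> carrier (sec F U) \<rightarrow> carrier (sec F V)) \<and>
     (\<forall>U. openin X U \<longrightarrow> (\<forall>s\<in>carrier (sec F U). res F U U s = s)) \<and>
     (\<forall>U V W. openin X U \<longrightarrow> openin X V \<longrightarrow> openin X W \<longrightarrow> W \<subseteq> V \<longrightarrow> V \<subseteq> U \<longrightarrow>
        (\<forall>s\<in>carrier (sec F U). res F V W (res F U V s) = res F U W s))"

definition is_sheaf :: "'p topology \<Rightarrow> ('p, 's, 'x) presheaf \<Rightarrow> bool" where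
  "is_sheaf X F \<longleftrightarrow> is_presheaf X F \<and>
     (\<forall>\<U> s. (\<forall>U\<in>\<U>. openin X U) \<longrightarrow> (\<forall>U\<in>\<U>. s U \<in> carrier (sec F U)) \<longrightarrow>
        (\<forall>U\<in>\<U>. \<forall>V\<in>\<U>. res F U (U \<inter> V) (s U) = res F V (U \<inter> V) (s V)) \<longrightarrow>
        (\<exists>!t. t \<in> carrier (sec F (\<Union>\<U>)) \<and> (\<forall>U\<in>\<U>. res F (\<Union>\<U>) U t = s U)))"

definition sheaf_of_semimodules ::
  "'p topology \<Rightarrow> ('p, 'a) ring_presheaf \<Rightarrow> ('p, 'a, 's) mod_presheaf \<Rightarrow> bool" where
  "sheaf_of_semimodules X OX F \<longleftrightarrow> is_sheaf X F \<and>
     (\<forall>U. openin X U \<longrightarrow> semimodule (sec OX U) (sec F U)) \<and>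
     (\<forall>U V. openin X U \<longrightarrow> openin X V \<longrightarrow> V \<subseteq> U \<longrightarrow>
        res F U V \<zero>\<^bsub>sec F U\<^esub> = \<zero>\<^bsub>sec F V\<^esub> \<and>
        (\<forall>s\<in>carrier (sec F U). \<forall>t\<in>carrier (sec F U).
           res F U V (s \<oplus>\<^bsub>sec F U\<^esub> t) = res F U V s \<oplus>\<^bsub>sec F V\<^esub> res F U V t) \<and>
        (\<forall>a\<in>carrier (sec OX U). \<forall>s\<in>carrier (sec F U).
           res F U V (a \<odot>\<^bsub>sec F U\<^esub> s) = res OX U V a \<odot>\<^bsub>sec F V\<^esub> res F U V s))"

definition sheaf_isomorphic ::
  "'p topology \<Rightarrow> ('p, 'a) ring_presheaf \<Rightarrow>
   ('p, 'a, 's) mod_presheaf \<Rightarrow> ('p, 'a, 't) mod_presheaf \<Rightarrow> bool" where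
  "sheaf_isomorphic X OX F G \<longleftrightarrow> (\<exists>\<phi>.
     (\<forall>U. openin X U \<longrightarrow>
        bij_betw (\<phi> U) (carrier (sec F U)) (carrier (sec G U)) \<and>
        \<phi> U \<zero>\<^bsub>sec F U\<^esub> = \<zero>\<^bsub>sec G U\<^esub> \<and>
        (\<forall>s\<in>carrier (sec F U). \<forall>t\<in>carrier (sec F U).
           \<phi> U (s \<oplus>\<^bsub>sec F U\<^esub> t) = \<phi> U s \<oplus>\<^bsub>sec G U\<^esub> \<phi> U t) \<and>
        (\<forall>a\<in>carrier (sec OX U). \<forall>s\<in>carrier (sec F U).
           \<phi> U (a \<odot>\<^bsub>sec F U\<^esub> s) = a \<odot>\<^bsub>sec G U\<^esub> \<phi> U s)) \<and>
     (\<forall>U V. openin X U \<longrightarrow> openin X V \<longrightarrow> V \<subseteq> U \<longrightarrow>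
        (\<forall>s\<in>carrier (sec F U). \<phi> V (res F U V s) = res G U V (\<phi> U s))))"

definition regular_sheaf :: "('p, 'a) ring_presheaf \<Rightarrow> ('p, 'a, 'a) mod_presheaf" where
  "regular_sheaf OX = \<lparr>sec = (\<lambda>U. regular (sec OX U)), res = res OX\<rparr>"

text \<open>
  The open subsets of the open subspace \<open>U\<close> are open in \<open>X\<close>, so the restriction of a presheaf
  to \<open>U\<close> needs no separate construction.
\<close>

definition invertible_sheaf ::
  "'p topology \<Rightarrow> ('p, 'a) ring_presheaf \<Rightarrow> ('p, 'a, 's) mod_presheaf \<Rightarrow> bool" where
  "invertible_sheaf X OX F \<longleftrightarrow> sheaf_of_semimodules X OX F \<and>
     (\<forall>x\<in>topspace X. \<exists>U. openin X U \<and> x \<in> U \<and>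
        sheaf_isomorphic (subtopology X U) OX F (regular_sheaf OX))"

subsection \<open>Sheafification\<close>

definition germ :: "'p topology \<Rightarrow> ('p, 's, 'x) presheaf \<Rightarrow> 'p \<Rightarrow> 'p set \<Rightarrow> 's \<Rightarrow> ('p set \<times> 's) set"
  where
  "germ X F x U s = {(V, t). openin X V \<and> x \<in> V \<and> t \<in> carrier (sec F V) \<and>
     (\<exists>W. openin X W \<and> x \<in> W \<and> W \<subseteq> U \<inter> V \<and> res F U W s = res F V W t)}"

definition germ_add ::
  "'p topology \<Rightarrow> ('p, 's, 'x) presheaf \<Rightarrow> 'p \<Rightarrow> ('p set \<times> 's) set \<Rightarrow> ('p set \<times> 's) set \<Rightarrow>
   ('p set \<times> 's) set" where
  "germ_add X F x A B = (\<Union>(U, s)\<in>A. \<Union>(V, t)\<in>B.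
     germ X F x (U \<inter> V) (res F U (U \<inter> V) s \<oplus>\<^bsub>sec F (U \<inter> V)\<^esub> res F V (U \<inter> V) t))"

definition germ_smult ::
  "'p topology \<Rightarrow> ('p, 'a) ring_presheaf \<Rightarrow> ('p, 'a, 's) mod_presheaf \<Rightarrow> 'p \<Rightarrow>
   'p set \<Rightarrow> 'a \<Rightarrow> ('p set \<times> 's) set \<Rightarrow> ('p set \<times> 's) set" where
  "germ_smult X OX F x U a B = (\<Union>(V, t)\<in>B.
     germ X F x (U \<inter> V) (res OX U (U \<inter> V) a \<odot>\<^bsub>sec F (U \<inter> V)\<^esub> res F V (U \<inter> V) t))"

definition sheafify ::
  "'p topology \<Rightarrow> ('p, 'a) ring_presheaf \<Rightarrow> ('p, 'a, 's) mod_presheaf \<Rightarrow>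
   ('p, 'a, 'p \<Rightarrow> ('p set \<times> 's) set) mod_presheaf" where
  "sheafify X OX F = \<lparr>
     sec = (\<lambda>U. \<lparr>
       carrier = {\<sigma> \<in> extensional U. \<forall>x\<in>U. \<exists>V t. openin X V \<and> x \<in> V \<and> V \<subseteq> U \<and>
         t \<in> carrier (sec F V) \<and> (\<forall>y\<in>V. \<sigma> y = germ X F y V t)},
       monoid.mult = undefined, one = undefined,
       zero = (\<lambda>x\<in>U. germ X F x U \<zero>\<^bsub>sec F U\<^esub>),
       add = (\<lambda>\<sigma> \<tau>. \<lambda>x\<in>U. germ_add X F x (\<sigma> x) (\<tau> x)),
       smult = (\<lambda>a \<sigma>. \<lambda>x\<in>U. germ_smult X OX F x U a (\<sigma> x))\<rparr>),
     res = (\<lambda>U V \<sigma>. restrict \<sigma> V)\<rparr>"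

definition tensor_presheaf ::
  "('p, 'a) ring_presheaf \<Rightarrow> ('p, 'a, 's) mod_presheaf \<Rightarrow> ('p, 'a, 't) mod_presheaf \<Rightarrow>
   ('p, 'a, ('s \<times> 't) multiset set) mod_presheaf" where
  "tensor_presheaf OX F G = \<lparr>
     sec = (\<lambda>U. tensor_module (sec OX U) (sec F U) (sec G U)),
     res = (\<lambda>U V A. {w. \<exists>u\<in>A. tensor_rel (sec OX V) (sec F V) (sec G V)
       (image_mset (map_prod (res F U V) (res G U V)) u) w})\<rparr>"

definition tensor_sheaf ::
  "'p topology \<Rightarrow> ('p, 'a) ring_presheaf \<Rightarrow>
   ('p, 'a, 's) mod_presheaf \<Rightarrow> ('p, 'a, 't) mod_presheaf \<Rightarrow>
   ('p, 'a, 'p \<Rightarrow> ('p set \<times> ('s \<times> 't) multiset set) set) mod_presheaf" where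
  "tensor_sheaf X OX F G = sheafify X OX (tensor_presheaf OX F G)"


section \<open>Affine schemes\<close>

definition semiring_ideal :: "('a, 'x) ring_scheme \<Rightarrow> 'a set \<Rightarrow> bool" where
  "semiring_ideal A I \<longleftrightarrow> I \<subseteq> carrier A \<and> \<zero>\<^bsub>A\<^esub> \<in> I \<and>
     (\<forall>x\<in>I. \<forall>y\<in>I. x \<oplus>\<^bsub>A\<^esub> y \<in> I) \<and> (\<forall>a\<in>carrier A. \<forall>x\<in>I. a \<otimes>\<^bsub>A\<^esub> x \<in> I)"

definition primes :: "('a, 'x) ring_scheme \<Rightarrow> 'a set set" where
  "primes A = {P. semiring_ideal A P \<and> P \<noteq> carrier A \<and>
     (\<forall>x\<in>carrier A. \<forall>y\<in>carrier A. x \<otimes>\<^bsub>A\<^esub> y \<in> P \<longrightarrow> x \<in> P \<or> y \<in> P)}"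

definition Spec :: "('a, 'x) ring_scheme \<Rightarrow> 'a set topology" where
  "Spec A = topology_generated_by {{P \<in> primes A. f \<notin> P} | f. f \<in> carrier A}"

subsection \<open>Localization\<close>

text \<open>
  For a multiplicative subset \<open>T\<close> of \<open>A\<close>, the fraction \<open>n/f\<close> in \<open>T\<^sup>-\<^sup>1N\<close> is represented by
  the set of all pairs equivalent to \<open>(n, f)\<close>.
\<close>

definition frac :: "('a, 'x) ring_scheme \<Rightarrow> 'a set \<Rightarrow> ('a, 'b, 'y) module_scheme \<Rightarrow>
    'b \<Rightarrow> 'a \<Rightarrow> ('b \<times> 'a) set" where
  "frac A T N n f = {(n', f'). n' \<in> carrier N \<and> f' \<in> T \<and>
     (\<exists>u\<in>T. (u \<otimes>\<^bsub>A\<^esub> f') \<odot>\<^bsub>N\<^esub> n = (u \<otimes>\<^bsub>A\<^esub> f) \<odot>\<^bsub>N\<^esub> n')}"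

definition loc_module :: "('a, 'x) ring_scheme \<Rightarrow> 'a set \<Rightarrow> ('a, 'b, 'y) module_scheme \<Rightarrow>
    (('a \<times> 'a) set, ('b \<times> 'a) set) module" where
  "loc_module A T N = \<lparr>
     carrier = {frac A T N n f | n f. n \<in> carrier N \<and> f \<in> T},
     monoid.mult = undefined, one = undefined,
     zero = frac A T N \<zero>\<^bsub>N\<^esub> \<one>\<^bsub>A\<^esub>,
     add = (\<lambda>\<xi> \<eta>. \<Union>(n, f)\<in>\<xi>. \<Union>(n', f')\<in>\<eta>.
       frac A T N (f' \<odot>\<^bsub>N\<^esub> n \<oplus>\<^bsub>N\<^esub> f \<odot>\<^bsub>N\<^esub> n') (f \<otimes>\<^bsub>A\<^esub> f')),
     smult = (\<lambda>\<alpha> \<xi>. \<Union>(a, g)\<in>\<alpha>. \<Union>(n, f)\<in>\<xi>. frac A T N (a \<odot>\<^bsub>N\<^esub> n) (g \<otimes>\<^bsub>A\<^esub> f))\<rparr>"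

definition loc_ring :: "('a, 'x) ring_scheme \<Rightarrow> 'a set \<Rightarrow> ('a \<times> 'a) set ring" where
  "loc_ring A T = (let L = loc_module A T (regular A) in
     \<lparr>carrier = carrier L, monoid.mult = smult L, one = frac A T (regular A) \<one>\<^bsub>A\<^esub> \<one>\<^bsub>A\<^esub>,
      zero = zero L, add = add L\<rparr>)"

subsection \<open>The sheaf of a semimodule and the structure sheaf\<close>

text \<open>
  Sections over \<open>U\<close> are the functions assigning to \<open>P \<in> U\<close> an element of the localization at
  \<open>P\<close> that are locally given by a single fraction.
\<close>

definition assoc_sheaf :: "('a, 'x) ring_scheme \<Rightarrow> ('a, 'b, 'y) module_scheme \<Rightarrow>
    ('a set, 'a set \<Rightarrow> ('a \<times> 'a) set, 'a set \<Rightarrow> ('b \<times> 'a) set) mod_presheaf" where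
  "assoc_sheaf A N = \<lparr>
     sec = (\<lambda>U. \<lparr>
       carrier = {s \<in> \<Pi>\<^sub>E P\<in>U. carrier (loc_module A (carrier A - P) N).
         \<forall>P\<in>U. \<exists>V n f. openin (Spec A) V \<and> P \<in> V \<and> V \<subseteq> U \<and> n \<in> carrier N \<and> f \<in> carrier A \<and>
           (\<forall>Q\<in>V. f \<notin> Q \<and> s Q = frac A (carrier A - Q) N n f)},
       monoid.mult = undefined, one = undefined,
       zero = (\<lambda>P\<in>U. \<zero>\<^bsub>loc_module A (carrier A - P) N\<^esub>),
       add = (\<lambda>s t. \<lambda>P\<in>U. s P \<oplus>\<^bsub>loc_module A (carrier A - P) N\<^esub> t P),
       smult = (\<lambda>a s. \<lambda>P\<in>U. a P \<odot>\<^bsub>loc_module A (carrier A - P) N\<^esub> s P)\<rparr>),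
     res = (\<lambda>U V s. restrict s V)\<rparr>"

definition Spec_sheaf :: "('a, 'x) ring_scheme \<Rightarrow>
    ('a set, 'a set \<Rightarrow> ('a \<times> 'a) set) ring_presheaf" where
  "Spec_sheaf A = \<lparr>
     sec = (\<lambda>U. \<lparr>
       carrier = carrier (sec (assoc_sheaf A (regular A)) U),
       monoid.mult = (\<lambda>s t. \<lambda>P\<in>U. s P \<otimes>\<^bsub>loc_ring A (carrier A - P)\<^esub> t P),
       one = (\<lambda>P\<in>U. \<one>\<^bsub>loc_ring A (carrier A - P)\<^esub>),
       zero = (\<lambda>P\<in>U. \<zero>\<^bsub>loc_ring A (carrier A - P)\<^esub>),
       add = (\<lambda>s t. \<lambda>P\<in>U. s P \<oplus>\<^bsub>loc_ring A (carrier A - P)\<^esub> t P)\<rparr>),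
     res = (\<lambda>U V s. restrict s V)\<rparr>"


section \<open>Projective space\<close>

subsection \<open>The graded pieces of the localizations of the polynomial semiring\<close>

text \<open>
  Let \<open>S = M[x\<^sub>0,\<dots>,x\<^sub>n]\<close>.  Monomials are cancellable in \<open>S\<close>, so the localization of \<open>S\<close> at \<open>\<Prod>j\<in>J. x\<^sub>j\<close> consists of the Laurent polynomials
  in \<open>x\<^sub>0,\<dots>,x\<^sub>n\<close> in which only the variables with index in \<open>J\<close> have negative exponents; see
  the lemma \<open>hom_loc_iff\<close> below.  \<open>hom_loc n J d\<close> is the set of its homogeneous
  elements of degree \<open>d\<close>.  In particular \<open>hom_loc n {i} 0\<close> is \<open>M[x\<^sub>0/x\<^sub>i,\<dots>,x\<^sub>n/x\<^sub>i]\<close>.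
\<close>

type_synonym 'm laurent = "(nat \<Rightarrow>\<^sub>0 int) \<Rightarrow>\<^sub>0 'm"

definition hom_loc :: "nat \<Rightarrow> nat set \<Rightarrow> int \<Rightarrow> 'm::comm_semiring_1 laurent set" where
  "hom_loc n J d = {f. \<forall>e\<in>Poly_Mapping.keys f. Poly_Mapping.keys e \<subseteq> {..n} \<and>
     (\<forall>k. k \<notin> J \<longrightarrow> 0 \<le> Poly_Mapping.lookup e k) \<and> (\<Sum>k\<le>n. Poly_Mapping.lookup e k) = d}"

lemma keys_monomial_times:
  fixes f :: "'m::comm_semiring_1 laurent"
  shows "Poly_Mapping.keys (Poly_Mapping.single c 1 * f) = (+) c ` Poly_Mapping.keys f"
proof -
  have l: "Poly_Mapping.lookup (Poly_Mapping.single c 1 * f) (c + e) = Poly_Mapping.lookup f e"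
    for e
  proof -
    have "Poly_Mapping.lookup (Poly_Mapping.single c 1 * f) (c + e)
      = (\<Sum>l. Poly_Mapping.lookup (Poly_Mapping.single c (1::'m)) l *
          (\<Sum>q. Poly_Mapping.lookup f q when c + e = l + q))"
      by (simp add: times_poly_mapping.rep_eq prod_fun_def)
    also have "\<dots> = (\<Sum>l. (\<Sum>q. Poly_Mapping.lookup f q when c + e = l + q) when c = l)"
      by (intro Sum_any.cong) (simp add: lookup_single when_def)
    also have "\<dots> = (\<Sum>q. Poly_Mapping.lookup f q when e = q)"
      by simp
    finally show ?thesis by simp
  qed
  have "e \<in> Poly_Mapping.keys (Poly_Mapping.single c 1 * f) \<longleftrightarrow> e - c \<in> Poly_Mapping.keys f" for e
    using l[of "e - c"] by (simp add: in_keys_iff)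
  then show ?thesis
    by (force simp: image_iff intro: bexI[of _ "_ - c"])
qed

text \<open>
  An element of degree \<open>d\<close> in the localization is \<open>g / (\<Prod>j\<in>J. x\<^sub>j)\<^sup>k\<close> for a polynomial \<open>g\<close>.
\<close>

lemma hom_loc_iff:
  fixes f :: "'m::comm_semiring_1 laurent"
  assumes J: "J \<subseteq> {..n}"
  defines "x \<equiv> \<lambda>k. Poly_Mapping.single (\<Sum>j\<in>J. Poly_Mapping.single j (int k)) (1::'m)"
  shows "f \<in> hom_loc n J d \<longleftrightarrow> (\<exists>k. x k * f \<in> hom_loc n {} (d + int k * int (card J)))"
proof -
  define c where "c k = (\<Sum>j\<in>J. Poly_Mapping.single j (int k))" for k
  have fin: "finite J" using J finite_subset by blast
  have lc: "Poly_Mapping.lookup (c k) i = (if i \<in> J then int k else 0)" for k i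
    using fin by (simp add: c_def lookup_sum lookup_single when_def)
  have keysc: "Poly_Mapping.keys (c k) \<subseteq> {..n}" for k
    using J by (auto simp: in_keys_iff lc split: if_splits)
  have sumc: "(\<Sum>i\<le>n. Poly_Mapping.lookup (c k) i) = int k * int (card J)" for k
  proof -
    have "(\<Sum>i\<le>n. Poly_Mapping.lookup (c k) i) = (\<Sum>i\<in>{..n} \<inter> J. int k)"
      by (simp add: lc sum.If_cases Int_def)
    also have "{..n} \<inter> J = J" using J by blast
    finally show ?thesis by (simp add: mult.commute)
  qed
  have kk: "Poly_Mapping.keys (c k + e) \<subseteq> {..n} \<longleftrightarrow> Poly_Mapping.keys e \<subseteq> {..n}" for k e
    using J by (fastforce simp: in_keys_iff lookup_add lc subset_iff split: if_splits)
  have x: "x k * f \<in> hom_loc n {} (d + int k * int (card J)) \<longleftrightarrow>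
     (\<forall>e\<in>Poly_Mapping.keys f. Poly_Mapping.keys e \<subseteq> {..n} \<and>
        (\<forall>i. 0 \<le> Poly_Mapping.lookup (c k) i + Poly_Mapping.lookup e i) \<and>
        (\<Sum>i\<le>n. Poly_Mapping.lookup e i) = d)" for k
    by (auto simp: x_def hom_loc_def c_def[symmetric] keys_monomial_times kk lookup_add
        sum.distrib sumc)
  show ?thesis
  proof
    assume f: "f \<in> hom_loc n J d"
    define S where "S = (\<Union>e\<in>Poly_Mapping.keys f. Poly_Mapping.lookup e ` Poly_Mapping.keys e)"
    have "finite S" by (simp add: S_def)
    then obtain b where b: "\<And>s. s \<in> S \<Longrightarrow> b \<le> s"
      by (metis Min_le)
    have "0 \<le> Poly_Mapping.lookup (c (nat (- b))) i + Poly_Mapping.lookup e i"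
      if e: "e \<in> Poly_Mapping.keys f" for e i
    proof (cases "i \<in> J")
      case True
      show ?thesis
      proof (cases "i \<in> Poly_Mapping.keys e")
        case True
        then have "b \<le> Poly_Mapping.lookup e i" using e b by (auto simp: S_def)
        then show ?thesis using \<open>i \<in> J\<close> by (simp add: lc)
      next
        case False
        then show ?thesis by (simp add: lc in_keys_iff)
      qed
    next
      case False
      then show ?thesis using f e by (auto simp: lc hom_loc_def)
    qed
    with f have "x (nat (- b)) * f \<in> hom_loc n {} (d + int (nat (- b)) * int (card J))"
      unfolding x by (auto simp: hom_loc_def)
    then show "\<exists>k. x k * f \<in> hom_loc n {} (d + int k * int (card J))" ..
  next
    assume "\<exists>k. x k * f \<in> hom_loc n {} (d + int k * int (card J))"
    then obtain k where "x k * f \<in> hom_loc n {} (d + int k * int (card J))" ..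
    then show "f \<in> hom_loc n J d"
      unfolding x by (fastforce simp: hom_loc_def lc split: if_splits)
  qed
qed

definition chart_ring :: "nat \<Rightarrow> nat set \<Rightarrow> 'm::comm_semiring_1 laurent ring" where
  "chart_ring n J = \<lparr>carrier = hom_loc n J 0, monoid.mult = (*), one = 1, zero = 0, add = (+)\<rparr>"

definition chart_module ::
  "nat \<Rightarrow> int \<Rightarrow> nat set \<Rightarrow> ('m::comm_semiring_1 laurent, 'm laurent) module" where
  "chart_module n d J = \<lparr>carrier = hom_loc n J d, monoid.mult = undefined, one = undefined,
     zero = 0, add = (+), smult = (*)\<rparr>"

subsection \<open>Gluing the charts\<close>

text \<open>
  The spaces \<open>Spec (chart_ring n {i})\<close> and \<open>Spec (chart_ring n {j})\<close> are glued along
  \<open>Spec (chart_ring n {i, j})\<close>, which embeds into both of them by contraction of prime ideals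
  as the basic open subset given by \<open>x\<^sub>j/x\<^sub>i\<close> and \<open>x\<^sub>i/x\<^sub>j\<close>, respectively.  Points of
  projective space are equivalence classes of pairs \<open>(i, P)\<close>.
\<close>

definition quotient_top :: "'a topology \<Rightarrow> ('a \<Rightarrow> 'b) \<Rightarrow> 'b topology" where
  "quotient_top X q =
     topology (\<lambda>U. U \<subseteq> q ` topspace X \<and> openin X {x \<in> topspace X. q x \<in> U})"

lemma openin_quotient_top:
  "openin (quotient_top X q) U \<longleftrightarrow> U \<subseteq> q ` topspace X \<and> openin X {x \<in> topspace X. q x \<in> U}"
proof -
  have 1: "{x \<in> topspace X. q x \<in> S \<inter> T} =
      {x \<in> topspace X. q x \<in> S} \<inter> {x \<in> topspace X. q x \<in> T}" for S T
    by auto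
  have 2: "{x \<in> topspace X. q x \<in> \<Union>\<K>} = (\<Union>K\<in>\<K>. {x \<in> topspace X. q x \<in> K})" for \<K>
    by auto
  have "istopology (\<lambda>U. U \<subseteq> q ` topspace X \<and> openin X {x \<in> topspace X. q x \<in> U})"
    unfolding istopology_def 1 2 by blast
  then show ?thesis
    by (simp add: quotient_top_def)
qed

type_synonym 'm ppoint = "(nat \<times> 'm laurent set) set"
type_synonym 'm psection = "nat \<Rightarrow> 'm laurent set \<Rightarrow> ('m laurent \<times> 'm laurent) set"

definition ppoint :: "nat \<Rightarrow> nat \<times> 'm::comm_semiring_1 laurent set \<Rightarrow> 'm ppoint" where
  "ppoint n = (\<lambda>(i, P). {(j, Q). j \<le> n \<and>
     (\<exists>R\<in>primes (chart_ring n {i, j}).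
        P = R \<inter> carrier (chart_ring n {i}) \<and> Q = R \<inter> carrier (chart_ring n {j}))})"

definition proj_space :: "nat \<Rightarrow> 'm::comm_semiring_1 ppoint topology" where
  "proj_space n = quotient_top (sum_topology (\<lambda>i. Spec (chart_ring n {i})) {..n}) (ppoint n)"

definition chart_part :: "nat \<Rightarrow> nat \<Rightarrow> 'm::comm_semiring_1 ppoint set \<Rightarrow> 'm laurent set set" where
  "chart_part n i U = {P \<in> primes (chart_ring n {i}). ppoint n (i, P) \<in> U}"

text \<open>The map \<open>n/f \<mapsto> n/f\<close> from a localization to a localization of a larger semimodule \<open>N\<close>.\<close>

definition loc_map :: "('a, 'x) ring_scheme \<Rightarrow> 'a set \<Rightarrow> ('a, 'b, 'y) module_scheme \<Rightarrow>
    ('b \<times> 'a) set \<Rightarrow> ('b \<times> 'a) set" where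
  "loc_map A T N \<xi> = (\<Union>(n, f)\<in>\<xi>. frac A T N n f)"

text \<open>
  \<open>N J\<close> is a semimodule over \<open>chart_ring n J\<close>.  A section over \<open>U\<close> of the sheaf glued from the
  sheaves associated to \<open>N {i}\<close> is a family of sections over the parts of \<open>U\<close> in the charts
  whose pullbacks to the overlaps agree.
\<close>

definition glued_sections ::
  "nat \<Rightarrow> (nat set \<Rightarrow> ('m::comm_semiring_1 laurent, 'm laurent) module) \<Rightarrow>
   'm ppoint set \<Rightarrow> 'm psection set" where
  "glued_sections n N U =
     {s \<in> \<Pi>\<^sub>E i\<in>{..n}. carrier (sec (assoc_sheaf (chart_ring n {i}) (N {i})) (chart_part n i U)).
       \<forall>i\<le>n. \<forall>j\<le>n. \<forall>R\<in>primes (chart_ring n {i, j}).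
         let P = R \<inter> carrier (chart_ring n {i}); Q = R \<inter> carrier (chart_ring n {j});
             A = chart_ring n {i, j}; T = carrier A - R
         in ppoint n (i, P) \<in> U \<longrightarrow>
           loc_map A T (N {i, j}) (s i P) = loc_map A T (N {i, j}) (s j Q)}"

definition proj_sheaf :: "nat \<Rightarrow> ('m::comm_semiring_1 ppoint, 'm psection) ring_presheaf" where
  "proj_sheaf n = \<lparr>
     sec = (\<lambda>U. let B = (\<lambda>i. sec (Spec_sheaf (chart_ring n {i})) (chart_part n i U)) in \<lparr>
       carrier = glued_sections n (\<lambda>J. regular (chart_ring n J)) U,
       monoid.mult = (\<lambda>s t. \<lambda>i\<in>{..n}. s i \<otimes>\<^bsub>B i\<^esub> t i),
       one = (\<lambda>i\<in>{..n}. \<one>\<^bsub>B i\<^esub>),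
       zero = (\<lambda>i\<in>{..n}. \<zero>\<^bsub>B i\<^esub>),
       add = (\<lambda>s t. \<lambda>i\<in>{..n}. s i \<oplus>\<^bsub>B i\<^esub> t i)\<rparr>),
     res = (\<lambda>U V s. \<lambda>i\<in>{..n}. restrict (s i) (chart_part n i V))\<rparr>"

text \<open>The twisting sheaf \<open>\<O>(d)\<close>.\<close>

definition twisting_sheaf ::
  "nat \<Rightarrow> int \<Rightarrow> ('m::comm_semiring_1 ppoint, 'm psection, 'm psection) mod_presheaf" where
  "twisting_sheaf n d = \<lparr>
     sec = (\<lambda>U. let B = (\<lambda>i. sec (assoc_sheaf (chart_ring n {i}) (chart_module n d {i}))
                              (chart_part n i U)) in \<lparr>
       carrier = glued_sections n (chart_module n d) U,
       monoid.mult = undefined, one = undefined,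
       zero = (\<lambda>i\<in>{..n}. \<zero>\<^bsub>B i\<^esub>),
       add = (\<lambda>s t. \<lambda>i\<in>{..n}. s i \<oplus>\<^bsub>B i\<^esub> t i),
       smult = (\<lambda>a s. \<lambda>i\<in>{..n}. a i \<odot>\<^bsub>B i\<^esub> s i)\<rparr>),
     res = (\<lambda>U V s. \<lambda>i\<in>{..n}. restrict (s i) (chart_part n i V))\<rparr>"

end

(*
  A point is determined by the set T of homogeneous polynomials that do not vanish there, and all
  stalks of all twisting sheaves at that point embed into one localization of the Laurent
  polynomials.  So a section of O(d) is a function on the points that is locally a fraction a/f of
  homogeneous polynomials with deg a - deg f = d, and no chart has to be mentioned.

  (1) Multiplication of such functions is a bilinear pairing O(l) x O(m) -> O(l + m).  Where x_i does
  not vanish, x_i^m generates O(m), so every tensor is of the form s (x) x_i^m, and s is determined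
  by the product s x_i^m.

  (2) For I a nonempty set of variables, the monomials in these variables form the set T of a point
  p_I, because M is a semifield in which sums vanish only trivially.  Every open set that contains
  p_I contains the intersection of the D(x_i) with i in I.  Hence an invertible sheaf is free on
  D(x_i), and the transition function between D(x_i) and D(x_j) is a single fraction, which is
  invertible only if it is c (x_i/x_j)^k.  The cocycle condition forces the exponents of all these
  transition functions to agree, and the scalars c form a coboundary.
*)

theory Submission
  imports Defs
begin

section \<open>Homogeneous Laurent polynomials\<close>

text \<open>Idempotent semirings lack cancellation: a/f = b/g at a point only says u g a = u f b for
  some u outside the prime. To compare stalks from different charts, the denominators are enlarged
  from T to \<open>sat T\<close>, the Laurent polynomials that are quotients of elements of T; the
  stalk of one chart is recovered by intersecting a class with the pairs which that chart admits. To
  turn equal fractions into equal Laurent polynomials, they are read at p_I: there every denominator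
  divides a monomial with invertible coefficient, hence is a unit, and u can be removed. That the
  monomials define a point rests on c + d = 0 forcing c = d = 0: no term of a sum or product
  disappears, so a product is a monomial only if both factors are. The isomorphism from an
  invertible sheaf to O(d) is the graph of a relation: a section s and a function h correspond if on
  every D(x_i) they have the same coordinate with respect to chosen generators. The degree d is the
  exponent of x_1/x_0 in the transition function from D(x_1) to D(x_0).\<close>

definition xpow :: "nat \<Rightarrow> int \<Rightarrow> 'm::comm_semiring_1 laurent" where
  "xpow i k = Poly_Mapping.single (Poly_Mapping.single i k) 1"

lemma xpow_add: "xpow i k * xpow i l = xpow i (k + l)"
  by (simp add: xpow_def mult_single single_add[symmetric])

lemma xpow_0 [simp]: "xpow i 0 = 1"
  by (simp add: xpow_def)

lemma xpow_inverse [simp]: "xpow i k * xpow i (- k) = 1" "xpow i (- k) * xpow i k = 1"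
  by (simp_all add: xpow_add)

lemma xpow_inverse_left [simp]:
  "xpow i k * (xpow i (- k) * f) = f" "xpow i (- k) * (xpow i k * f) = f"
  by (simp_all flip: mult.assoc)

lemma keys_xpow_times:
  "Poly_Mapping.keys (xpow i k * f) = (+) (Poly_Mapping.single i k) ` Poly_Mapping.keys f"
  unfolding xpow_def by (rule keys_monomial_times)

lemma zero_hom_loc [simp]: "0 \<in> hom_loc n J d"
  by (simp add: hom_loc_def)

lemma one_hom_loc [simp]: "1 \<in> hom_loc n J 0"
  by (simp add: hom_loc_def)

lemma hom_loc_add: "f \<in> hom_loc n J d \<Longrightarrow> g \<in> hom_loc n J d \<Longrightarrow> f + g \<in> hom_loc n J d"
  using keys_add[of f g] by (auto simp: hom_loc_def)

lemma hom_loc_mono: "f \<in> hom_loc n J d \<Longrightarrow> J \<subseteq> K \<Longrightarrow> f \<in> hom_loc n K d"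
  by (auto simp: hom_loc_def)

lemma hom_loc_mult:
  assumes f: "f \<in> hom_loc n J d" and g: "g \<in> hom_loc n J' e"
    and "J \<subseteq> K" "J' \<subseteq> K" "c = d + e"
  shows "f * g \<in> hom_loc n K c"
  unfolding hom_loc_def
proof (intro CollectI ballI)
  fix a assume "a \<in> Poly_Mapping.keys (f * g)"
  then obtain b b' where a: "a = b + b'" "b \<in> Poly_Mapping.keys f" "b' \<in> Poly_Mapping.keys g"
    using keys_mult[of f g] by blast
  have b: "Poly_Mapping.keys b \<subseteq> {..n}" "\<forall>k. k \<notin> J \<longrightarrow> 0 \<le> Poly_Mapping.lookup b k"
    "(\<Sum>k\<le>n. Poly_Mapping.lookup b k) = d" using f a(2) by (auto simp: hom_loc_def)
  have b': "Poly_Mapping.keys b' \<subseteq> {..n}" "\<forall>k. k \<notin> J' \<longrightarrow> 0 \<le> Poly_Mapping.lookup b' k"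
    "(\<Sum>k\<le>n. Poly_Mapping.lookup b' k) = e" using g a(3) by (auto simp: hom_loc_def)
  show "Poly_Mapping.keys a \<subseteq> {..n} \<and> (\<forall>k. k \<notin> K \<longrightarrow> 0 \<le> Poly_Mapping.lookup a k) \<and>
      (\<Sum>k\<le>n. Poly_Mapping.lookup a k) = c"
    using b b' keys_add[of b b'] assms(3-5)
    by (auto 4 4 simp: a(1) lookup_add sum.distrib subset_iff intro!: add_nonneg_nonneg)
qed

lemma xpow_hom_loc:
  assumes "i \<le> n" "i \<in> J \<or> 0 \<le> k" shows "xpow i k \<in> hom_loc n J k"
proof -
  have "(\<Sum>j\<le>n. k when i = j) = k" using assms(1) by (simp add: when_def)
  then show ?thesis using assms
    by (auto simp: hom_loc_def xpow_def lookup_single when_def)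
qed

lemma hom_loc_degree_unique:
  assumes "f \<in> hom_loc n J d" "f \<in> hom_loc n J' e" "f \<noteq> 0" shows "d = e"
proof -
  obtain a where "a \<in> Poly_Mapping.keys f" using assms(3)
    by (metis ex_in_conv keys_eq_empty)
  with assms show ?thesis by (auto simp: hom_loc_def)
qed

lemma clear_denominator:
  assumes f: "f \<in> hom_loc n (insert i J) d" and i: "i \<le> n"
  shows "\<exists>k\<ge>0. xpow i k * f \<in> hom_loc n J (k + d)"
proof -
  let ?S = "(\<lambda>e. Poly_Mapping.lookup e i) ` Poly_Mapping.keys f"
  obtain b where b: "\<And>s. s \<in> ?S \<Longrightarrow> b \<le> s" by (metis Min_le finite_imageI finite_keys)
  \<comment> \<open>The absolute value makes k nonnegative and at the same time large enough for k +
    b to be nonnegative.\<close>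
  define k where "k = \<bar>b\<bar>"
  have "Poly_Mapping.keys (Poly_Mapping.single i k + e) \<subseteq> {..n} \<and>
     (\<forall>j. j \<notin> J \<longrightarrow> 0 \<le> Poly_Mapping.lookup (Poly_Mapping.single i k + e) j) \<and>
     (\<Sum>j\<le>n. Poly_Mapping.lookup (Poly_Mapping.single i k + e) j) = k + d"
    if e: "e \<in> Poly_Mapping.keys f" for e
  proof -
    have "b \<le> Poly_Mapping.lookup e i" using b e by blast
    then have 1: "0 \<le> k + Poly_Mapping.lookup e i" by (simp add: k_def)
    have 2: "(\<Sum>j\<le>n. k when i = j) = k" using i by (simp add: when_def)
    have 3: "Poly_Mapping.keys e \<subseteq> {..n}" using f e by (auto simp: hom_loc_def)
    have "Poly_Mapping.keys (Poly_Mapping.single i k + e) \<subseteq> {..n}"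
      using keys_add[of "Poly_Mapping.single i k" e] 3 i by (auto split: if_splits)
    then show ?thesis using f e 1 2
      by (auto simp: hom_loc_def lookup_add sum.distrib lookup_single when_def)
  qed
  then have "xpow i k * f \<in> hom_loc n J (k + d)"
    unfolding hom_loc_def by (auto simp: keys_xpow_times)
  then show ?thesis by (intro exI[of _ k]) (simp add: k_def)
qed

section \<open>Homogeneous primes\<close>

text \<open>
  A point of projective space is encoded by the set \<open>T\<close> of the homogeneous polynomials that do not
  vanish there, so \<open>T\<close> is the set of homogeneous elements outside a homogeneous prime ideal.
\<close>

locale hprime =
  fixes n :: nat and T :: "'m::comm_semiring_1 laurent set"
  assumes hom: "f \<in> T \<Longrightarrow> \<exists>e. f \<in> hom_loc n {} e"
    and one_mem: "1 \<in> T" and zero_notin: "0 \<notin> T"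
    and mult_iff: "f \<in> hom_loc n {} d \<Longrightarrow> g \<in> hom_loc n {} e \<Longrightarrow> f * g \<in> T \<longleftrightarrow> f \<in> T \<and> g \<in> T"
    and add_cases: "f \<in> hom_loc n {} d \<Longrightarrow> g \<in> hom_loc n {} d \<Longrightarrow> f + g \<in> T \<Longrightarrow> f \<in> T \<or> g \<in> T"
    and ex_var: "\<exists>i\<le>n. xpow i 1 \<in> T"

text \<open>These are the Laurent polynomials that become units at the point. Negative powers of the
  variables that do not vanish there are included, so one set of denominators serves all charts
  through the point.\<close>

definition sat :: "'m::comm_semiring_1 laurent set \<Rightarrow> 'm laurent set" where
  "sat T = {f. \<exists>t\<in>T. t * f \<in> T}"

text \<open>The inverse of \<open>nonvanishing\<close>. Allowing several variables in
  \<open>J\<close> treats overlaps of charts in the same way as the charts themselves.\<close>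

definition prime_of :: "nat \<Rightarrow> 'm::comm_semiring_1 laurent set \<Rightarrow> nat set \<Rightarrow> 'm laurent set" where
  "prime_of n T J = {f \<in> hom_loc n J 0. f \<notin> sat T}"

definition charts :: "nat \<Rightarrow> 'm::comm_semiring_1 laurent set \<Rightarrow> nat set" where
  "charts n T = {i. i \<le> n \<and> xpow i 1 \<in> T}"

text \<open>Dividing f by the power of x_i of its own degree moves it into the chart ring. The
  choice of \<open>e\<close> is no ambiguity: only 0 has more than one degree, and 0 lies in every
  prime.\<close>

definition nonvanishing :: "nat \<Rightarrow> nat \<Rightarrow> 'm::comm_semiring_1 laurent set \<Rightarrow> 'm laurent set" where
  "nonvanishing n i P = {f. \<exists>e. f \<in> hom_loc n {} e \<and> xpow i (- e) * f \<notin> P}"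

context hprime
begin

lemma mult_mem: "f \<in> T \<Longrightarrow> g \<in> T \<Longrightarrow> f * g \<in> T"
  by (meson hom mult_iff)

lemma mem_sat: "f \<in> T \<Longrightarrow> f \<in> sat T"
  using one_mem by (auto simp: sat_def intro!: bexI[of _ 1])

lemma one_sat: "1 \<in> sat T"
  by (simp add: mem_sat one_mem)

lemma sat_mult: assumes "f \<in> sat T" "g \<in> sat T" shows "f * g \<in> sat T"
proof -
  obtain t t' where "t \<in> T" "t * f \<in> T" "t' \<in> T" "t' * g \<in> T" using assms by (auto simp: sat_def)
  then show ?thesis unfolding sat_def
    by (intro CollectI bexI[of _ "t * t'"]) (metis mult_mem mult.assoc mult.left_commute)+
qed

text \<open>If t s and t' s f lie in T, then t s t' lies in T and is a witness for f, since (t s t')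
  f = t (t' s f).\<close>

lemma sat_cancel: assumes "s \<in> sat T" shows "s * f \<in> sat T \<longleftrightarrow> f \<in> sat T"
proof
  assume "s * f \<in> sat T"
  then obtain t t' where "t \<in> T" "t * s \<in> T" "t' \<in> T" "t' * (s * f) \<in> T"
    using assms by (auto simp: sat_def)
  then have "(t * s) * t' \<in> T" "((t * s) * t') * f \<in> T"
    by (simp_all add: mult_mem) (metis mult_mem mult.assoc mult.left_commute)
  then show "f \<in> sat T" by (auto simp: sat_def)
qed (simp add: assms sat_mult)

text \<open>On homogeneous polynomials saturation adds nothing, because T contains every homogeneous
  factor of its elements.\<close>

lemma sat_poly: "f \<in> hom_loc n {} e \<Longrightarrow> f \<in> sat T \<longleftrightarrow> f \<in> T"
  using hom mult_iff mem_sat unfolding sat_def by fast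

lemma charts_nonempty: "charts n T \<noteq> {}"
  using ex_var by (auto simp: charts_def)

lemma xpow_mem_nat: "i \<in> charts n T \<Longrightarrow> xpow i (int k) \<in> T"
proof (induction k)
  case (Suc k)
  then have "xpow i 1 * xpow i (int k) \<in> T" by (auto intro: mult_mem simp: charts_def)
  then show ?case by (simp add: xpow_add)
qed (simp add: one_mem)

lemma xpow_mem: "i \<in> charts n T \<Longrightarrow> 0 \<le> k \<Longrightarrow> xpow i k \<in> T"
  using xpow_mem_nat[of i "nat k"] by simp

lemma xpow_sat: assumes "i \<in> charts n T" shows "xpow i k \<in> sat T"
proof (cases "0 \<le> k")
  case True then show ?thesis using assms by (simp add: mem_sat xpow_mem)
next
  case False then show ?thesis using assms xpow_mem[of i "- k"] one_mem
    unfolding sat_def by (intro CollectI bexI[of _ "xpow i (- k)"]) auto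
qed

text \<open>One variable is cleared at a time. The multiplier stays in T because only variables that
  do not vanish at the point have negative exponents.\<close>

lemma clear_denominators:
  assumes "finite J" "J \<subseteq> charts n T" "f \<in> hom_loc n J d"
  shows "\<exists>m e. m \<in> T \<and> m \<in> hom_loc n {} e \<and> m * f \<in> hom_loc n {} (e + d)"
  using assms
proof (induction J arbitrary: f d rule: finite_induct)
  case empty
  then show ?case using one_mem by (intro exI[of _ 1] exI[of _ 0]) simp
next
  case (insert i J)
  have i: "i \<in> charts n T" "i \<le> n" using insert.prems by (auto simp: charts_def)
  obtain k where k: "k \<ge> 0" "xpow i k * f \<in> hom_loc n J (k + d)"
    using clear_denominator insert.prems(2) i by blast
  obtain m e where m: "m \<in> T" "m \<in> hom_loc n {} e" "m * (xpow i k * f) \<in> hom_loc n {} (e + (k + d))"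
    using insert.IH[OF _ k(2)] insert.prems by auto
  have "m * xpow i k \<in> T" "m * xpow i k \<in> hom_loc n {} (e + k)"
    using m k i by (auto intro: mult_mem xpow_mem hom_loc_mult xpow_hom_loc)
  then show ?case using m(3) by (intro exI[of _ "m * xpow i k"] exI[of _ "e + k"]) (simp add: ac_simps)
qed

lemma finite_charts: "J \<subseteq> charts n T \<Longrightarrow> finite J"
  by (rule finite_subset[of _ "{..n}"]) (auto simp: charts_def)

text \<open>The axioms on T speak of polynomials only. A common multiplier carries them over to sums
  and products of Laurent polynomials.\<close>

lemma clear_denominators2:
  assumes "J \<subseteq> charts n T" "f \<in> hom_loc n J d" "g \<in> hom_loc n J d'"
  shows "\<exists>m e. m \<in> T \<and> m \<in> hom_loc n {} e \<and> m * f \<in> hom_loc n {} (e + d) \<and> m * g \<in> hom_loc n {} (e + d')"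
proof -
  note fin = finite_charts[OF assms(1)]
  obtain m e where m: "m \<in> T" "m \<in> hom_loc n {} e" "m * f \<in> hom_loc n {} (e + d)"
    using clear_denominators[OF fin assms(1,2)] by blast
  obtain m' e' where m': "m' \<in> T" "m' \<in> hom_loc n {} e'" "m' * g \<in> hom_loc n {} (e' + d')"
    using clear_denominators[OF fin assms(1,3)] by blast
  have "m * m' * f = m' * (m * f)" "m * m' * g = m * (m' * g)" by (simp_all add: ac_simps)
  then show ?thesis
    using m m' by (intro exI[of _ "m * m'"] exI[of _ "e + e'"])
      (auto intro: mult_mem hom_loc_mult)
qed

lemma sat_add_cases:
  assumes "J \<subseteq> charts n T" "f \<in> hom_loc n J d" "g \<in> hom_loc n J d" "f + g \<in> sat T"
  shows "f \<in> sat T \<or> g \<in> sat T"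
proof -
  obtain m e where m: "m \<in> T" "m \<in> hom_loc n {} e" "m * f \<in> hom_loc n {} (e + d)"
      "m * g \<in> hom_loc n {} (e + d)"
    using clear_denominators2[OF assms(1-3)] by blast
  have "m * f + m * g \<in> sat T"
    using sat_cancel[OF mem_sat[OF m(1)], of "f + g"] assms(4) by (simp add: distrib_left)
  then have "m * f + m * g \<in> T" using sat_poly hom_loc_add m(3,4) by blast
  then have "m * f \<in> T \<or> m * g \<in> T" using add_cases m(3,4) by blast
  then show ?thesis using m(1) by (auto simp: sat_def)
qed

lemma sat_mult_left:
  assumes "J \<subseteq> charts n T" "f \<in> hom_loc n J d" "g \<in> hom_loc n J d'" "f * g \<in> sat T"
  shows "f \<in> sat T"
proof -
  obtain m e where m: "m \<in> T" "m \<in> hom_loc n {} e" "m * f \<in> hom_loc n {} (e + d)"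
      "m * g \<in> hom_loc n {} (e + d')"
    using clear_denominators2[OF assms(1-3)] by blast
  have "(m * f) * (m * g) = m * (m * (f * g))" by (simp add: ac_simps)
  then have "(m * f) * (m * g) \<in> sat T"
    using sat_cancel[OF mem_sat[OF m(1)]] assms(4) by simp
  then have "(m * f) * (m * g) \<in> T"
    by (subst (asm) sat_poly[OF hom_loc_mult[OF m(3,4) subset_refl subset_refl HOL.refl]])
  then have "m * f \<in> T" using mult_iff m(3,4) by blast
  then show ?thesis using m(1) by (auto simp: sat_def)
qed

lemma sat_mult_iff:
  assumes "J \<subseteq> charts n T" "f \<in> hom_loc n J d" "g \<in> hom_loc n J d'"
  shows "f * g \<in> sat T \<longleftrightarrow> f \<in> sat T \<and> g \<in> sat T"
  using sat_mult sat_mult_left[OF assms] sat_mult_left[OF assms(1,3,2)] by (auto simp: mult.commute)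

lemma zero_notin_sat: "0 \<notin> sat T"
  by (simp add: sat_def zero_notin)

lemma prime_of_primes: assumes J: "J \<subseteq> charts n T" shows "prime_of n T J \<in> primes (chart_ring n J)"
proof -
  have "f * g \<in> prime_of n T J" if "f \<in> hom_loc n J 0" "g \<in> prime_of n T J" for f g
    using that sat_mult_iff[OF J, of f 0 g 0] hom_loc_mult[of f n J 0 g J 0 J 0]
    by (auto simp: prime_of_def)
  moreover have "f + g \<in> prime_of n T J" if "f \<in> prime_of n T J" "g \<in> prime_of n T J" for f g
    using that sat_add_cases[OF J, of f 0 g] by (auto simp: prime_of_def hom_loc_add)
  moreover have "prime_of n T J \<noteq> hom_loc n J 0"
    using one_sat one_hom_loc[of n J] unfolding prime_of_def by blast
  ultimately show ?thesis
    using sat_mult by (auto simp: primes_def semiring_ideal_def chart_ring_def prime_of_def zero_notin_sat)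
qed

lemma nonvanishing_prime_of:
  assumes i: "i \<in> charts n T" shows "nonvanishing n i (prime_of n T {i}) = T"
proof -
  have "f \<in> nonvanishing n i (prime_of n T {i}) \<longleftrightarrow> f \<in> T" if f: "f \<in> hom_loc n {} e" for f e
  proof -
    have 1: "xpow i (- d) * f \<in> hom_loc n {i} 0" if "f \<in> hom_loc n {} d" for d
      using i by (intro hom_loc_mult[OF xpow_hom_loc that, of i "{i}"]) (auto simp: charts_def)
    show ?thesis
      using f 1 by (auto simp: nonvanishing_def prime_of_def sat_cancel[OF xpow_sat[OF i]] sat_poly)
  qed
  then show ?thesis using hom unfolding nonvanishing_def by blast
qed

end

section \<open>Primes of the chart rings and of their overlaps\<close>

locale chart_prime =
  fixes n :: nat and J :: "nat set" and R :: "'m::comm_semiring_1 laurent set"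
  assumes J: "J \<subseteq> {..n}" and R: "R \<in> primes (chart_ring n J)"
begin

lemma R_zero: "0 \<in> R" and R_add: "f \<in> R \<Longrightarrow> g \<in> R \<Longrightarrow> f + g \<in> R"
  and R_sub: "f \<in> R \<Longrightarrow> f \<in> hom_loc n J 0"
  using R by (auto simp: primes_def semiring_ideal_def chart_ring_def)

lemma R_mult: "f \<in> hom_loc n J 0 \<Longrightarrow> g \<in> hom_loc n J 0 \<Longrightarrow> f * g \<in> R \<longleftrightarrow> f \<in> R \<or> g \<in> R"
  using R by (auto simp: primes_def semiring_ideal_def chart_ring_def mult.commute[of f])

lemma R_one: "1 \<notin> R"
proof
  assume 1: "1 \<in> R"
  have "f \<in> R" if "f \<in> hom_loc n J 0" for f using R_mult[OF that one_hom_loc] 1 by simp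
  then show False using R by (auto simp: primes_def semiring_ideal_def chart_ring_def)
qed

lemma R_unit: assumes "f \<in> hom_loc n J 0" "g \<in> hom_loc n J 0" "f * g = 1" shows "f \<notin> R"
  using R_mult[OF assms(1,2)] assms(3) R_one by auto

lemma degree0: "i \<in> J \<Longrightarrow> f \<in> hom_loc n {} e \<Longrightarrow> xpow i (- e) * f \<in> hom_loc n J 0"
  using J by (intro hom_loc_mult[OF xpow_hom_loc, of i n J]) auto

lemma nonvanishing_iff:
  "f \<in> hom_loc n {} e \<Longrightarrow> f \<in> nonvanishing n i R \<longleftrightarrow> xpow i (- e) * f \<notin> R"
  using hom_loc_degree_unique R_zero unfolding nonvanishing_def by fastforce

text \<open>The two elements differ by the factor (x_i/x_j)^e, which is a unit of the chart ring
  when both variables are inverted. Hence \<open>nonvanishing\<close> does not depend on the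
  variable used for normalization.\<close>

lemma xpow_diff: assumes "i \<in> J" "j \<in> J" "f \<in> hom_loc n {} e"
  shows "xpow i (- e) * f \<in> R \<longleftrightarrow> xpow j (- e) * f \<in> R"
proof -
  have u: "xpow j (- e) * xpow i e \<in> hom_loc n J 0" "xpow i (- e) * xpow j e \<in> hom_loc n J 0"
    using assms J by (auto intro!: hom_loc_mult xpow_hom_loc)
  have "(xpow j (- e) * xpow i e) * (xpow i (- e) * xpow j e) =
      (xpow j (- e) * xpow j e) * (xpow i e * xpow i (- e))" by (simp only: ac_simps)
  then have "xpow j (- e) * xpow i e \<notin> R" using R_unit[OF u] by simp
  moreover have "xpow j (- e) * f = (xpow j (- e) * xpow i e) * (xpow i (- e) * f)"
    by (simp add: mult.assoc)
  ultimately show ?thesis using R_mult[OF u(1) degree0[OF assms(1,3)]] by simp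
qed

lemma nonvanishing_eq: "i \<in> J \<Longrightarrow> j \<in> J \<Longrightarrow> nonvanishing n i R = nonvanishing n j R"
  using xpow_diff unfolding nonvanishing_def by blast

lemma nonvanishing_var: assumes "i \<in> J" shows "xpow i 1 \<in> nonvanishing n i R"
  using assms J R_one nonvanishing_iff[OF xpow_hom_loc, of i 1 i] by auto

lemma hprime_nonvanishing: assumes i: "i \<in> J" shows "hprime n (nonvanishing n i R)"
proof
  show "f \<in> nonvanishing n i R \<Longrightarrow> \<exists>e. f \<in> hom_loc n {} e" for f
    by (auto simp: nonvanishing_def)
  show "1 \<in> nonvanishing n i R" using nonvanishing_iff[OF one_hom_loc, of i] R_one by simp
  show "0 \<notin> nonvanishing n i R" using R_zero by (simp add: nonvanishing_def)
  show "f * g \<in> nonvanishing n i R \<longleftrightarrow> f \<in> nonvanishing n i R \<and> g \<in> nonvanishing n i R"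
    if f: "f \<in> hom_loc n {} d" and g: "g \<in> hom_loc n {} e" for f g d e
  proof -
    have "xpow i (- (d + e)) = (xpow i (- d) * xpow i (- e) :: 'm laurent)" by (simp add: xpow_add)
    then have "xpow i (- (d + e)) * (f * g) = (xpow i (- d) * f) * (xpow i (- e) * g)"
      by (simp only: mult.assoc mult.left_commute)
    then show ?thesis
      using nonvanishing_iff[OF f] nonvanishing_iff[OF g]
        nonvanishing_iff[OF hom_loc_mult[OF f g subset_refl subset_refl HOL.refl]]
        R_mult[OF degree0[OF i f] degree0[OF i g]] by simp
  qed
  show "f \<in> nonvanishing n i R \<or> g \<in> nonvanishing n i R"
    if "f \<in> hom_loc n {} d" "g \<in> hom_loc n {} d" "f + g \<in> nonvanishing n i R" for f g d
    using nonvanishing_iff[OF that(1)] nonvanishing_iff[OF that(2)]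
      nonvanishing_iff[OF hom_loc_add[OF that(1,2)]] that(3)
      R_add[of "xpow i (- d) * f" "xpow i (- d) * g"] by (auto simp: distrib_left)
  show "\<exists>j\<le>n. xpow j 1 \<in> nonvanishing n i R" using i J nonvanishing_var by blast
qed

lemma charts_nonvanishing: assumes "i \<in> J" shows "J \<subseteq> charts n (nonvanishing n i R)"
  using J nonvanishing_var nonvanishing_eq[OF assms] by (auto simp: charts_def)

text \<open>Some m in T turns f into a polynomial m f, whose membership in T is decided by x_i^(-e)
  m f. The factor x_i^(-e) m lies outside \<open>R\<close>, so primality leaves just the question
  whether f lies in \<open>R\<close>.\<close>

lemma prime_of_nonvanishing: assumes i: "i \<in> J" shows "prime_of n (nonvanishing n i R) J = R"
proof -
  interpret hprime n "nonvanishing n i R" by (rule hprime_nonvanishing[OF i])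
  note c = charts_nonvanishing[OF i]
  have "f \<in> sat (nonvanishing n i R) \<longleftrightarrow> f \<notin> R" if f: "f \<in> hom_loc n J 0" for f
  proof -
    obtain m e where m: "m \<in> nonvanishing n i R" "m \<in> hom_loc n {} e" "m * f \<in> hom_loc n {} (e + 0)"
      using clear_denominators[OF finite_charts[OF c] c f] by blast
    have "f \<in> sat (nonvanishing n i R) \<longleftrightarrow> m * f \<in> nonvanishing n i R"
      using sat_cancel[OF mem_sat[OF m(1)]] sat_poly[OF m(3)] by simp
    also have "\<dots> \<longleftrightarrow> (xpow i (- e) * m) * f \<notin> R"
      using nonvanishing_iff[OF m(3)] by (simp add: mult.assoc)
    also have "\<dots> \<longleftrightarrow> f \<notin> R"
      using R_mult[OF degree0[OF i m(2)] f] m(1) nonvanishing_iff[OF m(2)] by simp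
    finally show ?thesis .
  qed
  then show ?thesis using R_sub by (auto simp: prime_of_def)
qed

text \<open>The normalized polynomials that are tested involve only negative powers of x_i, so
  contracting the prime to chart i loses no information.\<close>

lemma nonvanishing_contract: "i \<in> J \<Longrightarrow> nonvanishing n i (R \<inter> hom_loc n {i} 0) = nonvanishing n i R"
proof -
  assume i: "i \<in> J"
  have "xpow i (- e) * f \<in> hom_loc n {i} 0" if "f \<in> hom_loc n {} e" for f e
    using i J by (intro hom_loc_mult[OF xpow_hom_loc that, of i "{i}"]) auto
  then show ?thesis by (auto simp: nonvanishing_def)
qed

lemma contract_primes: assumes "i \<in> J" shows "R \<inter> hom_loc n {i} 0 \<in> primes (chart_ring n {i})"
proof -
  have K: "f \<in> hom_loc n {i} 0 \<Longrightarrow> f \<in> hom_loc n J 0" for f using assms hom_loc_mono by blast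
  have "f * g \<in> hom_loc n {i} 0" if "f \<in> hom_loc n {i} 0" "g \<in> hom_loc n {i} 0" for f g
    using hom_loc_mult that by fastforce
  then show ?thesis
    using R_mult[OF K K] R_add R_zero R_one
    by (auto simp: primes_def semiring_ideal_def chart_ring_def hom_loc_add)
qed

end

section \<open>Points and open sets of projective space\<close>

text \<open>All members (i, P) of a point have the same nonvanishing set, so the union is that
  common set and no representative has to be chosen.\<close>

definition nonzero_at :: "nat \<Rightarrow> 'm::comm_semiring_1 ppoint \<Rightarrow> 'm laurent set" where
  "nonzero_at n p = (\<Union>(i, P)\<in>p. nonvanishing n i P)"

lemma carrier_chart_ring [simp]: "carrier (chart_ring n J) = hom_loc n J 0"
  by (simp add: chart_ring_def)

lemma chart_prime_single: "i \<le> n \<Longrightarrow> P \<in> primes (chart_ring n {i}) \<Longrightarrow> chart_prime n {i} P"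
  by unfold_locales auto

text \<open>This replaces gluing by an equality of sets, which makes it visibly an equivalence
  relation. For the converse direction, the prime of the overlap is \<open>prime_of\<close> of the
  common nonvanishing set, and its contractions are \<open>P\<close> and \<open>Q\<close> because
  these are recovered from that set.\<close>

lemma glued_iff_nonvanishing_eq:
  assumes i: "i \<le> n" "P \<in> primes (chart_ring n {i})" and j: "j \<le> n" "Q \<in> primes (chart_ring n {j})"
  shows "(\<exists>R\<in>primes (chart_ring n {i, j}). P = R \<inter> hom_loc n {i} 0 \<and> Q = R \<inter> hom_loc n {j} 0) \<longleftrightarrow>
    nonvanishing n j Q = nonvanishing n i P"
proof
  assume "\<exists>R\<in>primes (chart_ring n {i, j}). P = R \<inter> hom_loc n {i} 0 \<and> Q = R \<inter> hom_loc n {j} 0"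
  then obtain R where R: "R \<in> primes (chart_ring n {i, j})" "P = R \<inter> hom_loc n {i} 0"
    "Q = R \<inter> hom_loc n {j} 0" by blast
  interpret R: chart_prime n "{i, j}" R using i j R by unfold_locales auto
  show "nonvanishing n j Q = nonvanishing n i P"
    using R.nonvanishing_contract[of i] R.nonvanishing_contract[of j] R.nonvanishing_eq[of i j]
    by (simp add: R)
next
  assume eq: "nonvanishing n j Q = nonvanishing n i P"
  interpret P: chart_prime n "{i}" P by (rule chart_prime_single) fact+
  interpret Q: chart_prime n "{j}" Q by (rule chart_prime_single) fact+
  interpret hprime n "nonvanishing n i P" by (rule P.hprime_nonvanishing) simp
  have "{i, j} \<subseteq> charts n (nonvanishing n i P)"
    using P.charts_nonvanishing[of i] Q.charts_nonvanishing[of j] eq by auto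
  then have "prime_of n (nonvanishing n i P) {i, j} \<in> primes (chart_ring n {i, j})"
    by (rule prime_of_primes)
  moreover have "prime_of n (nonvanishing n i P) {i, j} \<inter> hom_loc n {i} 0 = prime_of n (nonvanishing n i P) {i}"
    "prime_of n (nonvanishing n i P) {i, j} \<inter> hom_loc n {j} 0 = prime_of n (nonvanishing n j Q) {j}"
    unfolding eq prime_of_def using hom_loc_mono[of _ n "{i}" 0 "{i, j}"] hom_loc_mono[of _ n "{j}" 0 "{i, j}"]
    by auto
  ultimately show "\<exists>R\<in>primes (chart_ring n {i, j}). P = R \<inter> hom_loc n {i} 0 \<and> Q = R \<inter> hom_loc n {j} 0"
    using P.prime_of_nonvanishing[of i] Q.prime_of_nonvanishing[of j] by (metis insertI1)
qed

lemma ppoint_eq: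
  assumes "i \<le> n" "P \<in> primes (chart_ring n {i})"
  shows "ppoint n (i, P) =
    {(j, Q). j \<le> n \<and> Q \<in> primes (chart_ring n {j}) \<and> nonvanishing n j Q = nonvanishing n i P}"
proof -
  have "Q \<in> primes (chart_ring n {j})"
    if "j \<le> n" "R \<in> primes (chart_ring n {i, j})" "Q = R \<inter> hom_loc n {j} 0" for j Q R
  proof -
    interpret R: chart_prime n "{i, j}" R using assms that by unfold_locales auto
    show ?thesis using R.contract_primes[of j] that by simp
  qed
  then show ?thesis
    using glued_iff_nonvanishing_eq[OF assms] unfolding ppoint_def by fastforce
qed

lemma nonzero_at_ppoint:
  assumes "i \<le> n" "P \<in> primes (chart_ring n {i})"
  shows "nonzero_at n (ppoint n (i, P)) = nonvanishing n i P"
  using assms by (auto simp: nonzero_at_def ppoint_eq)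

text \<open>The generating sets D(f) are closed under binary intersections, D(f) and D(g) meeting in
  D(f g), so they are a base and not only a subbase.\<close>

lemma openin_Spec_chart:
  fixes V :: "'m::comm_semiring_1 laurent set set"
  assumes J: "J \<subseteq> {..n}"
  shows "openin (Spec (chart_ring n J)) V \<longleftrightarrow> V \<subseteq> primes (chart_ring n J) \<and>
    (\<forall>P\<in>V. \<exists>f\<in>hom_loc n J 0. f \<notin> P \<and> (\<forall>Q\<in>primes (chart_ring n J). f \<notin> Q \<longrightarrow> Q \<in> V))"
    (is "?l \<longleftrightarrow> ?r V")
proof
  assume ?l
  then have "generate_topology_on {{P \<in> primes (chart_ring n J). f \<notin> P} | f. f \<in> hom_loc n J 0} V"
    by (simp add: Spec_def openin_topology_generated_by_iff)
  then show "?r V"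
  proof induction
    case (Int U V)
    show ?case
    proof (intro conjI ballI)
      fix P assume P: "P \<in> U \<inter> V"
      then interpret P: chart_prime n J P using Int J by unfold_locales auto
      obtain f where f: "f \<in> hom_loc n J 0" "f \<notin> P" "\<forall>Q\<in>primes (chart_ring n J). f \<notin> Q \<longrightarrow> Q \<in> U"
        using P Int by blast
      obtain g where g: "g \<in> hom_loc n J 0" "g \<notin> P" "\<forall>Q\<in>primes (chart_ring n J). g \<notin> Q \<longrightarrow> Q \<in> V"
        using P Int by blast
      show "\<exists>f\<in>hom_loc n J 0. f \<notin> P \<and> (\<forall>Q\<in>primes (chart_ring n J). f \<notin> Q \<longrightarrow> Q \<in> U \<inter> V)"
      proof (intro bexI[of _ "f * g"] conjI ballI impI)
        show "f * g \<in> hom_loc n J 0" using f(1) g(1) by (auto intro: hom_loc_mult)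
        show "f * g \<notin> P" using P.R_mult f g by simp
        fix Q assume Q: "Q \<in> primes (chart_ring n J)" "f * g \<notin> Q"
        then interpret Q: chart_prime n J Q using J by unfold_locales auto
        show "Q \<in> U \<inter> V" using Q Q.R_mult f g by auto
      qed
    qed (use Int in auto)
  next
    case (UN K)
    show ?case
    proof (intro conjI ballI)
      fix P assume "P \<in> \<Union> K"
      then obtain U where U: "U \<in> K" "P \<in> U" by blast
      then obtain f where "f \<in> hom_loc n J 0" "f \<notin> P" "\<forall>Q\<in>primes (chart_ring n J). f \<notin> Q \<longrightarrow> Q \<in> U"
        using UN.IH[OF U(1)] by blast
      then show "\<exists>f\<in>hom_loc n J 0. f \<notin> P \<and> (\<forall>Q\<in>primes (chart_ring n J). f \<notin> Q \<longrightarrow> Q \<in> \<Union> K)"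
        using U by (intro bexI[of _ f]) auto
    qed (use UN.IH in blast)
  next
    case (Basis U) then show ?case by blast
  qed simp
next
  assume r: "?r V"
  let ?B = "\<lambda>f. {P \<in> primes (chart_ring n J). f \<notin> P}"
  have o: "openin (Spec (chart_ring n J)) (?B f)" if "f \<in> hom_loc n J 0" for f
    unfolding Spec_def using that by (intro topology_generated_by_Basis) auto
  show ?l
  proof (subst openin_subopen, intro ballI)
    fix P assume "P \<in> V"
    then obtain f where f: "f \<in> hom_loc n J 0" "f \<notin> P" "\<forall>Q\<in>primes (chart_ring n J). f \<notin> Q \<longrightarrow> Q \<in> V"
      using r by blast
    show "\<exists>T. openin (Spec (chart_ring n J)) T \<and> P \<in> T \<and> T \<subseteq> V"
      using o[OF f(1)] f r \<open>P \<in> V\<close> by (intro exI[of _ "?B f"]) auto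
  qed
qed

lemma topspace_Spec_chart:
  assumes "J \<subseteq> {..n}" shows "topspace (Spec (chart_ring n J)) = primes (chart_ring n J :: 'm::comm_semiring_1 laurent ring)"
proof
  show "topspace (Spec (chart_ring n J)) \<subseteq> primes (chart_ring n J :: 'm laurent ring)"
    using openin_Spec_chart[OF assms] openin_topspace by blast
  have "\<exists>f\<in>hom_loc n J 0. f \<notin> P" if "P \<in> primes (chart_ring n J)" for P :: "'m laurent set"
  proof -
    interpret chart_prime n J P using assms that by unfold_locales auto
    show ?thesis using R_one one_hom_loc by blast
  qed
  then have "openin (Spec (chart_ring n J)) (primes (chart_ring n J) :: 'm laurent set set)"
    unfolding openin_Spec_chart[OF assms] by blast
  then show "primes (chart_ring n J) \<subseteq> topspace (Spec (chart_ring n J :: 'm laurent ring))"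
    by (rule openin_subset)
qed

lemma topspace_proj_space:
  "topspace (proj_space n) = ppoint n ` Sigma {..n} (\<lambda>i. primes (chart_ring n {i}))"
proof -
  let ?X = "sum_topology (\<lambda>i. Spec (chart_ring n {i} :: 'm::comm_semiring_1 laurent ring)) {..n}"
  have t: "topspace ?X = Sigma {..n} (\<lambda>i. primes (chart_ring n {i}))" by (auto simp: topspace_Spec_chart)
  have "openin (proj_space n) (ppoint n ` topspace ?X)"
    unfolding proj_space_def openin_quotient_top
    by (auto intro!: arg_cong[where f = "openin ?X", THEN iffD2, OF _ openin_topspace])
  then have "ppoint n ` topspace ?X \<subseteq> topspace (proj_space n)" by (rule openin_subset)
  moreover have "topspace (proj_space n) \<subseteq> ppoint n ` topspace ?X"
    using openin_topspace[of "proj_space n"] unfolding proj_space_def openin_quotient_top by blast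
  ultimately have "topspace (proj_space n) = ppoint n ` topspace ?X" by blast
  then show ?thesis unfolding t .
qed

lemma openin_proj_space_charts:
  fixes W :: "'m::comm_semiring_1 ppoint set"
  shows "openin (proj_space n) W \<longleftrightarrow> W \<subseteq> topspace (proj_space n) \<and>
    (\<forall>i\<le>n. openin (Spec (chart_ring n {i})) (chart_part n i W))"
proof -
  have t: "topspace (sum_topology (\<lambda>i. Spec (chart_ring n {i} :: 'm laurent ring)) {..n}) =
      Sigma {..n} (\<lambda>i. primes (chart_ring n {i}))"
    by (auto simp: topspace_Spec_chart)
  have "{x. (i, x) \<in> {x \<in> Sigma {..n} (\<lambda>i. primes (chart_ring n {i})). ppoint n x \<in> W}} = chart_part n i W"
    if "i \<le> n" for i using that by (auto simp: chart_part_def)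
  then show ?thesis
    unfolding topspace_proj_space unfolding proj_space_def openin_quotient_top t openin_sum_topology
    by (auto simp: topspace_Spec_chart)
qed

lemma point_cases:
  assumes "p \<in> topspace (proj_space n)"
  obtains i P where "i \<le> n" "P \<in> primes (chart_ring n {i})" "p = ppoint n (i, P)"
  using assms by (auto simp: topspace_proj_space)

lemma hprime_nonzero_at:
  assumes "p \<in> topspace (proj_space n)" shows "hprime n (nonzero_at n p)"
proof -
  obtain i P where p: "i \<le> n" "P \<in> primes (chart_ring n {i})" "p = ppoint n (i, P)"
    by (rule point_cases[OF assms])
  interpret chart_prime n "{i}" P by (rule chart_prime_single) fact+
  show ?thesis using p hprime_nonvanishing by (simp add: nonzero_at_ppoint)
qed

lemma (in hprime) ppoint_prime_of:
  assumes i: "i \<in> charts n T"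
  shows "ppoint n (i, prime_of n T {i}) \<in> topspace (proj_space n)"
    and "nonzero_at n (ppoint n (i, prime_of n T {i})) = T"
  using assms prime_of_primes[of "{i}"] nonvanishing_prime_of[OF i]
  by (auto simp: topspace_proj_space charts_def nonzero_at_ppoint)

lemma nonzero_at_inject:
  assumes "p \<in> topspace (proj_space n)" "q \<in> topspace (proj_space n)" "nonzero_at n p = nonzero_at n q"
  shows "p = q"
proof -
  obtain i P where P: "i \<le> n" "P \<in> primes (chart_ring n {i})" "p = ppoint n (i, P)"
    by (rule point_cases[OF assms(1)])
  obtain j Q where Q: "j \<le> n" "Q \<in> primes (chart_ring n {j})" "q = ppoint n (j, Q)"
    by (rule point_cases[OF assms(2)])
  show ?thesis using assms(3) by (simp add: P Q nonzero_at_ppoint) (simp add: P Q ppoint_eq)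
qed

lemma point_eq:
  assumes "p \<in> topspace (proj_space n)" "i \<in> charts n (nonzero_at n p)"
  shows "ppoint n (i, prime_of n (nonzero_at n p) {i}) = p"
  using hprime.ppoint_prime_of[OF hprime_nonzero_at[OF assms(1)] assms(2)]
  by (intro nonzero_at_inject[OF _ assms(1)])

lemma ppoint_chart:
  assumes "i \<le> n" "P \<in> primes (chart_ring n {i})"
  shows "ppoint n (i, P) \<in> topspace (proj_space n)"
    and "i \<in> charts n (nonzero_at n (ppoint n (i, P)))"
    and "prime_of n (nonzero_at n (ppoint n (i, P))) {i} = P"
proof -
  interpret chart_prime n "{i}" P by (rule chart_prime_single) fact+
  show "ppoint n (i, P) \<in> topspace (proj_space n)" "i \<in> charts n (nonzero_at n (ppoint n (i, P)))"
    "prime_of n (nonzero_at n (ppoint n (i, P))) {i} = P"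
    using assms charts_nonvanishing[of i] prime_of_nonvanishing[of i]
    by (auto simp: topspace_proj_space nonzero_at_ppoint)
qed

text \<open>A basic open set of a chart is also a set D(f) for a homogeneous polynomial f.\<close>

lemma chart_basic_open:
  fixes g :: "'m::comm_semiring_1 laurent"
  assumes i: "i \<le> n" and g: "g \<in> hom_loc n {i} 0"
  shows "\<exists>f e. f \<in> hom_loc n {} e \<and> (\<forall>q\<in>topspace (proj_space n). f \<in> nonzero_at n q \<longleftrightarrow>
      i \<in> charts n (nonzero_at n q) \<and> g \<notin> prime_of n (nonzero_at n q) {i})"
proof -
  obtain k where k: "xpow i k * g \<in> hom_loc n {} (k + 0)"
    using clear_denominator g i by blast
  have x: "xpow i 1 \<in> hom_loc n {} 1" using i by (simp add: xpow_hom_loc)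
  show ?thesis
  \<comment> \<open>The extra factor x_i forces the point into chart i, even when k = 0 and g needs
    no denominator.\<close>
  proof (intro exI[of _ "xpow i 1 * (xpow i k * g)"] exI[of _ "1 + k"] conjI ballI)
    show "xpow i 1 * (xpow i k * g) \<in> hom_loc n {} (1 + k)" using x k by (auto intro: hom_loc_mult)
    fix q :: "'m ppoint" assume q: "q \<in> topspace (proj_space n)"
    interpret hprime n "nonzero_at n q" by (rule hprime_nonzero_at[OF q])
    show "xpow i 1 * (xpow i k * g) \<in> nonzero_at n q \<longleftrightarrow>
      i \<in> charts n (nonzero_at n q) \<and> g \<notin> prime_of n (nonzero_at n q) {i}"
      using mult_iff[OF x k] sat_poly[OF k] sat_cancel[OF xpow_sat] i g
      by (auto simp: charts_def prime_of_def)
  qed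
qed

text \<open>The sets D(f) of homogeneous polynomials f form a base of projective space. From here on
  open sets are handled without charts.\<close>

lemma openin_proj_space_iff:
  "openin (proj_space n) W \<longleftrightarrow> W \<subseteq> topspace (proj_space n) \<and>
    (\<forall>p\<in>W. \<exists>f e. f \<in> hom_loc n {} e \<and> f \<in> nonzero_at n p \<and>
      (\<forall>q\<in>topspace (proj_space n). f \<in> nonzero_at n q \<longrightarrow> q \<in> W))" (is "?l \<longleftrightarrow> ?r")
proof
  assume l: ?l
  then have W: "W \<subseteq> topspace (proj_space n)" by (rule openin_subset)
  show ?r
  proof (intro conjI ballI W)
    fix p assume p: "p \<in> W"
    then obtain i P where P: "i \<le> n" "P \<in> primes (chart_ring n {i})" "p = ppoint n (i, P)"
      using W point_cases by blast
    have "openin (Spec (chart_ring n {i})) (chart_part n i W)"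
      using l P unfolding openin_proj_space_charts by blast
    moreover have "P \<in> chart_part n i W" using P p by (simp add: chart_part_def)
    ultimately obtain g where g: "g \<in> hom_loc n {i} 0" "g \<notin> P"
      "\<And>Q. Q \<in> primes (chart_ring n {i}) \<Longrightarrow> g \<notin> Q \<Longrightarrow> ppoint n (i, Q) \<in> W"
      using openin_Spec_chart[of "{i}" n "chart_part n i W"] P unfolding chart_part_def by auto
    obtain f e where f: "f \<in> hom_loc n {} e"
      "\<forall>q\<in>topspace (proj_space n). f \<in> nonzero_at n q \<longleftrightarrow>
        i \<in> charts n (nonzero_at n q) \<and> g \<notin> prime_of n (nonzero_at n q) {i}"
      using chart_basic_open[OF P(1) g(1)] by blast
    show "\<exists>f e. f \<in> hom_loc n {} e \<and> f \<in> nonzero_at n p \<and>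
      (\<forall>q\<in>topspace (proj_space n). f \<in> nonzero_at n q \<longrightarrow> q \<in> W)"
    proof (intro exI[of _ f] exI[of _ e] conjI ballI impI f(1))
      show "f \<in> nonzero_at n p" using f(2) P ppoint_chart[OF P(1,2)] g(2) by simp
      fix q assume q: "q \<in> topspace (proj_space n)" "f \<in> nonzero_at n q"
      then have c: "i \<in> charts n (nonzero_at n q)" "g \<notin> prime_of n (nonzero_at n q) {i}"
        using f(2) by auto
      have "prime_of n (nonzero_at n q) {i} \<in> primes (chart_ring n {i})"
        using hprime.prime_of_primes[OF hprime_nonzero_at[OF q(1)], of "{i}"] c by simp
      then show "q \<in> W" using g(3) c(2) point_eq[OF q(1) c(1)] by metis
    qed
  qed
next
  assume r: ?r
  have "openin (Spec (chart_ring n {i})) (chart_part n i W)" if i: "i \<le> n" for i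
    unfolding openin_Spec_chart[of "{i}" n, simplified, OF i]
  proof (intro conjI ballI)
    fix P assume "P \<in> chart_part n i W"
    then have P: "P \<in> primes (chart_ring n {i})" "ppoint n (i, P) \<in> W" by (auto simp: chart_part_def)
    interpret P: chart_prime n "{i}" P by (rule chart_prime_single) fact+
    obtain f e where f: "f \<in> hom_loc n {} e" "f \<in> nonzero_at n (ppoint n (i, P))"
      "\<forall>q\<in>topspace (proj_space n). f \<in> nonzero_at n q \<longrightarrow> q \<in> W" using r P by blast
    show "\<exists>f\<in>hom_loc n {i} 0. f \<notin> P \<and> (\<forall>Q\<in>primes (chart_ring n {i}). f \<notin> Q \<longrightarrow> Q \<in> chart_part n i W)"
    proof (intro bexI[of _ "xpow i (- e) * f"] conjI ballI impI)
      show "xpow i (- e) * f \<in> hom_loc n {i} 0" using P.degree0[OF _ f(1), of i] by simp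
      show "xpow i (- e) * f \<notin> P" using f P i P.nonvanishing_iff[OF f(1)] by (simp add: nonzero_at_ppoint)
      fix Q assume Q: "Q \<in> primes (chart_ring n {i})" "xpow i (- e) * f \<notin> Q"
      interpret Q: chart_prime n "{i}" Q by (rule chart_prime_single) fact+
      have "f \<in> nonzero_at n (ppoint n (i, Q))"
        using Q i Q.nonvanishing_iff[OF f(1)] by (simp add: nonzero_at_ppoint)
      then show "Q \<in> chart_part n i W" using f(3) Q(1) ppoint_chart(1)[OF i Q(1)] by (simp add: chart_part_def)
    qed
  qed (auto simp: chart_part_def)
  then show ?l unfolding openin_proj_space_charts using r by blast
qed

text \<open>The point p is a specialization of q, so each neighbourhood of p contains q. This is how
  one well chosen point controls an entire open set.\<close>

lemma open_specialization:
  assumes "openin (proj_space n) W" "p \<in> W" "q \<in> topspace (proj_space n)"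
    "nonzero_at n p \<subseteq> nonzero_at n q"
  shows "q \<in> W"
  using assms unfolding openin_proj_space_iff by blast

definition standard_open :: "nat \<Rightarrow> nat \<Rightarrow> 'm::comm_semiring_1 ppoint set" where
  "standard_open n i = {p \<in> topspace (proj_space n). i \<in> charts n (nonzero_at n p)}"

lemma openin_basic:
  assumes "f \<in> hom_loc n {} e"
  shows "openin (proj_space n) {p \<in> topspace (proj_space n). f \<in> nonzero_at n p}"
  unfolding openin_proj_space_iff using assms by auto

lemma openin_standard_open: "openin (proj_space n) (standard_open n i)"
proof (cases "i \<le> n")
  case True
  then show ?thesis using openin_basic[OF xpow_hom_loc, of i n 1] by (simp add: standard_open_def charts_def)
qed (simp add: standard_open_def charts_def)

lemma openin_chart_image:
  assumes i: "i \<le> n" and V: "openin (Spec (chart_ring n {i})) V"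
  shows "openin (proj_space n) {q \<in> standard_open n i. prime_of n (nonzero_at n q) {i} \<in> V}"
  unfolding openin_proj_space_iff
proof (intro conjI ballI)
  fix p assume p: "p \<in> {q \<in> standard_open n i. prime_of n (nonzero_at n q) {i} \<in> V}"
  then obtain g where g: "g \<in> hom_loc n {i} 0" "g \<notin> prime_of n (nonzero_at n p) {i}"
    "\<And>Q. Q \<in> primes (chart_ring n {i}) \<Longrightarrow> g \<notin> Q \<Longrightarrow> Q \<in> V"
    using V i openin_Spec_chart[of "{i}" n V] by auto
  obtain f e where f: "f \<in> hom_loc n {} e"
      "\<forall>q\<in>topspace (proj_space n). f \<in> nonzero_at n q \<longleftrightarrow>
        i \<in> charts n (nonzero_at n q) \<and> g \<notin> prime_of n (nonzero_at n q) {i}"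
    using chart_basic_open[OF i g(1)] by blast
  have "prime_of n (nonzero_at n q) {i} \<in> primes (chart_ring n {i})"
    if "q \<in> topspace (proj_space n)" "i \<in> charts n (nonzero_at n q)" for q
    using hprime.prime_of_primes[OF hprime_nonzero_at[OF that(1)], of "{i}"] that by simp
  then show "\<exists>f e. f \<in> hom_loc n {} e \<and> f \<in> nonzero_at n p \<and>
      (\<forall>q\<in>topspace (proj_space n). f \<in> nonzero_at n q \<longrightarrow>
        q \<in> {q \<in> standard_open n i. prime_of n (nonzero_at n q) {i} \<in> V})"
    using p g f by (intro exI[of _ f] exI[of _ e]) (auto simp: standard_open_def)
qed (auto simp: standard_open_def)

section \<open>Fractions\<close>

text \<open>In contrast to \<open>frac\<close>, numerators range over the whole type and there are
  no carriers. Fractions of all degrees and from all charts thus live in one type.\<close>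

definition fr :: "'r::comm_semiring_1 set \<Rightarrow> 'r \<Rightarrow> 'r \<Rightarrow> ('r \<times> 'r) set" where
  "fr S a f = {(a', f'). f' \<in> S \<and> (\<exists>u\<in>S. u * f' * a = u * f * a')}"

definition fr_add :: "'r::comm_semiring_1 set \<Rightarrow> ('r \<times> 'r) set \<Rightarrow> ('r \<times> 'r) set \<Rightarrow> ('r \<times> 'r) set" where
  "fr_add S \<xi> \<eta> = (\<Union>(a, f)\<in>\<xi>. \<Union>(b, g)\<in>\<eta>. fr S (g * a + f * b) (f * g))"

definition fr_mult :: "'r::comm_semiring_1 set \<Rightarrow> ('r \<times> 'r) set \<Rightarrow> ('r \<times> 'r) set \<Rightarrow> ('r \<times> 'r) set" where
  "fr_mult S \<xi> \<eta> = (\<Union>(a, f)\<in>\<xi>. \<Union>(b, g)\<in>\<eta>. fr S (a * b) (f * g))"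

text \<open>Operations on classes are defined as unions over all representatives. Once the summand
  does not depend on the representatives, the union collapses to a single class.\<close>

lemma UN_UN_const:
  assumes "(a, f) \<in> \<xi>" "(b, g) \<in> \<eta>"
    and "\<And>a' f' b' g'. (a', f') \<in> \<xi> \<Longrightarrow> (b', g') \<in> \<eta> \<Longrightarrow> F a' f' b' g' = C"
  shows "(\<Union>(a, f)\<in>\<xi>. \<Union>(b, g)\<in>\<eta>. F a f b g) = C"
  using assms by fast

locale mult_set =
  fixes S :: "'r::comm_semiring_1 set"
  assumes one_S: "1 \<in> S" and mult_S: "f \<in> S \<Longrightarrow> g \<in> S \<Longrightarrow> f * g \<in> S"
begin

lemma fr_self: "f \<in> S \<Longrightarrow> (a, f) \<in> fr S a f"
  using one_S by (auto simp: fr_def intro!: bexI[of _ 1])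

lemma fr_mem: "(b, g) \<in> fr S a f \<longleftrightarrow> g \<in> S \<and> (\<exists>u\<in>S. u * g * a = u * f * b)"
  by (simp add: fr_def)


text \<open>Transitivity of equality of fractions without cancellation: the witnesses u and v
  combine to u v f, where the denominator f of the intermediate fraction is part of the
  witness.\<close>

lemma fr_subset:
  assumes f: "f \<in> S" and g: "g \<in> S" and u: "u \<in> S" "u * g * a = u * f * b"
  shows "fr S a f \<subseteq> fr S b g"
proof clarify
  fix c h assume "(c, h) \<in> fr S a f"
  then obtain v where v: "h \<in> S" "v \<in> S" "v * h * a = v * f * c" by (auto simp: fr_mem)
  have "(u * v * f) * h * b = v * h * (u * f * b)" by (simp only: ac_simps)
  also have "\<dots> = v * h * (u * g * a)" by (simp only: u(2))
  also have "\<dots> = u * g * (v * h * a)" by (simp only: ac_simps)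
  also have "\<dots> = u * g * (v * f * c)" by (simp only: v(3))
  also have "\<dots> = (u * v * f) * g * c" by (simp only: ac_simps)
  finally show "(c, h) \<in> fr S b g"
    using v u f by (auto simp: fr_mem intro!: bexI[of _ "u * v * f"] mult_S)
qed

lemma fr_eqI:
  assumes "f \<in> S" "g \<in> S" "u \<in> S" "u * g * a = u * f * b"
  shows "fr S a f = fr S b g"
  using fr_subset[OF assms] fr_subset[OF assms(2,1,3) assms(4)[symmetric]] by blast

lemma fr_eq_of_mem: "f \<in> S \<Longrightarrow> (b, g) \<in> fr S a f \<Longrightarrow> fr S b g = fr S a f"
  unfolding fr_mem using fr_eqI by metis

lemma fr_eq_iff:
  assumes "f \<in> S" "g \<in> S"
  shows "fr S a f = fr S b g \<longleftrightarrow> (\<exists>u\<in>S. u * g * a = u * f * b)"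
proof
  assume "fr S a f = fr S b g"
  then have "(b, g) \<in> fr S a f" using fr_self[OF assms(2)] by simp
  then show "\<exists>u\<in>S. u * g * a = u * f * b" by (simp add: fr_mem)
qed (use fr_eqI assms in blast)

lemma fr_expand: "f \<in> S \<Longrightarrow> w \<in> S \<Longrightarrow> fr S (w * a) (w * f) = fr S a f"
  by (rule fr_eqI[of _ _ 1]) (auto simp: one_S mult_S ac_simps)

lemma fr_cong_add:
  assumes "f \<in> S" "g \<in> S" "(a', f') \<in> fr S a f" "(b', g') \<in> fr S b g"
  shows "fr S (g' * a' + f' * b') (f' * g') = fr S (g * a + f * b) (f * g)"
proof -
  obtain u where u: "f' \<in> S" "u \<in> S" "u * f' * a = u * f * a'" using assms(3) by (auto simp: fr_mem)
  obtain v where v: "g' \<in> S" "v \<in> S" "v * g' * b = v * g * b'" using assms(4) by (auto simp: fr_mem)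
  have "u * v * (f * g) * (g' * a' + f' * b') =
      v * g * g' * (u * f * a') + u * f * f' * (v * g * b')"
    by (simp only: distrib_left ac_simps)
  also have "\<dots> = v * g * g' * (u * f' * a) + u * f * f' * (v * g' * b)" by (simp only: u v)
  also have "\<dots> = u * v * (f' * g') * (g * a + f * b)" by (simp only: distrib_left ac_simps)
  finally show ?thesis by (intro fr_eqI[of _ _ "u * v"]) (auto simp: assms u v mult_S)
qed

lemma fr_cong_mult:
  assumes "f \<in> S" "g \<in> S" "(a', f') \<in> fr S a f" "(b', g') \<in> fr S b g"
  shows "fr S (a' * b') (f' * g') = fr S (a * b) (f * g)"
proof -
  obtain u where u: "f' \<in> S" "u \<in> S" "u * f' * a = u * f * a'" using assms(3) by (auto simp: fr_mem)
  obtain v where v: "g' \<in> S" "v \<in> S" "v * g' * b = v * g * b'" using assms(4) by (auto simp: fr_mem)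
  have "u * v * (f * g) * (a' * b') = (u * f * a') * (v * g * b')" by (simp only: ac_simps)
  also have "\<dots> = (u * f' * a) * (v * g' * b)" by (simp only: u v)
  also have "\<dots> = u * v * (f' * g') * (a * b)" by (simp only: ac_simps)
  finally show ?thesis by (intro fr_eqI[of _ _ "u * v"]) (auto simp: assms u v mult_S)
qed

lemma fr_add_eq: "f \<in> S \<Longrightarrow> g \<in> S \<Longrightarrow> fr_add S (fr S a f) (fr S b g) = fr S (g * a + f * b) (f * g)"
  unfolding fr_add_def by (rule UN_UN_const[OF fr_self fr_self]) (simp_all add: fr_cong_add)

lemma fr_mult_eq: "f \<in> S \<Longrightarrow> g \<in> S \<Longrightarrow> fr_mult S (fr S a f) (fr S b g) = fr S (a * b) (f * g)"
  unfolding fr_mult_def by (rule UN_UN_const[OF fr_self fr_self]) (simp_all add: fr_cong_mult)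

end

lemma (in hprime) mult_set_sat: "mult_set (sat T)"
  by unfold_locales (auto simp: one_sat sat_mult)

sublocale hprime \<subseteq> sat: mult_set "sat T"
  by (rule mult_set_sat)

definition degree_frac :: "nat \<Rightarrow> 'm::comm_semiring_1 laurent set \<Rightarrow> int \<Rightarrow> ('m laurent \<times> 'm laurent) set \<Rightarrow> bool" where
  "degree_frac n T d \<xi> \<longleftrightarrow>
    (\<exists>a f e. a \<in> hom_loc n {} (d + e) \<and> f \<in> hom_loc n {} e \<and> f \<in> T \<and> \<xi> = fr (sat T) a f)"

definition chart_pairs :: "nat \<Rightarrow> nat set \<Rightarrow> int \<Rightarrow> 'm::comm_semiring_1 laurent set \<Rightarrow> ('m laurent \<times> 'm laurent) set" where
  "chart_pairs n J d R = hom_loc n J d \<times> (hom_loc n J 0 - R)"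

lemma chart_simps [simp]:
  "carrier (chart_module n d J) = hom_loc n J d"
  "a \<odot>\<^bsub>chart_module n d J\<^esub> b = a * b" "a \<oplus>\<^bsub>chart_module n d J\<^esub> b = a + b"
  "\<zero>\<^bsub>chart_module n d J\<^esub> = 0"
  "a \<otimes>\<^bsub>chart_ring n J\<^esub> b = a * b" "\<one>\<^bsub>chart_ring n J\<^esub> = 1"
  by (simp_all add: chart_module_def chart_ring_def)

context hprime
begin

lemma chart_pairs_iff:
  "(a, f) \<in> chart_pairs n J d (prime_of n T J) \<longleftrightarrow> a \<in> hom_loc n J d \<and> f \<in> hom_loc n J 0 \<and> f \<in> sat T"
  by (auto simp: chart_pairs_def prime_of_def)

lemma chart_pairs_mono:
  "J \<subseteq> K \<Longrightarrow> chart_pairs n J d (prime_of n T J) \<subseteq> chart_pairs n K d (prime_of n T K)"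
  by (auto simp: chart_pairs_iff intro: hom_loc_mono)

text \<open>A witness from the large localization has a multiple that is a witness in the chart: t u
  is a homogeneous polynomial of some degree e, and x_i^(-e) brings it to degree 0.\<close>

lemma chart_unit:
  assumes u: "u \<in> sat T" and J: "J \<subseteq> charts n T" "J \<noteq> {}"
  obtains w where "w * u \<in> hom_loc n J 0" "w * u \<in> sat T"
proof -
  obtain t where t: "t \<in> T" "t * u \<in> T" using u by (auto simp: sat_def)
  obtain e where e: "t * u \<in> hom_loc n {} e" using hom t by blast
  obtain i where i: "i \<in> J" "i \<in> charts n T" "i \<le> n" using J by (auto simp: charts_def)
  show ?thesis
  proof
    show "xpow i (- e) * t * u \<in> hom_loc n J 0" unfolding mult.assoc
      using i by (intro hom_loc_mult[OF xpow_hom_loc e]) auto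
    show "xpow i (- e) * t * u \<in> sat T"
      unfolding mult.assoc using sat_mult[OF xpow_sat[OF i(2)] mem_sat[OF t(2)]] .
  qed
qed

text \<open>The stalk of a chart embeds into the large localization. Two pairs of the chart that are
  equal with a witness in \<open>sat T\<close> are also equal with one in the chart ring, by
  \<open>chart_unit\<close>.\<close>

lemma frac_eq_fr:
  assumes J: "J \<subseteq> charts n T" "J \<noteq> {}" and a: "(a, f) \<in> chart_pairs n J d (prime_of n T J)"
  shows "frac (chart_ring n J) (hom_loc n J 0 - prime_of n T J) (chart_module n d J) a f =
    fr (sat T) a f \<inter> chart_pairs n J d (prime_of n T J)"
proof -
  have "\<exists>w\<in>hom_loc n J 0 - prime_of n T J. w * f' * a = w * f * a'"
    if u: "u \<in> sat T" "u * f' * a = u * f * a'" for u a' f'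
  proof -
    obtain w where w: "w * u \<in> hom_loc n J 0" "w * u \<in> sat T" using chart_unit[OF u(1) J] .
    then have "(w * u) * f' * a = (w * u) * f * a'" using u(2) by (simp add: mult.assoc)
    then show ?thesis using w by (intro bexI[of _ "w * u"]) (auto simp: prime_of_def)
  qed
  then show ?thesis
    unfolding frac_def fr_def chart_pairs_def by (auto simp: prime_of_def)
qed

lemma fr_self_chart:
  "(a, f) \<in> chart_pairs n J d (prime_of n T J) \<Longrightarrow>
    (a, f) \<in> fr (sat T) a f \<inter> chart_pairs n J d (prime_of n T J)"
  using sat.fr_self by (simp add: chart_pairs_iff)

lemma loc_module_carrier:
  assumes J: "J \<subseteq> charts n T" "J \<noteq> {}"
  shows "\<xi> \<in> carrier (loc_module (chart_ring n J) (hom_loc n J 0 - prime_of n T J) (chart_module n d J)) \<longleftrightarrow>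
    (\<exists>a f. (a, f) \<in> chart_pairs n J d (prime_of n T J) \<and> \<xi> = fr (sat T) a f \<inter> chart_pairs n J d (prime_of n T J))"
proof -
  have "\<xi> \<in> carrier (loc_module (chart_ring n J) (hom_loc n J 0 - prime_of n T J) (chart_module n d J)) \<longleftrightarrow>
    (\<exists>a f. (a, f) \<in> chart_pairs n J d (prime_of n T J) \<and>
      \<xi> = frac (chart_ring n J) (hom_loc n J 0 - prime_of n T J) (chart_module n d J) a f)"
    by (auto simp: loc_module_def chart_pairs_def)
  then show ?thesis by (simp add: frac_eq_fr[OF J] cong: conj_cong)
qed

lemma loc_module_zero:
  assumes J: "J \<subseteq> charts n T" "J \<noteq> {}"
  shows "\<zero>\<^bsub>loc_module (chart_ring n J) (hom_loc n J 0 - prime_of n T J) (chart_module n d J)\<^esub> =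
    fr (sat T) 0 1 \<inter> chart_pairs n J d (prime_of n T J)"
  using frac_eq_fr[OF J, of 0 1 d] by (simp add: loc_module_def chart_pairs_iff one_sat)

lemma loc_module_add:
  assumes J: "J \<subseteq> charts n T" "J \<noteq> {}"
    and a: "(a, f) \<in> chart_pairs n J d (prime_of n T J)" "(b, g) \<in> chart_pairs n J d (prime_of n T J)"
  shows "(fr (sat T) a f \<inter> chart_pairs n J d (prime_of n T J))
      \<oplus>\<^bsub>loc_module (chart_ring n J) (hom_loc n J 0 - prime_of n T J) (chart_module n d J)\<^esub>
      (fr (sat T) b g \<inter> chart_pairs n J d (prime_of n T J)) =
    fr_add (sat T) (fr (sat T) a f) (fr (sat T) b g) \<inter> chart_pairs n J d (prime_of n T J)"
proof -
  let ?Y = "chart_pairs n J d (prime_of n T J)"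
  have c: "(g' * a' + f' * b', f' * g') \<in> ?Y" if "(a', f') \<in> ?Y" "(b', g') \<in> ?Y" for a' f' b' g'
    using that by (auto simp: chart_pairs_iff intro!: hom_loc_add sat_mult intro: hom_loc_mult)
  have s: "f \<in> sat T" "g \<in> sat T" using a by (auto simp: chart_pairs_iff)
  show ?thesis
    unfolding sat.fr_add_eq[OF s]
    unfolding loc_module_def
    by (simp, rule UN_UN_const[OF fr_self_chart[OF a(1)] fr_self_chart[OF a(2)]])
      (use frac_eq_fr[OF J] c sat.fr_cong_add[OF s] in auto)
qed

lemma loc_module_smult:
  assumes J: "J \<subseteq> charts n T" "J \<noteq> {}"
    and a: "(a, f) \<in> chart_pairs n J 0 (prime_of n T J)" "(b, g) \<in> chart_pairs n J d (prime_of n T J)"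
  shows "(fr (sat T) a f \<inter> chart_pairs n J 0 (prime_of n T J))
      \<odot>\<^bsub>loc_module (chart_ring n J) (hom_loc n J 0 - prime_of n T J) (chart_module n d J)\<^esub>
      (fr (sat T) b g \<inter> chart_pairs n J d (prime_of n T J)) =
    fr_mult (sat T) (fr (sat T) a f) (fr (sat T) b g) \<inter> chart_pairs n J d (prime_of n T J)"
proof -
  let ?Y = "chart_pairs n J d (prime_of n T J)"
  have c: "(a' * b', f' * g') \<in> ?Y" if "(a', f') \<in> chart_pairs n J 0 (prime_of n T J)" "(b', g') \<in> ?Y" for a' f' b' g'
    using that by (auto simp: chart_pairs_iff intro!: sat_mult intro: hom_loc_mult)
  have s: "f \<in> sat T" "g \<in> sat T" using a by (auto simp: chart_pairs_iff)
  show ?thesis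
    unfolding sat.fr_mult_eq[OF s]
    unfolding loc_module_def
    by (simp, rule UN_UN_const[OF fr_self_chart[OF a(1)] fr_self_chart[OF a(2)]])
      (use frac_eq_fr[OF J] c sat.fr_cong_mult[OF s] in auto)
qed

lemma loc_map_eq:
  assumes J: "J \<subseteq> charts n T" "J \<noteq> {}" and K: "K \<subseteq> J"
    and a: "(a, f) \<in> chart_pairs n K d (prime_of n T K)"
  shows "loc_map (chart_ring n J) (hom_loc n J 0 - prime_of n T J) (chart_module n d J)
      (fr (sat T) a f \<inter> chart_pairs n K d (prime_of n T K)) =
    fr (sat T) a f \<inter> chart_pairs n J d (prime_of n T J)"
proof -
  have s: "f \<in> sat T" using a by (auto simp: chart_pairs_iff)
  have "frac (chart_ring n J) (hom_loc n J 0 - prime_of n T J) (chart_module n d J) b g =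
      fr (sat T) a f \<inter> chart_pairs n J d (prime_of n T J)"
    if "(b, g) \<in> fr (sat T) a f \<inter> chart_pairs n K d (prime_of n T K)" for b g
    using that frac_eq_fr[OF J] chart_pairs_mono[OF K] sat.fr_eq_of_mem[OF s] by blast
  then show ?thesis
    unfolding loc_map_def using fr_self_chart[OF a] by fast
qed

lemma degree_frac_chart:
  assumes "degree_frac n T d \<xi>" "i \<in> charts n T"
  obtains a f where "(a, f) \<in> chart_pairs n {i} d (prime_of n T {i})" "\<xi> = fr (sat T) a f"
proof -
  obtain a f e where a: "a \<in> hom_loc n {} (d + e)" "f \<in> hom_loc n {} e" "f \<in> T" "\<xi> = fr (sat T) a f"
    using assms(1) by (auto simp: degree_frac_def)
  have i: "i \<le> n" using assms(2) by (simp add: charts_def)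
  show ?thesis
  proof
    show "(xpow i (- e) * a, xpow i (- e) * f) \<in> chart_pairs n {i} d (prime_of n T {i})"
      using a(3) sat_mult[OF xpow_sat[OF assms(2)] mem_sat[OF a(3)]] i
        hom_loc_mult[OF xpow_hom_loc a(1), of i "{i}" "- e" "{i}" d]
        hom_loc_mult[OF xpow_hom_loc a(2), of i "{i}" "- e" "{i}" 0]
      by (simp add: chart_pairs_iff)
    show "\<xi> = fr (sat T) (xpow i (- e) * a) (xpow i (- e) * f)"
      using sat.fr_expand mem_sat[OF a(3)] xpow_sat[OF assms(2)] a(4) by simp
  qed
qed

end

section \<open>The twisting sheaves as sheaves of functions\<close>

text \<open>
  All stalks at a point are taken inside one localization of the semiring of Laurent polynomials,
  so that a section is a single function on the points, independent of charts.
\<close>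

abbreviation denoms :: "nat \<Rightarrow> 'm::comm_semiring_1 ppoint \<Rightarrow> 'm laurent set" where
  "denoms n p \<equiv> sat (nonzero_at n p)"

type_synonym 'm fsection = "'m ppoint \<Rightarrow> ('m laurent \<times> 'm laurent) set"

definition fraction_on ::
  "nat \<Rightarrow> int \<Rightarrow> 'm::comm_semiring_1 ppoint set \<Rightarrow> 'm laurent \<Rightarrow> 'm laurent \<Rightarrow> 'm fsection \<Rightarrow> bool" where
  "fraction_on n d V a f s \<longleftrightarrow> (\<exists>e. a \<in> hom_loc n {} (d + e) \<and> f \<in> hom_loc n {} e) \<and>
     (\<forall>q\<in>V. f \<in> nonzero_at n q \<and> s q = fr (denoms n q) a f)"

definition fsections :: "nat \<Rightarrow> int \<Rightarrow> 'm::comm_semiring_1 ppoint set \<Rightarrow> 'm fsection set" where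
  "fsections n d U = {s \<in> extensional U. \<forall>p\<in>U. \<exists>V a f.
     openin (proj_space n) V \<and> p \<in> V \<and> V \<subseteq> U \<and> fraction_on n d V a f s}"

definition to_charts :: "nat \<Rightarrow> int \<Rightarrow> 'm::comm_semiring_1 ppoint set \<Rightarrow> 'm fsection \<Rightarrow> 'm psection" where
  "to_charts n d U s = (\<lambda>i\<in>{..n}. \<lambda>P\<in>chart_part n i U. s (ppoint n (i, P)) \<inter> chart_pairs n {i} d P)"

text \<open>The union runs over all charts through the point and all representatives there. For a
  glued section all these fractions coincide, so no choice of a chart is involved.\<close>

definition from_charts :: "nat \<Rightarrow> 'm::comm_semiring_1 ppoint set \<Rightarrow> 'm psection \<Rightarrow> 'm fsection" where
  "from_charts n U \<sigma> = (\<lambda>p\<in>U. \<Union>i\<in>charts n (nonzero_at n p).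
     \<Union>(a, f)\<in>\<sigma> i (prime_of n (nonzero_at n p) {i}). fr (denoms n p) a f)"

lemma open_points: "openin (proj_space n) U \<Longrightarrow> p \<in> U \<Longrightarrow> p \<in> topspace (proj_space n)"
  using openin_subset by blast

lemma fsections_degree_frac:
  assumes "s \<in> fsections n d U" "p \<in> U"
  shows "degree_frac n (nonzero_at n p) d (s p)"
  using assms unfolding fsections_def fraction_on_def degree_frac_def by blast

lemma chart_part_open_subset: "V \<subseteq> U \<Longrightarrow> chart_part n i V \<subseteq> chart_part n i U"
  by (auto simp: chart_part_def)

lemma chart_partD:
  assumes "i \<le> n" "P \<in> chart_part n i U"
  shows "ppoint n (i, P) \<in> U" "ppoint n (i, P) \<in> topspace (proj_space n)"
    "P \<in> primes (chart_ring n {i})"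
    "hprime n (nonzero_at n (ppoint n (i, P)))" "{i} \<subseteq> charts n (nonzero_at n (ppoint n (i, P)))"
    "prime_of n (nonzero_at n (ppoint n (i, P))) {i} = P"
  using assms ppoint_chart[of i n P] hprime_nonzero_at[of "ppoint n (i, P)" n]
  by (auto simp: chart_part_def)

lemma prime_of_chart_part:
  assumes "openin (proj_space n) U" "p \<in> U" "i \<in> charts n (nonzero_at n p)"
  shows "prime_of n (nonzero_at n p) {i} \<in> chart_part n i U"
  using assms point_eq[OF open_points[OF assms(1,2)] assms(3)]
    hprime.prime_of_primes[OF hprime_nonzero_at[OF open_points[OF assms(1,2)]], of "{i}"]
  by (simp add: chart_part_def)

lemma overlap_point:
  assumes ij: "i \<le> n" "j \<le> n" and R: "R \<in> primes (chart_ring n {i, j})"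
  defines "p \<equiv> ppoint n (i, R \<inter> hom_loc n {i} 0)"
  shows "ppoint n (j, R \<inter> hom_loc n {j} 0) = p" "{i, j} \<subseteq> charts n (nonzero_at n p)"
    "prime_of n (nonzero_at n p) {i, j} = R" "prime_of n (nonzero_at n p) {i} = R \<inter> hom_loc n {i} 0"
    "prime_of n (nonzero_at n p) {j} = R \<inter> hom_loc n {j} 0" "hprime n (nonzero_at n p)"
    "R \<inter> hom_loc n {i} 0 \<in> primes (chart_ring n {i})" "R \<inter> hom_loc n {j} 0 \<in> primes (chart_ring n {j})"
proof -
  interpret R: chart_prime n "{i, j}" R using assms by unfold_locales auto
  have P: "R \<inter> hom_loc n {i} 0 \<in> primes (chart_ring n {i})" "R \<inter> hom_loc n {j} 0 \<in> primes (chart_ring n {j})"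
    using R.contract_primes by auto
  have p: "nonzero_at n p = nonvanishing n i R"
    unfolding p_def using nonzero_at_ppoint[OF ij(1) P(1)] R.nonvanishing_contract[of i] by simp
  have q: "nonzero_at n (ppoint n (j, R \<inter> hom_loc n {j} 0)) = nonvanishing n i R"
    using nonzero_at_ppoint[OF ij(2) P(2)] R.nonvanishing_contract[of j] R.nonvanishing_eq[of i j] by simp
  show eq: "ppoint n (j, R \<inter> hom_loc n {j} 0) = p"
    using p q ppoint_chart(1)[OF ij(1) P(1)] ppoint_chart(1)[OF ij(2) P(2)] nonzero_at_inject
    unfolding p_def by blast
  show "{i, j} \<subseteq> charts n (nonzero_at n p)" "prime_of n (nonzero_at n p) {i, j} = R"
    "hprime n (nonzero_at n p)" unfolding p
    using R.charts_nonvanishing R.prime_of_nonvanishing R.hprime_nonvanishing by auto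
  show "prime_of n (nonzero_at n p) {i} = R \<inter> hom_loc n {i} 0"
    unfolding p_def by (rule ppoint_chart(3)[OF ij(1) P(1)])
  show "prime_of n (nonzero_at n p) {j} = R \<inter> hom_loc n {j} 0"
    using ppoint_chart(3)[OF ij(2) P(2)] eq by simp
qed (use R ij chart_prime.contract_primes[of n "{i, j}" R] in \<open>auto simp: chart_prime_def\<close>)

section \<open>Functions on the points and glued families of chart sections\<close>

lemma to_charts_section:
  assumes U: "openin (proj_space n) U" and s: "s \<in> fsections n d U" and i: "i \<le> n"
  shows "to_charts n d U s i \<in>
    carrier (sec (assoc_sheaf (chart_ring n {i}) (chart_module n d {i})) (chart_part n i U))"
proof -
  have 1: "\<exists>V a f. openin (Spec (chart_ring n {i})) V \<and> P \<in> V \<and> V \<subseteq> chart_part n i U \<and>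
      a \<in> hom_loc n {i} d \<and> f \<in> hom_loc n {i} 0 \<and>
      (\<forall>Q\<in>V. f \<notin> Q \<and> to_charts n d U s i Q =
        frac (chart_ring n {i}) (hom_loc n {i} 0 - Q) (chart_module n d {i}) a f)"
    if P: "P \<in> chart_part n i U" for P
  proof -
    obtain V a f where V: "openin (proj_space n) V" "ppoint n (i, P) \<in> V" "V \<subseteq> U"
      and f: "fraction_on n d V a f s"
      using s chart_partD(1)[OF i P] unfolding fsections_def by blast
    obtain e where e: "a \<in> hom_loc n {} (d + e)" "f \<in> hom_loc n {} e"
      using f by (auto simp: fraction_on_def)
    \<comment> \<open>Dividing both polynomials by x_i^e gives the denominator degree 0 and the
      numerator degree d, as the chart requires.\<close>
    let ?a = "xpow i (- e) * a" and ?f = "xpow i (- e) * f"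
    have a: "?a \<in> hom_loc n {i} d" "?f \<in> hom_loc n {i} 0"
      using hom_loc_mult[OF xpow_hom_loc e(1), of i "{i}" "- e" "{i}" d]
        hom_loc_mult[OF xpow_hom_loc e(2), of i "{i}" "- e" "{i}" 0] i by auto
    have val: "?f \<notin> Q \<and> to_charts n d U s i Q =
        frac (chart_ring n {i}) (hom_loc n {i} 0 - Q) (chart_module n d {i}) ?a ?f"
      if Q: "Q \<in> chart_part n i V" for Q
    proof -
      let ?q = "ppoint n (i, Q)"
      note q = chart_partD[OF i Q]
      interpret hprime n "nonzero_at n ?q" by (rule q(4))
      have c: "i \<in> charts n (nonzero_at n ?q)" using q(5) by simp
      have fq: "f \<in> denoms n ?q" "s ?q = fr (denoms n ?q) a f"
        using f q(1) by (auto simp: fraction_on_def mem_sat)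
      then have "?f \<in> denoms n ?q" "s ?q = fr (denoms n ?q) ?a ?f"
        using sat_mult[OF xpow_sat[OF c]] sat.fr_expand[OF _ xpow_sat[OF c]] by auto
      moreover from this have m: "(?a, ?f) \<in> chart_pairs n {i} d Q"
        using chart_pairs_iff[of ?a ?f "{i}" d] a unfolding q(6) by simp
      moreover have "Q \<in> chart_part n i U" using Q chart_part_open_subset[OF V(3)] by blast
      then have "to_charts n d U s i Q = s ?q \<inter> chart_pairs n {i} d Q"
        using i by (simp add: to_charts_def)
      ultimately show ?thesis
        using frac_eq_fr[OF q(5), of ?a ?f d] unfolding q(6) by (simp add: chart_pairs_def)
    qed
    show ?thesis
    proof (intro exI conjI ballI)
      show "openin (Spec (chart_ring n {i})) (chart_part n i V)"
        using V(1) i openin_proj_space_charts by blast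
      show "P \<in> chart_part n i V" using P V(2) by (simp add: chart_part_def)
      show "chart_part n i V \<subseteq> chart_part n i U" using V(3) by (rule chart_part_open_subset)
      show "?a \<in> hom_loc n {i} d" "?f \<in> hom_loc n {i} 0" by (fact a)+
      fix Q assume Q: "Q \<in> chart_part n i V"
      show "?f \<notin> Q" "to_charts n d U s i Q =
        frac (chart_ring n {i}) (hom_loc n {i} 0 - Q) (chart_module n d {i}) ?a ?f"
        using val[OF Q] by blast+
    qed
  qed
  have "to_charts n d U s i P \<in>
      carrier (loc_module (chart_ring n {i}) (hom_loc n {i} 0 - P) (chart_module n d {i}))"
    if P: "P \<in> chart_part n i U" for P
  proof -
    from 1[OF P] obtain V a f where V: "P \<in> V" "a \<in> hom_loc n {i} d" "f \<in> hom_loc n {i} 0"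
      "\<forall>Q\<in>V. f \<notin> Q \<and> to_charts n d U s i Q =
        frac (chart_ring n {i}) (hom_loc n {i} 0 - Q) (chart_module n d {i}) a f"
      by (elim exE conjE) (rule that)
    show ?thesis using V(2,3) bspec[OF V(4,1)] by (auto simp: loc_module_def)
  qed
  then have "to_charts n d U s i \<in> (\<Pi>\<^sub>E P\<in>chart_part n i U.
      carrier (loc_module (chart_ring n {i}) (hom_loc n {i} 0 - P) (chart_module n d {i})))"
    using i by (auto simp: to_charts_def PiE_iff)
  then show ?thesis using 1 by (simp add: assoc_sheaf_def)
qed

text \<open>Both pullbacks to the overlap are the value of the one function at the common point, cut
  down to the pairs of the overlap.\<close>

lemma to_charts_glued:
  assumes U: "openin (proj_space n) U" and s: "s \<in> fsections n d U"
  shows "to_charts n d U s \<in> glued_sections n (chart_module n d) U"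
proof -
  have "loc_map (chart_ring n {i, j}) (hom_loc n {i, j} 0 - R) (chart_module n d {i, j})
        (to_charts n d U s i (R \<inter> hom_loc n {i} 0)) =
      loc_map (chart_ring n {i, j}) (hom_loc n {i, j} 0 - R) (chart_module n d {i, j})
        (to_charts n d U s j (R \<inter> hom_loc n {j} 0))"
    if ij: "i \<le> n" "j \<le> n" and R: "R \<in> primes (chart_ring n {i, j})"
      and p: "ppoint n (i, R \<inter> hom_loc n {i} 0) \<in> U" for i j R
  proof -
    let ?p = "ppoint n (i, R \<inter> hom_loc n {i} 0)"
    note o = overlap_point[OF ij R]
    interpret hprime n "nonzero_at n ?p" by (rule o(6))
    have deg: "degree_frac n (nonzero_at n ?p) d (s ?p)" by (rule fsections_degree_frac[OF s p])
    have *: "loc_map (chart_ring n {i, j}) (hom_loc n {i, j} 0 - R) (chart_module n d {i, j})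
          (s ?p \<inter> chart_pairs n {k} d (prime_of n (nonzero_at n ?p) {k})) = s ?p \<inter> chart_pairs n {i, j} d R"
      if k: "k \<in> {i, j}" for k
    proof -
      have kc: "k \<in> charts n (nonzero_at n ?p)" using k o(2) by auto
      obtain a f where a: "(a, f) \<in> chart_pairs n {k} d (prime_of n (nonzero_at n ?p) {k})"
        "s ?p = fr (denoms n ?p) a f" by (rule degree_frac_chart[OF deg kc])
      show ?thesis using loc_map_eq[OF o(2) _ _ a(1)] k unfolding a(2) o(3) by auto
    qed
    have "to_charts n d U s i (R \<inter> hom_loc n {i} 0) = s ?p \<inter> chart_pairs n {i} d (prime_of n (nonzero_at n ?p) {i})"
      using ij(1) p o(4,7) by (simp add: to_charts_def chart_part_def)
    moreover have "to_charts n d U s j (R \<inter> hom_loc n {j} 0) = s ?p \<inter> chart_pairs n {j} d (prime_of n (nonzero_at n ?p) {j})"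
      using ij(2) p o(1,5,8) by (simp add: to_charts_def chart_part_def)
    ultimately show ?thesis using * by simp
  qed
  moreover have "to_charts n d U s \<in> extensional {..n}" by (simp add: to_charts_def)
  ultimately show ?thesis
    using to_charts_section[OF U s]
    unfolding glued_sections_def Let_def PiE_iff carrier_chart_ring by auto
qed

lemma glued_sections_overlap:
  assumes "\<sigma> \<in> glued_sections n N U" "i \<le> n" "j \<le> n" "R \<in> primes (chart_ring n {i, j})"
    "ppoint n (i, R \<inter> hom_loc n {i} 0) \<in> U"
  shows "loc_map (chart_ring n {i, j}) (hom_loc n {i, j} 0 - R) (N {i, j}) (\<sigma> i (R \<inter> hom_loc n {i} 0)) =
    loc_map (chart_ring n {i, j}) (hom_loc n {i, j} 0 - R) (N {i, j}) (\<sigma> j (R \<inter> hom_loc n {j} 0))"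
  using assms unfolding glued_sections_def Let_def carrier_chart_ring by blast

lemma from_charts_value:
  assumes U: "openin (proj_space n) U" and \<sigma>: "\<sigma> \<in> glued_sections n (chart_module n d) U"
    and p: "p \<in> U" and i: "i \<in> charts n (nonzero_at n p)"
    and a: "(a, f) \<in> \<sigma> i (prime_of n (nonzero_at n p) {i})"
  shows "from_charts n U \<sigma> p = fr (denoms n p) a f"
    and "\<sigma> i (prime_of n (nonzero_at n p) {i}) =
      fr (denoms n p) a f \<inter> chart_pairs n {i} d (prime_of n (nonzero_at n p) {i})"
proof -
  let ?T = "nonzero_at n p"
  have pt: "p \<in> topspace (proj_space n)" by (rule open_points[OF U p])
  interpret hprime n ?T by (rule hprime_nonzero_at[OF pt])
  have val: "\<exists>a f. (a, f) \<in> chart_pairs n {j} d (prime_of n ?T {j}) \<and>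
      \<sigma> j (prime_of n ?T {j}) = fr (denoms n p) a f \<inter> chart_pairs n {j} d (prime_of n ?T {j})"
    if j: "j \<in> charts n ?T" for j
  proof -
    have "\<sigma> j (prime_of n ?T {j}) \<in>
        carrier (loc_module (chart_ring n {j}) (hom_loc n {j} 0 - prime_of n ?T {j}) (chart_module n d {j}))"
      using \<sigma> prime_of_chart_part[OF U p j] j
      by (auto simp: glued_sections_def assoc_sheaf_def PiE_iff charts_def)
    then show ?thesis using loc_module_carrier[of "{j}"] j by simp
  qed
  have key: "fr (denoms n p) a f = fr (denoms n p) b g"
    if j: "j \<in> charts n ?T" "k \<in> charts n ?T" and a: "(a, f) \<in> \<sigma> j (prime_of n ?T {j})"
      and b: "(b, g) \<in> \<sigma> k (prime_of n ?T {k})" for j k a f b g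
  proof -
    obtain a0 f0 where a0: "(a0, f0) \<in> chart_pairs n {j} d (prime_of n ?T {j})"
      "\<sigma> j (prime_of n ?T {j}) = fr (denoms n p) a0 f0 \<inter> chart_pairs n {j} d (prime_of n ?T {j})"
      using val[OF j(1)] by blast
    obtain b0 g0 where b0: "(b0, g0) \<in> chart_pairs n {k} d (prime_of n ?T {k})"
      "\<sigma> k (prime_of n ?T {k}) = fr (denoms n p) b0 g0 \<inter> chart_pairs n {k} d (prime_of n ?T {k})"
      using val[OF j(2)] by blast
    have S: "f0 \<in> denoms n p" "g0 \<in> denoms n p" using a0 b0 by (auto simp: chart_pairs_iff)
    \<comment> \<open>The prime of the overlap ring that contracts to the primes of p in both
      charts.\<close>
    let ?R = "prime_of n ?T {j, k}"
    have jk: "{j, k} \<subseteq> charts n ?T" "j \<le> n" "k \<le> n" using j by (auto simp: charts_def)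
    have R: "?R \<in> primes (chart_ring n {j, k})" by (rule prime_of_primes[OF jk(1)])
    have c: "?R \<inter> hom_loc n {j} 0 = prime_of n ?T {j}" "?R \<inter> hom_loc n {k} 0 = prime_of n ?T {k}"
      using hom_loc_mono[of _ n "{j}" 0 "{j, k}"] hom_loc_mono[of _ n "{k}" 0 "{j, k}"]
      by (auto simp: prime_of_def)
    have "loc_map (chart_ring n {j, k}) (hom_loc n {j, k} 0 - ?R) (chart_module n d {j, k}) (\<sigma> j (prime_of n ?T {j})) =
      loc_map (chart_ring n {j, k}) (hom_loc n {j, k} 0 - ?R) (chart_module n d {j, k}) (\<sigma> k (prime_of n ?T {k}))"
      using glued_sections_overlap[OF \<sigma> jk(2,3) R] unfolding c using point_eq[OF pt j(1)] p by simp
    then have "fr (denoms n p) a0 f0 \<inter> chart_pairs n {j, k} d ?R = fr (denoms n p) b0 g0 \<inter> chart_pairs n {j, k} d ?R"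
      using loc_map_eq[OF jk(1) _ _ a0(1)] loc_map_eq[OF jk(1) _ _ b0(1)] unfolding a0(2) b0(2) by auto
    moreover have "(a0, f0) \<in> fr (denoms n p) a0 f0 \<inter> chart_pairs n {j, k} d ?R"
      using sat.fr_self[OF S(1)] a0(1) chart_pairs_mono[of "{j}" "{j, k}"] by blast
    ultimately have "fr (denoms n p) a0 f0 = fr (denoms n p) b0 g0"
      using sat.fr_eq_of_mem[OF S(2)] by blast
    then show ?thesis using a b unfolding a0(2) b0(2)
      using sat.fr_eq_of_mem[OF S(1)] sat.fr_eq_of_mem[OF S(2)] by blast
  qed
  have "(\<Union>j\<in>charts n ?T. \<Union>(b, g)\<in>\<sigma> j (prime_of n ?T {j}). fr (denoms n p) b g) = fr (denoms n p) a f"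
    using key[OF _ i _ a] i a by fast
  then show "from_charts n U \<sigma> p = fr (denoms n p) a f"
    using p by (simp add: from_charts_def)
  obtain a0 f0 where a0: "(a0, f0) \<in> chart_pairs n {i} d (prime_of n ?T {i})"
    "\<sigma> i (prime_of n ?T {i}) = fr (denoms n p) a0 f0 \<inter> chart_pairs n {i} d (prime_of n ?T {i})"
    using val[OF i] by blast
  then show "\<sigma> i (prime_of n ?T {i}) = fr (denoms n p) a f \<inter> chart_pairs n {i} d (prime_of n ?T {i})"
    using a sat.fr_eq_of_mem[of f0 a f a0] by (auto simp: chart_pairs_iff)
qed

lemma from_charts_nonempty:
  assumes U: "openin (proj_space n) U" and \<sigma>: "\<sigma> \<in> glued_sections n (chart_module n d) U"
    and p: "p \<in> U" and i: "i \<in> charts n (nonzero_at n p)"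
  obtains V a f where "openin (Spec (chart_ring n {i})) V" "prime_of n (nonzero_at n p) {i} \<in> V"
    "V \<subseteq> chart_part n i U" "a \<in> hom_loc n {i} d" "f \<in> hom_loc n {i} 0"
    "\<And>Q. Q \<in> V \<Longrightarrow> f \<notin> Q \<and> (a, f) \<in> \<sigma> i Q"
proof -
  have "\<sigma> i \<in> carrier (sec (assoc_sheaf (chart_ring n {i}) (chart_module n d {i})) (chart_part n i U))"
    using \<sigma> i by (auto simp: glued_sections_def PiE_iff charts_def)
  then obtain V a f where V: "openin (Spec (chart_ring n {i})) V" "prime_of n (nonzero_at n p) {i} \<in> V"
    "V \<subseteq> chart_part n i U" "a \<in> hom_loc n {i} d" "f \<in> hom_loc n {i} 0"
    "\<forall>Q\<in>V. f \<notin> Q \<and> \<sigma> i Q = frac (chart_ring n {i}) (hom_loc n {i} 0 - Q) (chart_module n d {i}) a f"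
    using prime_of_chart_part[OF U p i] unfolding assoc_sheaf_def by auto
  have "f \<notin> Q \<and> (a, f) \<in> \<sigma> i Q" if Q: "Q \<in> V" for Q
  proof -
    have "i \<le> n" using i by (simp add: charts_def)
    then interpret chart_prime n "{i}" Q using Q V(3) by (intro chart_prime_single) (auto simp: chart_part_def)
    show ?thesis using V Q R_one
      by (auto simp: frac_def intro!: bexI[of _ 1])
  qed
  then show ?thesis using V that by blast
qed

lemma from_charts_fsections:
  assumes U: "openin (proj_space n) U" and \<sigma>: "\<sigma> \<in> glued_sections n (chart_module n d) U"
  shows "from_charts n U \<sigma> \<in> fsections n d U"
proof -
  have "\<exists>V a f. openin (proj_space n) V \<and> p \<in> V \<and> V \<subseteq> U \<and> fraction_on n d V a f (from_charts n U \<sigma>)"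
    if p: "p \<in> U" for p
  proof -
    have pt: "p \<in> topspace (proj_space n)" by (rule open_points[OF U p])
    obtain i where i: "i \<in> charts n (nonzero_at n p)"
      using hprime.charts_nonempty[OF hprime_nonzero_at[OF pt]] by blast
    have "i \<le> n" using i by (simp add: charts_def)
    obtain V a f where V: "openin (Spec (chart_ring n {i})) V" "prime_of n (nonzero_at n p) {i} \<in> V"
      "V \<subseteq> chart_part n i U" "a \<in> hom_loc n {i} d" "f \<in> hom_loc n {i} 0"
      "\<And>Q. Q \<in> V \<Longrightarrow> f \<notin> Q \<and> (a, f) \<in> \<sigma> i Q"
      using from_charts_nonempty[OF U \<sigma> p i] by blast
    obtain k where k: "k \<ge> 0" "xpow i k * a \<in> hom_loc n {} (k + d)"
      using clear_denominator V(4) \<open>i \<le> n\<close> by blast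
    obtain l where l: "l \<ge> 0" "xpow i l * f \<in> hom_loc n {} (l + 0)"
      using clear_denominator V(5) \<open>i \<le> n\<close> by blast
    define W where "W = {q \<in> standard_open n i. prime_of n (nonzero_at n q) {i} \<in> V}"
    have W: "openin (proj_space n) W" unfolding W_def by (rule openin_chart_image[OF \<open>i \<le> n\<close> V(1)])
    \<comment> \<open>x_i^k clears the numerator and x_i^l the denominator; multiplying both by the
      product turns them into polynomials without changing the fraction.\<close>
    let ?a = "xpow i (k + l) * a" and ?f = "xpow i (k + l) * f"
    have a: "?a \<in> hom_loc n {} (d + (k + l))" "?f \<in> hom_loc n {} (k + l)"
      using hom_loc_mult[OF xpow_hom_loc k(2), of i "{}" l "{}" "d + (k + l)"]
        hom_loc_mult[OF xpow_hom_loc l(2), of i "{}" k "{}" "k + l"] \<open>i \<le> n\<close> k(1) l(1)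
      by (simp_all add: xpow_add add.commute flip: mult.assoc)
    have "q \<in> U \<and> ?f \<in> nonzero_at n q \<and> from_charts n U \<sigma> q = fr (denoms n q) ?a ?f" if q: "q \<in> W" for q
    proof -
      have qt: "q \<in> topspace (proj_space n)" and c: "i \<in> charts n (nonzero_at n q)"
        and Q: "prime_of n (nonzero_at n q) {i} \<in> V"
        using q by (auto simp: W_def standard_open_def)
      interpret hprime n "nonzero_at n q" by (rule hprime_nonzero_at[OF qt])
      have qU: "q \<in> U" using Q V(3) point_eq[OF qt c] by (auto simp: chart_part_def)
      have f: "f \<in> denoms n q" using V(5) V(6)[OF Q] by (auto simp: prime_of_def)
      have "?f \<in> denoms n q" by (rule sat_mult[OF xpow_sat[OF c] f])
      then have "?f \<in> nonzero_at n q" using sat_poly[OF a(2)] by simp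
      moreover have "from_charts n U \<sigma> q = fr (denoms n q) a f"
        using from_charts_value(1)[OF U \<sigma> qU c] V(6)[OF Q] by blast
      ultimately show ?thesis using qU sat.fr_expand[OF f xpow_sat[OF c]] by simp
    qed
    then show ?thesis using W a p i V(2) pt unfolding fraction_on_def
      by (intro exI[of _ W] exI[of _ ?a] exI[of _ ?f]) (auto simp: W_def standard_open_def)
  qed
  then show ?thesis by (auto simp: fsections_def from_charts_def)
qed

lemma to_from_charts:
  assumes U: "openin (proj_space n) U" and \<sigma>: "\<sigma> \<in> glued_sections n (chart_module n d) U"
  shows "to_charts n d U (from_charts n U \<sigma>) = \<sigma>"
proof
  fix i
  show "to_charts n d U (from_charts n U \<sigma>) i = \<sigma> i"
  proof (cases "i \<le> n")
    case True
    have "\<sigma> i \<in> carrier (sec (assoc_sheaf (chart_ring n {i}) (chart_module n d {i})) (chart_part n i U))"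
      using \<sigma> True by (auto simp: glued_sections_def PiE_iff)
    then have ext: "\<sigma> i \<in> extensional (chart_part n i U)" by (simp add: assoc_sheaf_def PiE_iff)
    show ?thesis
    proof
      fix P
      show "to_charts n d U (from_charts n U \<sigma>) i P = \<sigma> i P"
      proof (cases "P \<in> chart_part n i U")
        case P: True
        note c = chart_partD[OF True P]
        have ic: "i \<in> charts n (nonzero_at n (ppoint n (i, P)))" using c(5) by simp
        obtain a f where a: "(a, f) \<in> \<sigma> i P"
          using from_charts_nonempty[OF U \<sigma> c(1) ic] unfolding c(6) by metis
        show ?thesis
          using from_charts_value[OF U \<sigma> c(1) ic, of a f] a True P unfolding c(6)
          by (simp add: to_charts_def)
      next
        case False
        then show ?thesis using True extensional_arb[OF ext] by (simp add: to_charts_def)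
      qed
    qed
  next
    case False
    then show ?thesis using \<sigma> by (auto simp: glued_sections_def PiE_iff to_charts_def extensional_def)
  qed
qed

lemma to_charts_inj:
  assumes U: "openin (proj_space n) U" shows "inj_on (to_charts n d U) (fsections n d U)"
proof (rule inj_onI)
  fix s t assume s: "s \<in> fsections n d U" and t: "t \<in> fsections n d U"
    and eq: "to_charts n d U s = to_charts n d U t"
  have ext: "s \<in> extensional U" "t \<in> extensional U" using s t by (auto simp: fsections_def)
  show "s = t"
  proof (rule extensionalityI[OF ext])
    fix p assume p: "p \<in> U"
    have pt: "p \<in> topspace (proj_space n)" by (rule open_points[OF U p])
    interpret hprime n "nonzero_at n p" by (rule hprime_nonzero_at[OF pt])
    obtain i where i: "i \<in> charts n (nonzero_at n p)" using charts_nonempty by blast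
    let ?P = "prime_of n (nonzero_at n p) {i}"
    have c: "?P \<in> chart_part n i U" by (rule prime_of_chart_part[OF U p i])
    have "to_charts n d U s i ?P = to_charts n d U t i ?P" by (simp add: eq)
    then have *: "s p \<inter> chart_pairs n {i} d ?P = t p \<inter> chart_pairs n {i} d ?P"
      using i c point_eq[OF pt i] by (simp add: to_charts_def charts_def)
    obtain a f where a: "(a, f) \<in> chart_pairs n {i} d ?P" "s p = fr (denoms n p) a f"
      using degree_frac_chart[OF fsections_degree_frac[OF s p] i] .
    obtain b g where b: "(b, g) \<in> chart_pairs n {i} d ?P" "t p = fr (denoms n p) b g"
      using degree_frac_chart[OF fsections_degree_frac[OF t p] i] .
    have "(a, f) \<in> fr (denoms n p) b g" using * fr_self_chart[OF a(1)] a(2) b(2) by blast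
    then show "s p = t p" using b sat.fr_eq_of_mem[of g a f b] a(2) by (auto simp: chart_pairs_iff)
  qed
qed

lemma to_charts_bij:
  assumes U: "openin (proj_space n) U"
  shows "bij_betw (to_charts n d U) (fsections n d U) (glued_sections n (chart_module n d) U)"
  unfolding bij_betw_def
proof
  show "to_charts n d U ` fsections n d U = glued_sections n (chart_module n d) U"
  proof (intro equalityI subsetI)
    fix \<sigma> assume \<sigma>: "\<sigma> \<in> glued_sections n (chart_module n d) U"
    show "\<sigma> \<in> to_charts n d U ` fsections n d U"
      by (rule image_eqI[of _ _ "from_charts n U \<sigma>"])
        (simp_all add: to_from_charts[OF U \<sigma>] from_charts_fsections[OF U \<sigma>])
  qed (use to_charts_glued[OF U] in blast)
qed (rule to_charts_inj[OF U])

section \<open>The structure sheaf as the twisting sheaf of degree 0\<close>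

lemma loc_module_regular:
  "loc_module (chart_ring n J) T (regular (chart_ring n J)) = loc_module (chart_ring n J) T (chart_module n 0 J)"
  by (simp add: loc_module_def frac_def regular_def chart_ring_def chart_module_def fun_eq_iff)

lemma assoc_sheaf_regular:
  "assoc_sheaf (chart_ring n J) (regular (chart_ring n J)) = assoc_sheaf (chart_ring n J) (chart_module n 0 J)"
  unfolding assoc_sheaf_def loc_module_regular
  by (simp add: frac_def regular_def chart_ring_def chart_module_def fun_eq_iff)

lemma glued_sections_regular:
  "glued_sections n (\<lambda>J. regular (chart_ring n J)) = glued_sections n (chart_module n 0)"
proof -
  have "loc_map (chart_ring n J) T (regular (chart_ring n J)) = loc_map (chart_ring n J) T (chart_module n 0 J)"
    for J and T :: "'a::comm_semiring_1 laurent set"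
    by (simp add: loc_map_def frac_def regular_def chart_ring_def chart_module_def fun_eq_iff)
  then show ?thesis by (simp add: glued_sections_def assoc_sheaf_regular fun_eq_iff)
qed

lemma carrier_proj_sheaf: "carrier (sec (proj_sheaf n) U) = glued_sections n (chart_module n 0) U"
  by (simp add: proj_sheaf_def glued_sections_regular)

lemma carrier_twisting_sheaf: "carrier (sec (twisting_sheaf n d) U) = glued_sections n (chart_module n d) U"
  by (simp add: twisting_sheaf_def)

lemma proj_sheaf_twisting:
  "s \<otimes>\<^bsub>sec (proj_sheaf n) U\<^esub> t = s \<odot>\<^bsub>sec (twisting_sheaf n 0) U\<^esub> t"
  "s \<oplus>\<^bsub>sec (proj_sheaf n) U\<^esub> t = s \<oplus>\<^bsub>sec (twisting_sheaf n 0) U\<^esub> t"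
  "\<zero>\<^bsub>sec (proj_sheaf n) U\<^esub> = \<zero>\<^bsub>sec (twisting_sheaf n 0) U\<^esub>"
  "res (proj_sheaf n) U V s = res (twisting_sheaf n 0) U V s"
  by (simp_all add: proj_sheaf_def twisting_sheaf_def Spec_sheaf_def assoc_sheaf_def loc_ring_def
      Let_def loc_module_regular)

text \<open>Only the module is replaced by functions. Scalars remain sections of
  \<open>proj_sheaf\<close>, so that isomorphisms can be stated over the given structure sheaf; this
  is why \<open>from_charts\<close> appears in the scalar multiplication.\<close>

definition fsheaf :: "nat \<Rightarrow> int \<Rightarrow> ('m::comm_semiring_1 ppoint, 'm psection, 'm fsection) mod_presheaf" where
  "fsheaf n d = \<lparr>
     sec = (\<lambda>U. \<lparr>carrier = fsections n d U, monoid.mult = undefined, one = undefined,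
       zero = (\<lambda>p\<in>U. fr (denoms n p) 0 1),
       add = (\<lambda>s t. \<lambda>p\<in>U. fr_add (denoms n p) (s p) (t p)),
       smult = (\<lambda>a s. \<lambda>p\<in>U. fr_mult (denoms n p) (from_charts n U a p) (s p))\<rparr>),
     res = (\<lambda>U V s. restrict s V)\<rparr>"

lemma fsheaf_simps [simp]:
  "carrier (sec (fsheaf n d) U) = fsections n d U"
  "\<zero>\<^bsub>sec (fsheaf n d) U\<^esub> = (\<lambda>p\<in>U. fr (denoms n p) 0 1)"
  "s \<oplus>\<^bsub>sec (fsheaf n d) U\<^esub> t = (\<lambda>p\<in>U. fr_add (denoms n p) (s p) (t p))"
  "a \<odot>\<^bsub>sec (fsheaf n d) U\<^esub> s = (\<lambda>p\<in>U. fr_mult (denoms n p) (from_charts n U a p) (s p))"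
  "res (fsheaf n d) U V s = restrict s V"
  by (simp_all add: fsheaf_def)

lemma from_to_charts:
  assumes U: "openin (proj_space n) U" and s: "s \<in> fsections n d U"
  shows "from_charts n U (to_charts n d U s) = s"
  using inj_onD[OF to_charts_inj[OF U] _ from_charts_fsections[OF U to_charts_glued[OF U s]] s]
    to_from_charts[OF U to_charts_glued[OF U s]] by simp

section \<open>Restriction, sums and products of sections given by functions\<close>

lemma fsections_restrict:
  assumes "s \<in> fsections n d U" "openin (proj_space n) V" "V \<subseteq> U"
  shows "restrict s V \<in> fsections n d V"
proof -
  have "\<exists>W a f. openin (proj_space n) W \<and> p \<in> W \<and> W \<subseteq> V \<and> fraction_on n d W a f (restrict s V)"
    if p: "p \<in> V" for p
  proof -
    obtain W a f where W: "openin (proj_space n) W" "p \<in> W" "fraction_on n d W a f s"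
      using assms(1,3) p unfolding fsections_def by blast
    then show ?thesis using assms(2) p
      by (intro exI[of _ "W \<inter> V"] exI[of _ a] exI[of _ f]) (auto simp: fraction_on_def)
  qed
  then show ?thesis by (simp add: fsections_def)
qed

lemma fsections_localI:
  assumes s: "s \<in> extensional U"
    and loc: "\<And>p. p \<in> U \<Longrightarrow> \<exists>V. openin (proj_space n) V \<and> p \<in> V \<and> V \<subseteq> U \<and> restrict s V \<in> fsections n d V"
  shows "s \<in> fsections n d U"
proof -
  have "\<exists>W a f. openin (proj_space n) W \<and> p \<in> W \<and> W \<subseteq> U \<and> fraction_on n d W a f s" if p: "p \<in> U" for p
  proof -
    obtain V where V: "openin (proj_space n) V" "p \<in> V" "V \<subseteq> U" "restrict s V \<in> fsections n d V"
      using loc[OF p] by blast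
    then obtain W a f where W: "openin (proj_space n) W" "p \<in> W" "W \<subseteq> V" "fraction_on n d W a f (restrict s V)"
      unfolding fsections_def by blast
    have "\<forall>q\<in>W. restrict s V q = s q" using W(3) by auto
    then have "fraction_on n d W a f s" using W(4) by (simp add: fraction_on_def)
    then show ?thesis using W(1-3) V(3) by blast
  qed
  then show ?thesis using s by (simp add: fsections_def)
qed

lemma fraction_on_subset: "fraction_on n d V a f s \<Longrightarrow> W \<subseteq> V \<Longrightarrow> fraction_on n d W a f s"
  by (auto simp: fraction_on_def)

lemma fraction_on_add:
  assumes "fraction_on n d V a f s" "fraction_on n d V b g t" "V \<subseteq> topspace (proj_space n)" "V \<subseteq> U"
  shows "fraction_on n d V (g * a + f * b) (f * g) (\<lambda>p\<in>U. fr_add (denoms n p) (s p) (t p))"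
proof -
  obtain e e' where e: "a \<in> hom_loc n {} (d + e)" "f \<in> hom_loc n {} e"
    "b \<in> hom_loc n {} (d + e')" "g \<in> hom_loc n {} e'" using assms by (auto simp: fraction_on_def)
  have "g * a + f * b \<in> hom_loc n {} (d + (e + e'))" "f * g \<in> hom_loc n {} (e + e')"
    using e by (auto intro!: hom_loc_add intro: hom_loc_mult)
  moreover have "f * g \<in> nonzero_at n q \<and> fr_add (denoms n q) (s q) (t q) = fr (denoms n q) (g * a + f * b) (f * g)"
    if q: "q \<in> V" for q
  proof -
    interpret hprime n "nonzero_at n q" using q assms(3) hprime_nonzero_at by blast
    have "f \<in> nonzero_at n q" "g \<in> nonzero_at n q" "s q = fr (denoms n q) a f" "t q = fr (denoms n q) b g"
      using q assms(1,2) by (auto simp: fraction_on_def)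
    then show ?thesis using sat.fr_add_eq mem_sat mult_mem by simp
  qed
  ultimately show ?thesis using assms(4) by (auto simp: fraction_on_def)
qed

lemma fraction_on_mult:
  assumes "fraction_on n d V a f s" "fraction_on n d' V b g t" "V \<subseteq> topspace (proj_space n)" "V \<subseteq> U"
  shows "fraction_on n (d + d') V (a * b) (f * g) (\<lambda>p\<in>U. fr_mult (denoms n p) (s p) (t p))"
proof -
  obtain e e' where e: "a \<in> hom_loc n {} (d + e)" "f \<in> hom_loc n {} e"
    "b \<in> hom_loc n {} (d' + e')" "g \<in> hom_loc n {} e'" using assms by (auto simp: fraction_on_def)
  have "a * b \<in> hom_loc n {} (d + d' + (e + e'))" "f * g \<in> hom_loc n {} (e + e')"
    using e by (auto intro: hom_loc_mult)
  moreover have "f * g \<in> nonzero_at n q \<and> fr_mult (denoms n q) (s q) (t q) = fr (denoms n q) (a * b) (f * g)"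
    if q: "q \<in> V" for q
  proof -
    interpret hprime n "nonzero_at n q" using q assms(3) hprime_nonzero_at by blast
    have "f \<in> nonzero_at n q" "g \<in> nonzero_at n q" "s q = fr (denoms n q) a f" "t q = fr (denoms n q) b g"
      using q assms(1,2) by (auto simp: fraction_on_def)
    then show ?thesis using sat.fr_mult_eq mem_sat mult_mem by simp
  qed
  ultimately show ?thesis using assms(4) by (auto simp: fraction_on_def)
qed

lemma common_fraction:
  assumes "s \<in> fsections n d U" "t \<in> fsections n d' U" "p \<in> U"
  obtains V a f b g where "openin (proj_space n) V" "p \<in> V" "V \<subseteq> U"
    "fraction_on n d V a f s" "fraction_on n d' V b g t"
proof -
  obtain V a f where V: "openin (proj_space n) V" "p \<in> V" "V \<subseteq> U" "fraction_on n d V a f s"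
    using assms(1,3) unfolding fsections_def by blast
  obtain W b g where W: "openin (proj_space n) W" "p \<in> W" "W \<subseteq> U" "fraction_on n d' W b g t"
    using assms(2,3) unfolding fsections_def by blast
  show ?thesis
    by (rule that[of "V \<inter> W" a f b g]) (use V W fraction_on_subset in blast)+
qed

lemma fsections_add:
  assumes "s \<in> fsections n d U" "t \<in> fsections n d U"
  shows "(\<lambda>p\<in>U. fr_add (denoms n p) (s p) (t p)) \<in> fsections n d U"
proof -
  have "\<exists>V a f. openin (proj_space n) V \<and> p \<in> V \<and> V \<subseteq> U \<and>
      fraction_on n d V a f (\<lambda>p\<in>U. fr_add (denoms n p) (s p) (t p))" if p: "p \<in> U" for p
  proof -
    obtain V a f b g where V: "openin (proj_space n) V" "p \<in> V" "V \<subseteq> U"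
      "fraction_on n d V a f s" "fraction_on n d V b g t" by (rule common_fraction[OF assms p])
    show ?thesis using fraction_on_add[OF V(4,5) openin_subset[OF V(1)] V(3)] V(1-3) by blast
  qed
  then show ?thesis by (simp add: fsections_def)
qed

lemma fsections_mult:
  assumes "s \<in> fsections n d U" "t \<in> fsections n d' U" "e = d + d'"
  shows "(\<lambda>p\<in>U. fr_mult (denoms n p) (s p) (t p)) \<in> fsections n e U"
proof -
  have "\<exists>V a f. openin (proj_space n) V \<and> p \<in> V \<and> V \<subseteq> U \<and>
      fraction_on n (d + d') V a f (\<lambda>p\<in>U. fr_mult (denoms n p) (s p) (t p))" if p: "p \<in> U" for p
  proof -
    obtain V a f b g where V: "openin (proj_space n) V" "p \<in> V" "V \<subseteq> U"
      "fraction_on n d V a f s" "fraction_on n d' V b g t" by (rule common_fraction[OF assms(1,2) p])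
    show ?thesis using fraction_on_mult[OF V(4,5) openin_subset[OF V(1)] V(3)] V(1-3) by blast
  qed
  then show ?thesis by (simp add: fsections_def assms(3))
qed

lemma fraction_on_fsections:
  assumes U: "openin (proj_space n) U" and "s \<in> extensional U" "fraction_on n d U a f s"
  shows "s \<in> fsections n d U"
  using assms by (auto simp: fsections_def)

lemma fsections_zero:
  assumes U: "openin (proj_space n) U"
  shows "(\<lambda>p\<in>U. fr (denoms n p) 0 1) \<in> fsections n d U"
proof -
  have "1 \<in> nonzero_at n q" if "q \<in> U" for q
    using hprime.one_mem[OF hprime_nonzero_at[OF open_points[OF U that]]] .
  then show ?thesis
    by (intro fraction_on_fsections[OF U, of _ d 0 1]) (auto simp: fraction_on_def intro!: exI[of _ 0])
qed

lemma fsection_chart_value: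
  assumes U: "openin (proj_space n) U" and s: "s \<in> fsections n d U" and i: "i \<le> n" "P \<in> chart_part n i U"
  obtains a f where "(a, f) \<in> chart_pairs n {i} d P" "s (ppoint n (i, P)) = fr (denoms n (ppoint n (i, P))) a f"
proof -
  note c = chart_partD[OF i]
  interpret hprime n "nonzero_at n (ppoint n (i, P))" by (rule c(4))
  have ic: "i \<in> charts n (nonzero_at n (ppoint n (i, P)))" using c(5) by simp
  show ?thesis
    using degree_frac_chart[OF fsections_degree_frac[OF s c(1)] ic] that unfolding c(6) by metis
qed

lemma to_charts_zero:
  assumes U: "openin (proj_space n) U"
  shows "to_charts n d U (\<lambda>p\<in>U. fr (denoms n p) 0 1) = \<zero>\<^bsub>sec (twisting_sheaf n d) U\<^esub>"
proof -
  have "(\<lambda>p\<in>U. fr (denoms n p) 0 1) (ppoint n (i, P)) \<inter> chart_pairs n {i} d P =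
      \<zero>\<^bsub>loc_module (chart_ring n {i}) (hom_loc n {i} 0 - P) (chart_module n d {i})\<^esub>"
    if i: "i \<le> n" "P \<in> chart_part n i U" for i P
  proof -
    note c = chart_partD[OF i]
    interpret hprime n "nonzero_at n (ppoint n (i, P))" by (rule c(4))
    show ?thesis using loc_module_zero[OF c(5), of d] c(1) unfolding c(6) by simp
  qed
  then show ?thesis
    by (auto simp: to_charts_def twisting_sheaf_def assoc_sheaf_def intro!: restrict_ext)
qed

lemma to_charts_add:
  assumes U: "openin (proj_space n) U" and s: "s \<in> fsections n d U" and t: "t \<in> fsections n d U"
  shows "to_charts n d U (\<lambda>p\<in>U. fr_add (denoms n p) (s p) (t p)) =
    to_charts n d U s \<oplus>\<^bsub>sec (twisting_sheaf n d) U\<^esub> to_charts n d U t"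
proof -
  have "(\<lambda>p\<in>U. fr_add (denoms n p) (s p) (t p)) (ppoint n (i, P)) \<inter> chart_pairs n {i} d P =
      to_charts n d U s i P \<oplus>\<^bsub>loc_module (chart_ring n {i}) (hom_loc n {i} 0 - P) (chart_module n d {i})\<^esub>
      to_charts n d U t i P"
    if i: "i \<le> n" "P \<in> chart_part n i U" for i P
  proof -
    note c = chart_partD[OF i]
    interpret hprime n "nonzero_at n (ppoint n (i, P))" by (rule c(4))
    obtain a f where a: "(a, f) \<in> chart_pairs n {i} d P" "s (ppoint n (i, P)) = fr (denoms n (ppoint n (i, P))) a f"
      by (rule fsection_chart_value[OF U s i])
    obtain b g where b: "(b, g) \<in> chart_pairs n {i} d P" "t (ppoint n (i, P)) = fr (denoms n (ppoint n (i, P))) b g"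
      by (rule fsection_chart_value[OF U t i])
    show ?thesis
      using loc_module_add[OF c(5), unfolded c(6), OF _ a(1) b(1)] c(1) i a(2) b(2) by (simp add: to_charts_def)
  qed
  then show ?thesis
    by (auto simp: to_charts_def[of n d U "restrict _ _"] twisting_sheaf_def assoc_sheaf_def intro!: restrict_ext)
qed

lemma to_charts_smult:
  assumes U: "openin (proj_space n) U" and s: "s \<in> fsections n 0 U" and t: "t \<in> fsections n d U"
  shows "to_charts n d U (\<lambda>p\<in>U. fr_mult (denoms n p) (s p) (t p)) =
    to_charts n 0 U s \<odot>\<^bsub>sec (twisting_sheaf n d) U\<^esub> to_charts n d U t"
proof -
  have "(\<lambda>p\<in>U. fr_mult (denoms n p) (s p) (t p)) (ppoint n (i, P)) \<inter> chart_pairs n {i} d P =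
      to_charts n 0 U s i P \<odot>\<^bsub>loc_module (chart_ring n {i}) (hom_loc n {i} 0 - P) (chart_module n d {i})\<^esub>
      to_charts n d U t i P"
    if i: "i \<le> n" "P \<in> chart_part n i U" for i P
  proof -
    note c = chart_partD[OF i]
    interpret hprime n "nonzero_at n (ppoint n (i, P))" by (rule c(4))
    obtain a f where a: "(a, f) \<in> chart_pairs n {i} 0 P" "s (ppoint n (i, P)) = fr (denoms n (ppoint n (i, P))) a f"
      by (rule fsection_chart_value[OF U s i])
    obtain b g where b: "(b, g) \<in> chart_pairs n {i} d P" "t (ppoint n (i, P)) = fr (denoms n (ppoint n (i, P))) b g"
      by (rule fsection_chart_value[OF U t i])
    show ?thesis
      using loc_module_smult[OF c(5), unfolded c(6), OF _ a(1) b(1)] c(1) i a(2) b(2) by (simp add: to_charts_def)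
  qed
  then show ?thesis
    by (auto simp: to_charts_def[of n d U "restrict _ _"] twisting_sheaf_def assoc_sheaf_def intro!: restrict_ext)
qed

lemma to_charts_res:
  assumes "V \<subseteq> U"
  shows "to_charts n d V (restrict s V) = res (twisting_sheaf n d) U V (to_charts n d U s)"
  unfolding to_charts_def twisting_sheaf_def partial_object.simps presheaf.simps
proof (intro restrict_ext)
  fix i P assume "i \<in> {..n}" "P \<in> chart_part n i V"
  moreover have "P \<in> chart_part n i U" using \<open>P \<in> _\<close> chart_part_open_subset[OF assms] by blast
  ultimately show "restrict s V (ppoint n (i, P)) \<inter> chart_pairs n {i} d P =
      (\<lambda>i\<in>{..n}. \<lambda>P\<in>chart_part n i U. s (ppoint n (i, P)) \<inter> chart_pairs n {i} d P) i P"
    by (simp add: chart_part_def)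
qed

lemma from_charts_res:
  assumes "openin (proj_space n) U" "openin (proj_space n) V" "V \<subseteq> U" "\<sigma> \<in> glued_sections n (chart_module n d) U"
  shows "from_charts n V (res (twisting_sheaf n d) U V \<sigma>) = restrict (from_charts n U \<sigma>) V"
  using from_to_charts[OF assms(2) fsections_restrict[OF from_charts_fsections[OF assms(1,4)] assms(2,3)]]
    to_charts_res[OF assms(3), of n d "from_charts n U \<sigma>"] to_from_charts[OF assms(1,4)] by simp

section \<open>Isomorphisms of sheaves of semimodules with a named map\<close>

definition sheaf_iso ::
  "'p topology \<Rightarrow> ('p, 'a) ring_presheaf \<Rightarrow> ('p, 'a, 's) mod_presheaf \<Rightarrow> ('p, 'a, 't) mod_presheaf \<Rightarrow>
   ('p set \<Rightarrow> 's \<Rightarrow> 't) \<Rightarrow> bool" where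
  "sheaf_iso X OX F G \<phi> \<longleftrightarrow>
     (\<forall>U. openin X U \<longrightarrow>
        bij_betw (\<phi> U) (carrier (sec F U)) (carrier (sec G U)) \<and>
        \<phi> U \<zero>\<^bsub>sec F U\<^esub> = \<zero>\<^bsub>sec G U\<^esub> \<and>
        (\<forall>s\<in>carrier (sec F U). \<forall>t\<in>carrier (sec F U).
           \<phi> U (s \<oplus>\<^bsub>sec F U\<^esub> t) = \<phi> U s \<oplus>\<^bsub>sec G U\<^esub> \<phi> U t) \<and>
        (\<forall>a\<in>carrier (sec OX U). \<forall>s\<in>carrier (sec F U).
           \<phi> U (a \<odot>\<^bsub>sec F U\<^esub> s) = a \<odot>\<^bsub>sec G U\<^esub> \<phi> U s)) \<and>
     (\<forall>U V. openin X U \<longrightarrow> openin X V \<longrightarrow> V \<subseteq> U \<longrightarrow>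
        (\<forall>s\<in>carrier (sec F U). \<phi> V (res F U V s) = res G U V (\<phi> U s)))"

lemma sheaf_isomorphic_iff: "sheaf_isomorphic X OX F G \<longleftrightarrow> (\<exists>\<phi>. sheaf_iso X OX F G \<phi>)"
  unfolding sheaf_isomorphic_def sheaf_iso_def ..

lemma sheaf_isoI:
  assumes "\<And>U. openin X U \<Longrightarrow> bij_betw (\<phi> U) (carrier (sec F U)) (carrier (sec G U))"
    and "\<And>U. openin X U \<Longrightarrow> \<phi> U \<zero>\<^bsub>sec F U\<^esub> = \<zero>\<^bsub>sec G U\<^esub>"
    and "\<And>U s t. openin X U \<Longrightarrow> s \<in> carrier (sec F U) \<Longrightarrow> t \<in> carrier (sec F U) \<Longrightarrow>
      \<phi> U (s \<oplus>\<^bsub>sec F U\<^esub> t) = \<phi> U s \<oplus>\<^bsub>sec G U\<^esub> \<phi> U t"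
    and "\<And>U a s. openin X U \<Longrightarrow> a \<in> carrier (sec OX U) \<Longrightarrow> s \<in> carrier (sec F U) \<Longrightarrow>
      \<phi> U (a \<odot>\<^bsub>sec F U\<^esub> s) = a \<odot>\<^bsub>sec G U\<^esub> \<phi> U s"
    and "\<And>U V s. openin X U \<Longrightarrow> openin X V \<Longrightarrow> V \<subseteq> U \<Longrightarrow> s \<in> carrier (sec F U) \<Longrightarrow>
      \<phi> V (res F U V s) = res G U V (\<phi> U s)"
  shows "sheaf_iso X OX F G \<phi>"
  using assms by (simp add: sheaf_iso_def)

lemma sheaf_isoD:
  assumes "sheaf_iso X OX F G \<phi>" "openin X U"
  shows "bij_betw (\<phi> U) (carrier (sec F U)) (carrier (sec G U))"
    and "\<phi> U \<zero>\<^bsub>sec F U\<^esub> = \<zero>\<^bsub>sec G U\<^esub>"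
    and "s \<in> carrier (sec F U) \<Longrightarrow> t \<in> carrier (sec F U) \<Longrightarrow>
      \<phi> U (s \<oplus>\<^bsub>sec F U\<^esub> t) = \<phi> U s \<oplus>\<^bsub>sec G U\<^esub> \<phi> U t"
    and "a \<in> carrier (sec OX U) \<Longrightarrow> s \<in> carrier (sec F U) \<Longrightarrow>
      \<phi> U (a \<odot>\<^bsub>sec F U\<^esub> s) = a \<odot>\<^bsub>sec G U\<^esub> \<phi> U s"
    and "openin X V \<Longrightarrow> V \<subseteq> U \<Longrightarrow> s \<in> carrier (sec F U) \<Longrightarrow>
      \<phi> V (res F U V s) = res G U V (\<phi> U s)"
  using assms by (simp_all add: sheaf_iso_def)

lemma sheaf_iso_closed:
  "sheaf_iso X OX F G \<phi> \<Longrightarrow> openin X U \<Longrightarrow> s \<in> carrier (sec F U) \<Longrightarrow> \<phi> U s \<in> carrier (sec G U)"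
  using sheaf_isoD(1) bij_betwE by blast

lemma sheaf_iso_trans:
  assumes "sheaf_iso X OX F G \<phi>" "sheaf_iso X OX G H \<psi>"
  shows "sheaf_iso X OX F H (\<lambda>U s. \<psi> U (\<phi> U s))"
proof (rule sheaf_isoI)
  fix U assume U: "openin X U"
  show "bij_betw (\<lambda>s. \<psi> U (\<phi> U s)) (carrier (sec F U)) (carrier (sec H U))"
    using bij_betw_trans[OF sheaf_isoD(1)[OF assms(1) U] sheaf_isoD(1)[OF assms(2) U]] by (simp add: comp_def)
qed (simp_all add: sheaf_isoD[OF assms(1)] sheaf_isoD[OF assms(2)] sheaf_iso_closed[OF assms(1)])

lemma sheaf_isomorphic_trans:
  "sheaf_isomorphic X OX F G \<Longrightarrow> sheaf_isomorphic X OX G H \<Longrightarrow> sheaf_isomorphic X OX F H"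
  unfolding sheaf_isomorphic_iff using sheaf_iso_trans by blast

lemma fsheaf_iso_twisting:
  "sheaf_iso (proj_space n) (proj_sheaf n) (fsheaf n d) (twisting_sheaf n d) (to_charts n d)"
proof (rule sheaf_isoI)
  fix U :: "'a ppoint set" and a s
  assume U: "openin (proj_space n) U" and a: "a \<in> carrier (sec (proj_sheaf n) U)"
    and s: "s \<in> carrier (sec (fsheaf n d) U)"
  then have a': "a \<in> glued_sections n (chart_module n 0) U" by (simp add: carrier_proj_sheaf)
  show "to_charts n d U (a \<odot>\<^bsub>sec (fsheaf n d) U\<^esub> s) = a \<odot>\<^bsub>sec (twisting_sheaf n d) U\<^esub> to_charts n d U s"
    using to_charts_smult[OF U from_charts_fsections[OF U a']] s to_from_charts[OF U a'] by simp
qed (simp_all add: carrier_twisting_sheaf to_charts_bij to_charts_zero to_charts_add to_charts_res)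

section \<open>Tensor products of locally free sheaves of rank one\<close>

text \<open>
  \<open>H\<close> is a sheaf whose sections are functions, and \<open>\<beta>\<close> is a bilinear pairing into \<open>H\<close> for which
  \<open>G\<close> has local generators \<open>y\<close> such that pairing with \<open>y\<close> is bijective.  Then \<open>\<beta>\<close> is a tensor product:
  locally every tensor is of the form \<open>s \<otimes> y\<close>, and \<open>s\<close> is determined by \<open>\<beta> s y\<close>.
\<close>

locale tensor_pairing =
  fixes X :: "'p topology" and OX :: "('p, 'a) ring_presheaf"
    and F :: "('p, 'a, 's) mod_presheaf" and G :: "('p, 'a, 't) mod_presheaf"
    and H :: "('p, 'a, 'p \<Rightarrow> 'v) mod_presheaf"
    and \<beta> :: "'p set \<Rightarrow> 's \<Rightarrow> 't \<Rightarrow> 'p \<Rightarrow> 'v"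
  assumes OX_res: "\<lbrakk>openin X U; openin X V; V \<subseteq> U; a \<in> carrier (sec OX U)\<rbrakk> \<Longrightarrow> res OX U V a \<in> carrier (sec OX V)"
    and OX_res_res: "\<lbrakk>openin X U; openin X V; openin X W; W \<subseteq> V; V \<subseteq> U; a \<in> carrier (sec OX U)\<rbrakk> \<Longrightarrow>
      res OX V W (res OX U V a) = res OX U W a"
    and F_zero: "openin X U \<Longrightarrow> \<zero>\<^bsub>sec F U\<^esub> \<in> carrier (sec F U)"
    and F_add: "\<lbrakk>openin X U; s \<in> carrier (sec F U); s' \<in> carrier (sec F U)\<rbrakk> \<Longrightarrow> s \<oplus>\<^bsub>sec F U\<^esub> s' \<in> carrier (sec F U)"
    and F_smult: "\<lbrakk>openin X U; a \<in> carrier (sec OX U); s \<in> carrier (sec F U)\<rbrakk> \<Longrightarrow> a \<odot>\<^bsub>sec F U\<^esub> s \<in> carrier (sec F U)"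
    and F_res: "\<lbrakk>openin X U; openin X V; V \<subseteq> U; s \<in> carrier (sec F U)\<rbrakk> \<Longrightarrow> res F U V s \<in> carrier (sec F V)"
    and G_zero: "openin X U \<Longrightarrow> \<zero>\<^bsub>sec G U\<^esub> \<in> carrier (sec G U)"
    and G_add: "\<lbrakk>openin X U; t \<in> carrier (sec G U); t' \<in> carrier (sec G U)\<rbrakk> \<Longrightarrow> t \<oplus>\<^bsub>sec G U\<^esub> t' \<in> carrier (sec G U)"
    and G_smult: "\<lbrakk>openin X U; a \<in> carrier (sec OX U); t \<in> carrier (sec G U)\<rbrakk> \<Longrightarrow> a \<odot>\<^bsub>sec G U\<^esub> t \<in> carrier (sec G U)"
    and G_res: "\<lbrakk>openin X U; openin X V; V \<subseteq> U; t \<in> carrier (sec G U)\<rbrakk> \<Longrightarrow> res G U V t \<in> carrier (sec G V)"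
    and H_monoid: "openin X U \<Longrightarrow> abelian_monoid (sec H U)"
    and H_smult_closed: "\<lbrakk>openin X U; a \<in> carrier (sec OX U); x \<in> carrier (sec H U)\<rbrakk> \<Longrightarrow> a \<odot>\<^bsub>sec H U\<^esub> x \<in> carrier (sec H U)"
    and H_smult_add: "\<lbrakk>openin X U; a \<in> carrier (sec OX U); x \<in> carrier (sec H U); y \<in> carrier (sec H U)\<rbrakk> \<Longrightarrow>
      a \<odot>\<^bsub>sec H U\<^esub> (x \<oplus>\<^bsub>sec H U\<^esub> y) = a \<odot>\<^bsub>sec H U\<^esub> x \<oplus>\<^bsub>sec H U\<^esub> a \<odot>\<^bsub>sec H U\<^esub> y"
    and H_smult_zero: "\<lbrakk>openin X U; a \<in> carrier (sec OX U)\<rbrakk> \<Longrightarrow> a \<odot>\<^bsub>sec H U\<^esub> \<zero>\<^bsub>sec H U\<^esub> = \<zero>\<^bsub>sec H U\<^esub>"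
    and H_ext: "\<lbrakk>openin X U; x \<in> carrier (sec H U)\<rbrakk> \<Longrightarrow> x \<in> extensional U"
    and H_res: "res H U V x = restrict x V"
    and H_restrict: "\<lbrakk>openin X U; openin X V; V \<subseteq> U; x \<in> carrier (sec H U)\<rbrakk> \<Longrightarrow> restrict x V \<in> carrier (sec H V)"
    and H_restrict_zero: "\<lbrakk>openin X U; openin X V; V \<subseteq> U\<rbrakk> \<Longrightarrow> restrict \<zero>\<^bsub>sec H U\<^esub> V = \<zero>\<^bsub>sec H V\<^esub>"
    and H_restrict_add: "\<lbrakk>openin X U; openin X V; V \<subseteq> U; x \<in> carrier (sec H U); y \<in> carrier (sec H U)\<rbrakk> \<Longrightarrow>
      restrict (x \<oplus>\<^bsub>sec H U\<^esub> y) V = restrict x V \<oplus>\<^bsub>sec H V\<^esub> restrict y V"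
    and H_restrict_smult: "\<lbrakk>openin X U; openin X V; V \<subseteq> U; a \<in> carrier (sec OX U); x \<in> carrier (sec H U)\<rbrakk> \<Longrightarrow>
      restrict (a \<odot>\<^bsub>sec H U\<^esub> x) V = res OX U V a \<odot>\<^bsub>sec H V\<^esub> restrict x V"
    and H_local: "\<lbrakk>openin X U; x \<in> extensional U;
      \<And>p. p \<in> U \<Longrightarrow> \<exists>V. openin X V \<and> p \<in> V \<and> V \<subseteq> U \<and> restrict x V \<in> carrier (sec H V)\<rbrakk> \<Longrightarrow> x \<in> carrier (sec H U)"
    and \<beta>_closed: "\<lbrakk>openin X U; s \<in> carrier (sec F U); t \<in> carrier (sec G U)\<rbrakk> \<Longrightarrow> \<beta> U s t \<in> carrier (sec H U)"
    and \<beta>_add_left: "\<lbrakk>openin X U; s \<in> carrier (sec F U); s' \<in> carrier (sec F U); t \<in> carrier (sec G U)\<rbrakk> \<Longrightarrow>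
      \<beta> U (s \<oplus>\<^bsub>sec F U\<^esub> s') t = \<beta> U s t \<oplus>\<^bsub>sec H U\<^esub> \<beta> U s' t"
    and \<beta>_add_right: "\<lbrakk>openin X U; s \<in> carrier (sec F U); t \<in> carrier (sec G U); t' \<in> carrier (sec G U)\<rbrakk> \<Longrightarrow>
      \<beta> U s (t \<oplus>\<^bsub>sec G U\<^esub> t') = \<beta> U s t \<oplus>\<^bsub>sec H U\<^esub> \<beta> U s t'"
    and \<beta>_zero_left: "\<lbrakk>openin X U; t \<in> carrier (sec G U)\<rbrakk> \<Longrightarrow> \<beta> U \<zero>\<^bsub>sec F U\<^esub> t = \<zero>\<^bsub>sec H U\<^esub>"
    and \<beta>_zero_right: "\<lbrakk>openin X U; s \<in> carrier (sec F U)\<rbrakk> \<Longrightarrow> \<beta> U s \<zero>\<^bsub>sec G U\<^esub> = \<zero>\<^bsub>sec H U\<^esub>"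
    and \<beta>_smult_left: "\<lbrakk>openin X U; a \<in> carrier (sec OX U); s \<in> carrier (sec F U); t \<in> carrier (sec G U)\<rbrakk> \<Longrightarrow>
      \<beta> U (a \<odot>\<^bsub>sec F U\<^esub> s) t = a \<odot>\<^bsub>sec H U\<^esub> \<beta> U s t"
    and \<beta>_smult_right: "\<lbrakk>openin X U; a \<in> carrier (sec OX U); s \<in> carrier (sec F U); t \<in> carrier (sec G U)\<rbrakk> \<Longrightarrow>
      \<beta> U s (a \<odot>\<^bsub>sec G U\<^esub> t) = a \<odot>\<^bsub>sec H U\<^esub> \<beta> U s t"
    and \<beta>_res: "\<lbrakk>openin X U; openin X V; V \<subseteq> U; s \<in> carrier (sec F U); t \<in> carrier (sec G U)\<rbrakk> \<Longrightarrow>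
      \<beta> V (res F U V s) (res G U V t) = restrict (\<beta> U s t) V"
    and generator: "p \<in> topspace X \<Longrightarrow> \<exists>U. openin X U \<and> p \<in> U \<and>
      (\<forall>V. openin X V \<longrightarrow> V \<subseteq> U \<longrightarrow> (\<exists>y\<in>carrier (sec G V).
        (\<forall>t\<in>carrier (sec G V). \<exists>a\<in>carrier (sec OX V). t = a \<odot>\<^bsub>sec G V\<^esub> y) \<and>
        bij_betw (\<lambda>s. \<beta> V s y) (carrier (sec F V)) (carrier (sec H V))))"
begin

abbreviation rel :: "'p set \<Rightarrow> ('s \<times> 't) multiset \<Rightarrow> ('s \<times> 't) multiset \<Rightarrow> bool" where
  "rel V \<equiv> tensor_rel (sec OX V) (sec F V) (sec G V)"

definition pairs :: "'p set \<Rightarrow> ('s \<times> 't) multiset \<Rightarrow> bool" where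
  "pairs V u \<longleftrightarrow> set_mset u \<subseteq> carrier (sec F V) \<times> carrier (sec G V)"

text \<open>The membership tests only serve to make the folded function commute on the whole type.\<close>

definition mu_step :: "'p set \<Rightarrow> 's \<times> 't \<Rightarrow> ('p \<Rightarrow> 'v) \<Rightarrow> 'p \<Rightarrow> 'v" where
  "mu_step V = (\<lambda>(s, t) x. if x \<in> carrier (sec H V) \<and> s \<in> carrier (sec F V) \<and> t \<in> carrier (sec G V)
     then \<beta> V s t \<oplus>\<^bsub>sec H V\<^esub> x else x)"

definition mu :: "'p set \<Rightarrow> ('s \<times> 't) multiset \<Rightarrow> 'p \<Rightarrow> 'v" where
  "mu V u = fold_mset (mu_step V) \<zero>\<^bsub>sec H V\<^esub> u"

lemma pairs_simps [simp]:
  "pairs V {#}" "pairs V (add_mset (s, t) u) \<longleftrightarrow> s \<in> carrier (sec F V) \<and> t \<in> carrier (sec G V) \<and> pairs V u"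
  "pairs V (u + v) \<longleftrightarrow> pairs V u \<and> pairs V v"
  by (auto simp: pairs_def)

context
  fixes V assumes V: "openin X V"
begin

interpretation H: abelian_monoid "sec H V" by (rule H_monoid[OF V])

lemma mu_empty [simp]: "mu V {#} = \<zero>\<^bsub>sec H V\<^esub>"
  by (simp add: mu_def)

lemma mu_step_commute: "comp_fun_commute (mu_step V)"
  by unfold_locales (auto simp: mu_step_def fun_eq_iff \<beta>_closed V H.a_ac split: prod.splits)

lemma mu_add_mset_step: "mu V (add_mset x u) = mu_step V x (mu V u)"
  unfolding mu_def using mu_step_commute by (rule comp_fun_commute.fold_mset_add_mset)

lemma mu_closed: "mu V u \<in> carrier (sec H V)"
  by (induction u) (auto simp: mu_add_mset_step mu_step_def \<beta>_closed V)

lemma mu_add_mset: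
  "s \<in> carrier (sec F V) \<Longrightarrow> t \<in> carrier (sec G V) \<Longrightarrow> mu V (add_mset (s, t) u) = \<beta> V s t \<oplus>\<^bsub>sec H V\<^esub> mu V u"
  by (simp add: mu_add_mset_step mu_step_def mu_closed)

lemma mu_single: "s \<in> carrier (sec F V) \<Longrightarrow> t \<in> carrier (sec G V) \<Longrightarrow> mu V {#(s, t)#} = \<beta> V s t"
  by (simp add: mu_add_mset \<beta>_closed V)

lemma mu_plus: "pairs V u \<Longrightarrow> mu V (u + v) = mu V u \<oplus>\<^bsub>sec H V\<^esub> mu V v"
proof (induction u)
  case (add x u)
  then show ?case by (cases x) (simp add: mu_add_mset \<beta>_closed V mu_closed H.a_assoc)
qed (simp add: mu_closed)

text \<open>Each generating relation of the tensor product is one of the bilinearity laws of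
  \<open>\<beta>\<close>, so \<open>mu\<close> is well defined on tensors.\<close>

lemma rel_mu: "rel V u v \<Longrightarrow> pairs V u \<and> pairs V v \<and> mu V u = mu V v"
proof (induction rule: tensor_rel.induct)
  case (plus u v u' v')
  then show ?case by (simp add: mu_plus)
next
  case (add_left s s' t)
  then show ?case by (simp add: mu_add_mset F_add V \<beta>_add_left \<beta>_closed H.a_assoc)
next
  case (add_right s t t')
  then show ?case by (simp add: mu_add_mset G_add V \<beta>_add_right \<beta>_closed H.a_assoc)
next
  case (scalar a s t)
  then show ?case by (simp add: mu_single F_smult G_smult V \<beta>_smult_left \<beta>_smult_right)
qed (auto simp: pairs_def mu_single F_zero G_zero \<beta>_zero_left \<beta>_zero_right V)

lemma mu_smult:
  assumes a: "a \<in> carrier (sec OX V)" and u: "pairs V u"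
  shows "pairs V (image_mset (\<lambda>(x, y). (a \<odot>\<^bsub>sec F V\<^esub> x, y)) u) \<and>
    mu V (image_mset (\<lambda>(x, y). (a \<odot>\<^bsub>sec F V\<^esub> x, y)) u) = a \<odot>\<^bsub>sec H V\<^esub> mu V u"
  using u
proof (induction u)
  case (add x u)
  then show ?case
    by (cases x) (simp add: mu_add_mset F_smult V a \<beta>_smult_left H_smult_add \<beta>_closed mu_closed)
qed (simp add: H_smult_zero V a)

text \<open>Writing t as a y moves the scalar to the left factor, and tensors with the same right
  factor y add up to a single one. The empty sum is 0 \<otimes> y.\<close>

lemma normal_form:
  assumes y: "y \<in> carrier (sec G V)" "\<And>t. t \<in> carrier (sec G V) \<Longrightarrow> \<exists>a\<in>carrier (sec OX V). t = a \<odot>\<^bsub>sec G V\<^esub> y"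
    and u: "pairs V u"
  shows "\<exists>s\<in>carrier (sec F V). rel V u {#(s, y)#}"
  using u
proof (induction u)
  case empty
  show ?case using tensor_rel.sym[OF tensor_rel.zero_left[OF y(1)]] F_zero[OF V] by auto
next
  case (add x u)
  obtain s t where x: "x = (s, t)" by fastforce
  have st: "s \<in> carrier (sec F V)" "t \<in> carrier (sec G V)" "pairs V u" using add.prems by (auto simp: x)
  obtain s' where s': "s' \<in> carrier (sec F V)" "rel V u {#(s', y)#}" using add.IH st by blast
  obtain a where a: "a \<in> carrier (sec OX V)" "t = a \<odot>\<^bsub>sec G V\<^esub> y" using y(2)[OF st(2)] by blast
  have as: "a \<odot>\<^bsub>sec F V\<^esub> s \<in> carrier (sec F V)" using F_smult V a st by simp
  have "rel V {#(s, t)#} {#(a \<odot>\<^bsub>sec F V\<^esub> s, y)#}"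
    unfolding a(2) by (rule tensor_rel.sym[OF tensor_rel.scalar[OF a(1) st(1) y(1)]])
  then have "rel V ({#(s, t)#} + u) ({#(a \<odot>\<^bsub>sec F V\<^esub> s, y)#} + {#(s', y)#})"
    using s'(2) by (rule tensor_rel.plus)
  moreover have "rel V ({#(a \<odot>\<^bsub>sec F V\<^esub> s, y)#} + {#(s', y)#}) {#(a \<odot>\<^bsub>sec F V\<^esub> s \<oplus>\<^bsub>sec F V\<^esub> s', y)#}"
    using tensor_rel.sym[OF tensor_rel.add_left[OF as s'(1) y(1)]] by (simp add: add_mset_commute)
  ultimately show ?case
    using F_add[OF V as s'(1)] by (auto simp: x intro: tensor_rel.trans)
qed

end

lemma mu_res:
  assumes V: "openin X V" and W: "openin X W" "W \<subseteq> V" and u: "pairs V u"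
  shows "pairs W (image_mset (map_prod (res F V W) (res G V W)) u) \<and>
    mu W (image_mset (map_prod (res F V W) (res G V W)) u) = restrict (mu V u) W"
  using u
proof (induction u)
  case empty
  then show ?case
    using H_restrict_zero[OF V W] by (simp add: mu_def)
next
  case (add x u)
  obtain s t where x: "x = (s, t)" by fastforce
  have st: "s \<in> carrier (sec F V)" "t \<in> carrier (sec G V)" "pairs V u" using add.prems by (auto simp: x)
  have r: "res F V W s \<in> carrier (sec F W)" "res G V W t \<in> carrier (sec G W)"
    using F_res G_res V W st by auto
  note ih = add.IH[OF st(3)]
  have "mu W (image_mset (map_prod (res F V W) (res G V W)) (add_mset x u)) =
      \<beta> W (res F V W s) (res G V W t) \<oplus>\<^bsub>sec H W\<^esub> mu W (image_mset (map_prod (res F V W) (res G V W)) u)"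
    by (simp add: x mu_add_mset W(1) r)
  also have "\<dots> = restrict (\<beta> V s t) W \<oplus>\<^bsub>sec H W\<^esub> restrict (mu V u) W"
    by (simp only: conjunct2[OF ih] \<beta>_res[OF V W st(1,2)])
  also have "\<dots> = restrict (\<beta> V s t \<oplus>\<^bsub>sec H V\<^esub> mu V u) W"
    by (rule H_restrict_add[OF V W \<beta>_closed[OF V st(1,2)] mu_closed[OF V], symmetric])
  also have "\<dots> = restrict (mu V (add_mset x u)) W" by (simp only: x mu_add_mset[OF V st(1,2)])
  finally show ?case using ih r by (simp add: x)
qed

section \<open>Tensors over open sets on which the second factor is free\<close>

definition free_on :: "'p set \<Rightarrow> bool" where
  "free_on V \<longleftrightarrow> openin X V \<and> (\<exists>y\<in>carrier (sec G V).
    (\<forall>t\<in>carrier (sec G V). \<exists>a\<in>carrier (sec OX V). t = a \<odot>\<^bsub>sec G V\<^esub> y) \<and>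
    bij_betw (\<lambda>s. \<beta> V s y) (carrier (sec F V)) (carrier (sec H V)))"

text \<open>The locale demands a generator on every open subset of a neighbourhood, so the open sets
  with a generator form a base.\<close>

lemma free_nbhd:
  assumes "openin X V" "p \<in> V"
  obtains W where "free_on W" "p \<in> W" "W \<subseteq> V"
proof -
  have "p \<in> topspace X" using assms openin_subset by blast
  then have "\<exists>U. openin X U \<and> p \<in> U \<and> (\<forall>W. openin X W \<longrightarrow> W \<subseteq> U \<longrightarrow> free_on W)"
    using generator[of p] by (simp add: free_on_def)
  then obtain U where U: "openin X U" "p \<in> U" "\<forall>W. openin X W \<longrightarrow> W \<subseteq> U \<longrightarrow> free_on W"
    by blast
  show ?thesis
    by (rule that[of "U \<inter> V"]) (use U assms in auto)
qed

text \<open>Over such a set \<open>mu\<close> is injective on tensors: both sides reduce to the form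
  s \<otimes> y, and s is determined by its product with y.\<close>

lemma free_on_rel:
  assumes "free_on V" "pairs V u" "pairs V v" "mu V u = mu V v"
  shows "rel V u v"
proof -
  obtain y where V: "openin X V" and y: "y \<in> carrier (sec G V)"
    "\<forall>t\<in>carrier (sec G V). \<exists>a\<in>carrier (sec OX V). t = a \<odot>\<^bsub>sec G V\<^esub> y"
    "bij_betw (\<lambda>s. \<beta> V s y) (carrier (sec F V)) (carrier (sec H V))"
    using assms(1) unfolding free_on_def by blast
  obtain s where s: "s \<in> carrier (sec F V)" "rel V u {#(s, y)#}"
    using normal_form[OF V y(1) _ assms(2)] y(2) by blast
  obtain s' where s': "s' \<in> carrier (sec F V)" "rel V v {#(s', y)#}"
    using normal_form[OF V y(1) _ assms(3)] y(2) by blast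
  have "\<beta> V s y = \<beta> V s' y"
    using rel_mu[OF V s(2)] rel_mu[OF V s'(2)] assms(4) mu_single[OF V _ y(1)] s(1) s'(1) by simp
  then have "s = s'" using y(3) s(1) s'(1) by (auto simp: bij_betw_def dest: inj_onD)
  then show ?thesis using s(2) s'(2) by (blast intro: tensor_rel.trans tensor_rel.sym)
qed

text \<open>\<open>A\<close> need not be an equivalence class. Sums, scalar multiples and
  restrictions in the tensor presheaf are formed as sets of related multisets, and this weaker
  notion passes through them directly. Nonemptiness makes \<open>h\<close> unique.\<close>

definition represents :: "'p set \<Rightarrow> ('s \<times> 't) multiset set \<Rightarrow> ('p \<Rightarrow> 'v) \<Rightarrow> bool" where
  "represents V A h \<longleftrightarrow> A \<noteq> {} \<and> (\<forall>u\<in>A. pairs V u \<and> mu V u = h)"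

abbreviation T where "T \<equiv> tensor_presheaf OX F G"

lemma represents_closed: "openin X V \<Longrightarrow> represents V A h \<Longrightarrow> h \<in> carrier (sec H V)"
  using mu_closed by (fastforce simp: represents_def)

lemma rel_refl: "pairs V u \<Longrightarrow> rel V u u"
  by (simp add: pairs_def tensor_rel.refl)

lemma represents_image:
  assumes V: "openin X V" and ne: "B \<noteq> {}" and B: "\<And>u. u \<in> B \<Longrightarrow> pairs V u \<and> mu V u = h"
  shows "represents V {w. \<exists>u\<in>B. rel V u w} h"
  unfolding represents_def
proof
  obtain u where "u \<in> B" using ne by blast
  then show "{w. \<exists>u\<in>B. rel V u w} \<noteq> {}" using rel_refl B by blast
  show "\<forall>w\<in>{w. \<exists>u\<in>B. rel V u w}. pairs V w \<and> mu V w = h"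
  proof clarify
    fix u w assume "u \<in> B" "rel V u w"
    then show "pairs V w \<and> mu V w = h" using B[of u] rel_mu[OF V, of u w] by simp
  qed
qed

lemma represents_class: "openin X V \<Longrightarrow> pairs V u \<Longrightarrow> represents V {v. rel V u v} (mu V u)"
  using represents_image[of V "{u}" "mu V u"] by simp

lemma represents_carrier:
  assumes "openin X V" "A \<in> carrier (sec T V)" shows "\<exists>h. represents V A h"
proof -
  obtain u where "pairs V u" "A = {v. rel V u v}"
    using assms(2) by (auto simp: tensor_presheaf_def tensor_module_def pairs_def)
  then show ?thesis using represents_class[OF assms(1)] by blast
qed

lemma represents_zero: "openin X V \<Longrightarrow> represents V \<zero>\<^bsub>sec T V\<^esub> \<zero>\<^bsub>sec H V\<^esub>"
  using represents_class[of V "{#}"] by (simp add: tensor_presheaf_def tensor_module_def)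

lemma represents_add:
  assumes V: "openin X V" and A: "represents V A h" "represents V A' h'"
  shows "represents V (A \<oplus>\<^bsub>sec T V\<^esub> A') (h \<oplus>\<^bsub>sec H V\<^esub> h')"
proof -
  have "A \<oplus>\<^bsub>sec T V\<^esub> A' = {w. \<exists>u\<in>{u + u' | u u'. u \<in> A \<and> u' \<in> A'}. rel V u w}"
    by (auto simp: tensor_presheaf_def tensor_module_def)
  moreover have "represents V \<dots> (h \<oplus>\<^bsub>sec H V\<^esub> h')"
    using A by (intro represents_image[OF V]) (auto simp: represents_def mu_plus V)
  ultimately show ?thesis by simp
qed

lemma represents_smult:
  assumes V: "openin X V" and A: "represents V A h" and a: "a \<in> carrier (sec OX V)"
  shows "represents V (a \<odot>\<^bsub>sec T V\<^esub> A) (a \<odot>\<^bsub>sec H V\<^esub> h)"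
proof -
  have "a \<odot>\<^bsub>sec T V\<^esub> A = {w. \<exists>u\<in>image_mset (\<lambda>(x, y). (a \<odot>\<^bsub>sec F V\<^esub> x, y)) ` A. rel V u w}"
    by (auto simp: tensor_presheaf_def tensor_module_def)
  moreover have "represents V \<dots> (a \<odot>\<^bsub>sec H V\<^esub> h)"
    using A mu_smult[OF V a] by (intro represents_image[OF V]) (auto simp: represents_def)
  ultimately show ?thesis by simp
qed

lemma res_T: "res T V W A = {w. \<exists>u\<in>image_mset (map_prod (res F V W) (res G V W)) ` A. rel W u w}"
  by (auto simp: tensor_presheaf_def)

lemma represents_res:
  assumes V: "openin X V" "openin X W" "W \<subseteq> V" and A: "represents V A h"
  shows "represents W (res T V W A) (restrict h W)"
  unfolding res_T using A mu_res[OF V]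
  by (intro represents_image[OF V(2)]) (auto simp: represents_def)

text \<open>Restricted to a free set, a tensor becomes the full fibre of \<open>mu\<close> over its
  function, because any two multisets with the same value are related there. It then depends on the
  function alone.\<close>

lemma res_T_free:
  assumes W: "free_on W" and V: "openin X V" "W \<subseteq> V" and A: "represents V A h"
  shows "res T V W A = {w. pairs W w \<and> mu W w = restrict h W}"
proof -
  have Wo: "openin X W" using W by (simp add: free_on_def)
  obtain u where u: "u \<in> A" "pairs V u" "mu V u = h" using A by (auto simp: represents_def)
  have "pairs W (image_mset (map_prod (res F V W) (res G V W)) u)"
    "mu W (image_mset (map_prod (res F V W) (res G V W)) u) = restrict h W"
    using mu_res[OF V(1) Wo V(2) u(2)] u(3) by auto
  then have "w \<in> res T V W A" if "pairs W w" "mu W w = restrict h W" for w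
    using free_on_rel[OF W _ that(1)] that(2) u(1) unfolding res_T by auto
  moreover have "pairs W w \<and> mu W w = restrict h W" if "w \<in> res T V W A" for w
    using represents_res[OF V(1) Wo V(2) A] that by (simp add: represents_def)
  ultimately show ?thesis by blast
qed

lemma germ_subset:
  assumes V: "openin X V" "represents V A h" and V': "openin X V'" "represents V' A' h'"
    and W: "openin X W" "p \<in> W" "W \<subseteq> V" "W \<subseteq> V'" "restrict h W = restrict h' W"
  shows "germ X T p V A \<subseteq> germ X T p V' A'"
proof clarify
  fix V2 A2 assume "(V2, A2) \<in> germ X T p V A"
  then obtain W2 where V2: "openin X V2" "p \<in> V2" "A2 \<in> carrier (sec T V2)"
    and W2: "openin X W2" "p \<in> W2" "W2 \<subseteq> V \<inter> V2" "res T V W2 A = res T V2 W2 A2"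
    by (auto simp: germ_def)
  obtain h2 where h2: "represents V2 A2 h2" using represents_carrier[OF V2(1,3)] by blast
  have "restrict h W2 = restrict h2 W2"
    using represents_res[OF V(1) W2(1) _ V(2)] represents_res[OF V2(1) W2(1) _ h2] W2(3,4)
    by (auto simp: represents_def)
  \<comment> \<open>On a free set inside both neighbourhoods the restrictions are determined by
    \<open>h'\<close> and \<open>h2\<close>, which both agree there with \<open>h\<close>.\<close>
  obtain Z where Z: "free_on Z" "p \<in> Z" "Z \<subseteq> W \<inter> W2" using free_nbhd[of "W \<inter> W2" p] W W2 by auto
  have "restrict h' Z = restrict (restrict h' W) Z" using Z by (auto simp: Int_absorb1)
  also have "\<dots> = restrict (restrict h W) Z" by (simp only: W(5))
  also have "\<dots> = restrict (restrict h W2) Z" using Z by (auto simp: Int_absorb1)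
  also have "\<dots> = restrict (restrict h2 W2) Z" by (simp only: \<open>restrict h W2 = restrict h2 W2\<close>)
  also have "\<dots> = restrict h2 Z" using Z by (auto simp: Int_absorb1)
  finally have "res T V' Z A' = res T V2 Z A2"
    using res_T_free[OF Z(1) V'(1) _ V'(2)] res_T_free[OF Z(1) V2(1) _ h2] Z(3) W(4) W2(3) by auto
  moreover have "openin X Z" using Z(1) by (simp add: free_on_def)
  ultimately show "(V2, A2) \<in> germ X T p V' A'"
    using V2 Z W(4) W2(3) by (auto simp: germ_def intro!: exI[of _ Z])
qed

lemma germ_eq:
  assumes V: "openin X V" "represents V A h" and V': "openin X V'" "represents V' A' h'"
    and W: "openin X W" "p \<in> W" "W \<subseteq> V" "W \<subseteq> V'" "restrict h W = restrict h' W"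
  shows "germ X T p V A = germ X T p V' A'"
  using germ_subset[OF V V' W] germ_subset[OF V' V W(1,2,4,3) W(5)[symmetric]] by blast

lemma free_representative:
  assumes "free_on V" "h \<in> carrier (sec H V)"
  obtains A where "A \<in> carrier (sec T V)" "represents V A h"
proof -
  obtain y where V: "openin X V" and y: "y \<in> carrier (sec G V)"
    "bij_betw (\<lambda>s. \<beta> V s y) (carrier (sec F V)) (carrier (sec H V))"
    using assms(1) unfolding free_on_def by blast
  have "h \<in> (\<lambda>s. \<beta> V s y) ` carrier (sec F V)" using y(2) assms(2) by (simp add: bij_betw_def)
  then obtain s where s: "s \<in> carrier (sec F V)" "\<beta> V s y = h" by blast
  show ?thesis
  proof
    show "{v. rel V {#(s, y)#} v} \<in> carrier (sec T V)"
      using s(1) y(1) by (auto simp: tensor_presheaf_def tensor_module_def intro!: exI[of _ "{#(s, y)#}"])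
    show "represents V {v. rel V {#(s, y)#} v} h"
      using represents_class[OF V, of "{#(s, y)#}"] s y(1) by (simp add: mu_single V)
  qed
qed

lemma germ_self:
  "openin X V \<Longrightarrow> p \<in> V \<Longrightarrow> A \<in> carrier (sec T V) \<Longrightarrow> (V, A) \<in> germ X T p V A"
  by (auto simp: germ_def)

text \<open>\<open>A\<close> itself may fail to be a section of the tensor presheaf, so (V, A)
  cannot serve as the member. A section representing the same function over a smaller free set
  can.\<close>

lemma germ_nonempty:
  assumes V: "openin X V" "p \<in> V" and A: "represents V A h"
  obtains V' A' where "(V', A') \<in> germ X T p V A"
proof -
  obtain W where W: "free_on W" "p \<in> W" "W \<subseteq> V" by (rule free_nbhd[OF V])
  have Wo: "openin X W" using W by (simp add: free_on_def)
  obtain A' where A': "A' \<in> carrier (sec T W)" "represents W A' (restrict h W)"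
    using free_representative[OF W(1) H_restrict[OF V(1) Wo W(3) represents_closed[OF V(1) A]]] .
  have "germ X T p V A = germ X T p W A'"
    using germ_eq[OF V(1) A Wo A'(2) Wo W(2,3)] by simp
  then show ?thesis using germ_self[OF Wo W(2) A'(1)] that by simp
qed

lemma germ_memD:
  assumes V: "openin X V" and A: "represents V A h" and m: "(V', A') \<in> germ X T p V A"
  obtains W h' where "openin X V'" "p \<in> V'" "represents V' A' h'" "openin X W" "p \<in> W" "W \<subseteq> V \<inter> V'"
    "restrict h W = restrict h' W"
proof -
  obtain W where V': "openin X V'" "p \<in> V'" "A' \<in> carrier (sec T V')"
    and W: "openin X W" "p \<in> W" "W \<subseteq> V \<inter> V'" "res T V W A = res T V' W A'"
    using m by (auto simp: germ_def)
  obtain h' where h': "represents V' A' h'" using represents_carrier[OF V'(1,3)] by blast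
  have "restrict h W = restrict h' W"
    using represents_res[OF V(1) W(1) _ A] represents_res[OF V'(1) W(1) _ h'] W(3,4)
    by (auto simp: represents_def)
  then show ?thesis using that V' h' W by blast
qed

definition germ_value :: "'p \<Rightarrow> ('p set \<times> ('s \<times> 't) multiset set) set \<Rightarrow> 'v" where
  "germ_value p B = (SOME x. \<exists>V A h. (V, A) \<in> B \<and> represents V A h \<and> x = h p)"

text \<open>All members of a germ represent functions that agree near the point, so the arbitrary
  choice in \<open>germ_value\<close> has only one possible outcome.\<close>

lemma germ_value_germ:
  assumes V: "openin X V" "p \<in> V" and A: "represents V A h"
  shows "germ_value p (germ X T p V A) = h p"
  unfolding germ_value_def
proof (rule some_equality)
  have *: "\<exists>V' A' h'. (V', A') \<in> germ X T p V A \<and> represents V' A' h'"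
    using germ_nonempty[OF V A] germ_memD[OF V(1) A] by metis
  have **: "h' p = h p" if m: "(V', A') \<in> germ X T p V A" "represents V' A' h'" for V' A' h'
  proof -
    obtain W h2 where W: "represents V' A' h2" "p \<in> W" "restrict h W = restrict h2 W"
      by (rule germ_memD[OF V(1) A m(1)])
    have "h2 = h'" using W(1) m(2) by (auto simp: represents_def)
    then show ?thesis using W(2,3) by (metis restrict_apply')
  qed
  show "\<exists>V' A' h'. (V', A') \<in> germ X T p V A \<and> represents V' A' h' \<and> h p = h' p"
    using * ** by metis
  show "x = h p" if "\<exists>V' A' h'. (V', A') \<in> germ X T p V A \<and> represents V' A' h' \<and> x = h' p" for x
    using that ** by blast
qed

text \<open>Any two representatives yield a sum that represents the same function near the point,
  and germs depend only on that function. Hence the union over all representatives is a single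
  germ.\<close>

lemma germ_add_germ:
  assumes V: "openin X V" "p \<in> V" and A: "represents V A h" and V': "openin X V'" "p \<in> V'" and A': "represents V' A' h'"
  shows "germ_add X T p (germ X T p V A) (germ X T p V' A') =
    germ X T p (V \<inter> V') (res T V (V \<inter> V') A \<oplus>\<^bsub>sec T (V \<inter> V')\<^esub> res T V' (V \<inter> V') A')" (is "_ = ?R")
proof -
  have rep: "represents (V1 \<inter> V2) (res T V1 (V1 \<inter> V2) A1 \<oplus>\<^bsub>sec T (V1 \<inter> V2)\<^esub> res T V2 (V1 \<inter> V2) A2)
      (restrict h1 (V1 \<inter> V2) \<oplus>\<^bsub>sec H (V1 \<inter> V2)\<^esub> restrict h2 (V1 \<inter> V2))"
    if "openin X V1" "openin X V2" "represents V1 A1 h1" "represents V2 A2 h2" for V1 V2 A1 A2 h1 h2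
    using that by (intro represents_add represents_res) auto
  have "germ X T p (V1 \<inter> V2) (res T V1 (V1 \<inter> V2) A1 \<oplus>\<^bsub>sec T (V1 \<inter> V2)\<^esub> res T V2 (V1 \<inter> V2) A2) = ?R"
    if 1: "(V1, A1) \<in> germ X T p V A" and 2: "(V2, A2) \<in> germ X T p V' A'" for V1 A1 V2 A2
  proof -
    obtain W1 h1 where h1: "openin X V1" "p \<in> V1" "represents V1 A1 h1" "openin X W1" "p \<in> W1" "W1 \<subseteq> V \<inter> V1"
      "restrict h W1 = restrict h1 W1" by (rule germ_memD[OF V(1) A 1])
    obtain W2 h2 where h2: "openin X V2" "p \<in> V2" "represents V2 A2 h2" "openin X W2" "p \<in> W2" "W2 \<subseteq> V' \<inter> V2"
      "restrict h' W2 = restrict h2 W2" by (rule germ_memD[OF V'(1) A' 2])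
    let ?W = "W1 \<inter> W2"
    have o: "openin X ?W" "?W \<subseteq> V1 \<inter> V2" "?W \<subseteq> V \<inter> V'" using h1 h2 by auto
    have e: "restrict h ?W = restrict h1 ?W" "restrict h' ?W = restrict h2 ?W"
      using h1(7) h2(7) by (metis restrict_restrict Int_commute)+
    have io: "openin X (V \<inter> V')" "openin X (V1 \<inter> V2)" using V V' h1(1) h2(1) by auto
    have cl: "restrict g (Z1 \<inter> Z2) \<in> carrier (sec H (Z1 \<inter> Z2))"
      if "openin X Z1" "openin X Z2" "represents Z1 B g \<or> represents Z2 B g" for Z1 Z2 B g
      using that H_restrict represents_closed by (metis Int_lower1 Int_lower2 openin_Int)
    have "restrict (restrict h1 (V1 \<inter> V2) \<oplus>\<^bsub>sec H (V1 \<inter> V2)\<^esub> restrict h2 (V1 \<inter> V2)) ?W =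
        restrict h1 ?W \<oplus>\<^bsub>sec H ?W\<^esub> restrict h2 ?W"
      using H_restrict_add[OF io(2) o(1,2) cl[OF h1(1) h2(1) disjI1[OF h1(3)]]
        cl[OF h1(1) h2(1) disjI2[OF h2(3)]]] o(2)
      by (simp add: Int_absorb1)
    moreover have "restrict (restrict h (V \<inter> V') \<oplus>\<^bsub>sec H (V \<inter> V')\<^esub> restrict h' (V \<inter> V')) ?W =
        restrict h ?W \<oplus>\<^bsub>sec H ?W\<^esub> restrict h' ?W"
      using H_restrict_add[OF io(1) o(1,3) cl[OF V(1) V'(1) disjI1[OF A]]
        cl[OF V(1) V'(1) disjI2[OF A']]] o(3)
      by (simp add: Int_absorb1)
    ultimately show ?thesis
      using germ_eq[OF io(2) rep[OF h1(1) h2(1) h1(3) h2(3)] io(1) rep[OF V(1) V'(1) A A'] o(1) _ o(2,3)]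
        h1(5) h2(5) e by simp
  qed
  moreover obtain V1 A1 where "(V1, A1) \<in> germ X T p V A" by (rule germ_nonempty[OF V A])
  moreover obtain V2 A2 where "(V2, A2) \<in> germ X T p V' A'" by (rule germ_nonempty[OF V' A'])
  ultimately show ?thesis
    unfolding germ_add_def by (rule_tac UN_UN_const) auto
qed

lemma germ_smult_germ:
  assumes U: "openin X U" and V: "openin X V" "p \<in> V" "V \<subseteq> U" and A: "represents V A h" and a: "a \<in> carrier (sec OX U)"
  shows "germ_smult X OX T p U a (germ X T p V A) = germ X T p V (res OX U V a \<odot>\<^bsub>sec T V\<^esub> A)"
proof -
  have aV: "res OX U V' a \<in> carrier (sec OX V')" if "openin X V'" "V' \<subseteq> U" for V'
    using OX_res[OF U that a] .
  have "germ X T p (U \<inter> V1) (res OX U (U \<inter> V1) a \<odot>\<^bsub>sec T (U \<inter> V1)\<^esub> res T V1 (U \<inter> V1) A1) =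
      germ X T p V (res OX U V a \<odot>\<^bsub>sec T V\<^esub> A)"
    if 1: "(V1, A1) \<in> germ X T p V A" for V1 A1
  proof -
    obtain W h1 where h1: "openin X V1" "p \<in> V1" "represents V1 A1 h1" "openin X W" "p \<in> W" "W \<subseteq> V \<inter> V1"
      "restrict h W = restrict h1 W" by (rule germ_memD[OF V(1) A 1])
    have o: "openin X (U \<inter> V1)" "U \<inter> V1 \<subseteq> U" "U \<inter> V1 \<subseteq> V1" "W \<subseteq> U \<inter> V1" "W \<subseteq> U" "W \<subseteq> V"
      using U h1 V(3) by auto
    have r1: "represents (U \<inter> V1) (res T V1 (U \<inter> V1) A1) (restrict h1 (U \<inter> V1))"
      by (rule represents_res[OF h1(1) o(1,3) h1(3)])
    note r = represents_smult[OF o(1) r1 aV[OF o(1,2)]] represents_smult[OF V(1) A aV[OF V(1,3)]]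
    have c: "h1 \<in> carrier (sec H V1)" "h \<in> carrier (sec H V)" using represents_closed h1 V A by auto
    have "restrict (res OX U (U \<inter> V1) a \<odot>\<^bsub>sec H (U \<inter> V1)\<^esub> restrict h1 (U \<inter> V1)) W =
        res OX (U \<inter> V1) W (res OX U (U \<inter> V1) a) \<odot>\<^bsub>sec H W\<^esub> restrict h1 W"
      using H_restrict_smult[OF o(1) h1(4) o(4) aV[OF o(1,2)] H_restrict[OF h1(1) o(1,3) c(1)]] o(4)
      by (simp add: Int_absorb1)
    moreover have "restrict (res OX U V a \<odot>\<^bsub>sec H V\<^esub> h) W = res OX V W (res OX U V a) \<odot>\<^bsub>sec H W\<^esub> restrict h W"
      using H_restrict_smult[OF V(1) h1(4) o(6) aV[OF V(1,3)] c(2)] .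
    ultimately show ?thesis
      using germ_eq[OF o(1) r(1) V(1) r(2) h1(4,5) o(4,6)] h1(7) OX_res_res[OF U _ h1(4) o(4) o(2) a] o(1)
        OX_res_res[OF U V(1) h1(4) o(6) V(3) a] by simp
  qed
  moreover obtain V1 A1 where "(V1, A1) \<in> germ X T p V A" by (rule germ_nonempty[OF V(1,2) A])
  ultimately show ?thesis unfolding germ_smult_def by fast
qed

lemma sheafify_section:
  assumes \<sigma>: "\<sigma> \<in> carrier (sec (sheafify X OX T) U)" and p: "p \<in> U"
  obtains V A h where "openin X V" "p \<in> V" "V \<subseteq> U" "represents V A h"
    "\<And>q. q \<in> V \<Longrightarrow> \<sigma> q = germ X T q V A"
    "\<And>q. q \<in> V \<Longrightarrow> germ_value q (\<sigma> q) = h q"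
proof -
  obtain V A where V: "openin X V" "p \<in> V" "V \<subseteq> U" "A \<in> carrier (sec T V)"
    "\<forall>q\<in>V. \<sigma> q = germ X T q V A"
    using \<sigma> p by (auto simp: sheafify_def)
  obtain h where h: "represents V A h" using represents_carrier[OF V(1,4)] by blast
  show ?thesis
    using that[OF V(1-3) h] V(5) germ_value_germ[OF V(1) _ h] by simp
qed

definition section_value :: "'p set \<Rightarrow> ('p \<Rightarrow> ('p set \<times> ('s \<times> 't) multiset set) set) \<Rightarrow> 'p \<Rightarrow> 'v" where
  "section_value U \<sigma> = (\<lambda>p\<in>U. germ_value p (\<sigma> p))"

lemma section_value_local:
  assumes "V \<subseteq> U" "\<And>q. q \<in> V \<Longrightarrow> germ_value q (\<sigma> q) = h q"
  shows "restrict (section_value U \<sigma>) V = restrict h V"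
  using assms by (auto simp: section_value_def restrict_def fun_eq_iff)

lemma section_value_closed:
  assumes U: "openin X U" and \<sigma>: "\<sigma> \<in> carrier (sec (sheafify X OX T) U)"
  shows "section_value U \<sigma> \<in> carrier (sec H U)"
proof (rule H_local[OF U])
  fix p assume "p \<in> U"
  then obtain V A h where V: "openin X V" "p \<in> V" "V \<subseteq> U" "represents V A h"
    "\<And>q. q \<in> V \<Longrightarrow> \<sigma> q = germ X T q V A"
    "\<And>q. q \<in> V \<Longrightarrow> germ_value q (\<sigma> q) = h q"
    using sheafify_section[OF \<sigma>] by metis
  have "restrict (section_value U \<sigma>) V = restrict h V" using section_value_local[OF V(3)] V(6) by blast
  also have "\<dots> \<in> carrier (sec H V)" using H_restrict[OF V(1,1) subset_refl represents_closed[OF V(1,4)]] .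
  finally show "\<exists>V. openin X V \<and> p \<in> V \<and> V \<subseteq> U \<and> restrict (section_value U \<sigma>) V \<in> carrier (sec H V)"
    using V by blast
qed (simp add: section_value_def)

text \<open>Equal values at all points mean that the local functions agree on the intersection of
  their domains, and then the germs agree by \<open>germ_eq\<close>.\<close>

lemma section_value_inj:
  assumes U: "openin X U"
  shows "inj_on (section_value U) (carrier (sec (sheafify X OX T) U))"
proof (rule inj_onI)
  fix \<sigma> \<tau> assume \<sigma>: "\<sigma> \<in> carrier (sec (sheafify X OX T) U)" and \<tau>: "\<tau> \<in> carrier (sec (sheafify X OX T) U)"
    and eq: "section_value U \<sigma> = section_value U \<tau>"
  have ext: "\<sigma> \<in> extensional U" "\<tau> \<in> extensional U" using \<sigma> \<tau> by (auto simp: sheafify_def)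
  show "\<sigma> = \<tau>"
  proof (rule extensionalityI[OF ext])
    fix p assume p: "p \<in> U"
    obtain V A h where V: "openin X V" "p \<in> V" "V \<subseteq> U" "represents V A h"
      "\<And>q. q \<in> V \<Longrightarrow> \<sigma> q = germ X T q V A"
    "\<And>q. q \<in> V \<Longrightarrow> germ_value q (\<sigma> q) = h q"
      using sheafify_section[OF \<sigma> p] by metis
    obtain V' A' h' where V': "openin X V'" "p \<in> V'" "V' \<subseteq> U" "represents V' A' h'"
      "\<And>q. q \<in> V' \<Longrightarrow> \<tau> q = germ X T q V' A'"
      "\<And>q. q \<in> V' \<Longrightarrow> germ_value q (\<tau> q) = h' q"
      using sheafify_section[OF \<tau> p] by metis
    have "h q = h' q" if "q \<in> V \<inter> V'" for q
      using fun_cong[OF eq, of q] V(3) V(6)[of q] V'(6)[of q] that by (auto simp: section_value_def)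
    then have "restrict h (V \<inter> V') = restrict h' (V \<inter> V')" by (auto simp: restrict_def fun_eq_iff)
    then have "germ X T p V A = germ X T p V' A'"
      using germ_eq[OF V(1,4) V'(1,4), of "V \<inter> V'"] V(1,2) V'(1,2) by auto
    then show "\<sigma> p = \<tau> p" using V(2,5) V'(2,5) by simp
  qed
qed

text \<open>Around each point h is represented by a tensor over a free set. The germs of these
  independently chosen tensors fit together because a germ depends only on the function
  represented.\<close>

lemma section_value_surj:
  assumes U: "openin X U" and h: "h \<in> carrier (sec H U)"
  shows "h \<in> section_value U ` carrier (sec (sheafify X OX T) U)"
proof -
  have "\<exists>V A. openin X V \<and> p \<in> V \<and> V \<subseteq> U \<and> A \<in> carrier (sec T V) \<and> represents V A (restrict h V)"
    if p: "p \<in> U" for p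
  proof -
    obtain V where V: "free_on V" "p \<in> V" "V \<subseteq> U" by (rule free_nbhd[OF U p])
    have Vo: "openin X V" using V by (simp add: free_on_def)
    show ?thesis
      using free_representative[OF V(1) H_restrict[OF U Vo V(3) h]] V(2,3) Vo by metis
  qed
  then obtain V A where V: "\<And>p. p \<in> U \<Longrightarrow> openin X (V p) \<and> p \<in> V p \<and> V p \<subseteq> U \<and>
      A p \<in> carrier (sec T (V p)) \<and> represents (V p) (A p) (restrict h (V p))"
    by metis
  define \<sigma> where "\<sigma> = (\<lambda>p\<in>U. germ X T p (V p) (A p))"
  have \<sigma>: "\<sigma> q = germ X T q (V p) (A p)" if p: "p \<in> U" and q: "q \<in> V p" for p q
  proof -
    have qU: "q \<in> U" using V[OF p] q by blast
    have "germ X T q (V q) (A q) = germ X T q (V p) (A p)"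
      using V[OF p] V[OF qU] q
      by (intro germ_eq[of "V q" _ "restrict h (V q)" "V p" _ "restrict h (V p)" "V q \<inter> V p"])
        (auto simp: Int_commute)
    then show ?thesis using qU by (simp add: \<sigma>_def)
  qed
  have "\<exists>W t. openin X W \<and> p \<in> W \<and> W \<subseteq> U \<and> t \<in> carrier (sec T W) \<and> (\<forall>q\<in>W. \<sigma> q = germ X T q W t)"
    if "p \<in> U" for p using V[OF that] \<sigma>[OF that] by metis
  then have "\<sigma> \<in> carrier (sec (sheafify X OX T) U)"
    by (simp add: sheafify_def \<sigma>_def)
  moreover have "h = section_value U \<sigma>"
  proof (rule extensionalityI[OF H_ext[OF U h]])
    show "section_value U \<sigma> \<in> extensional U" by (simp add: section_value_def)
    fix p assume p: "p \<in> U"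
    have "germ_value p (germ X T p (V p) (A p)) = restrict h (V p) p"
      using V[OF p] by (intro germ_value_germ[of "V p" p "A p" "restrict h (V p)"]) auto
    then show "h p = section_value U \<sigma> p" using p V[OF p] by (simp add: section_value_def \<sigma>_def)
  qed
  ultimately show ?thesis by blast
qed

lemma sheafify_simps:
  "\<zero>\<^bsub>sec (sheafify X OX T) U\<^esub> = (\<lambda>x\<in>U. germ X T x U \<zero>\<^bsub>sec T U\<^esub>)"
  "\<sigma> \<oplus>\<^bsub>sec (sheafify X OX T) U\<^esub> \<tau> = (\<lambda>x\<in>U. germ_add X T x (\<sigma> x) (\<tau> x))"
  "a \<odot>\<^bsub>sec (sheafify X OX T) U\<^esub> \<sigma> = (\<lambda>x\<in>U. germ_smult X OX T x U a (\<sigma> x))"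
  "res (sheafify X OX T) U V \<sigma> = restrict \<sigma> V"
  by (simp_all add: sheafify_def)

lemma section_value_add:
  assumes U: "openin X U" and \<sigma>: "\<sigma> \<in> carrier (sec (sheafify X OX T) U)"
    and \<tau>: "\<tau> \<in> carrier (sec (sheafify X OX T) U)"
  shows "section_value U (\<sigma> \<oplus>\<^bsub>sec (sheafify X OX T) U\<^esub> \<tau>) =
    section_value U \<sigma> \<oplus>\<^bsub>sec H U\<^esub> section_value U \<tau>"
proof (rule extensionalityI[of _ U])
  note c = section_value_closed[OF U \<sigma>] section_value_closed[OF U \<tau>]
  interpret HU: abelian_monoid "sec H U" by (rule H_monoid[OF U])
  show "section_value U \<sigma> \<oplus>\<^bsub>sec H U\<^esub> section_value U \<tau> \<in> extensional U" using H_ext[OF U] c by simp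
  fix p assume p: "p \<in> U"
  obtain V A h where V: "openin X V" "p \<in> V" "V \<subseteq> U" "represents V A h"
    "\<And>q. q \<in> V \<Longrightarrow> \<sigma> q = germ X T q V A"
    "\<And>q. q \<in> V \<Longrightarrow> germ_value q (\<sigma> q) = h q"
    using sheafify_section[OF \<sigma> p] by metis
  obtain V' A' h' where V': "openin X V'" "p \<in> V'" "V' \<subseteq> U" "represents V' A' h'"
    "\<And>q. q \<in> V' \<Longrightarrow> \<tau> q = germ X T q V' A'"
      "\<And>q. q \<in> V' \<Longrightarrow> germ_value q (\<tau> q) = h' q"
    using sheafify_section[OF \<tau> p] by metis
  let ?W = "V \<inter> V'"
  have W: "openin X ?W" "p \<in> ?W" "?W \<subseteq> U" "?W \<subseteq> V" "?W \<subseteq> V'" using V V' by auto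
  have "represents ?W (res T V ?W A \<oplus>\<^bsub>sec T ?W\<^esub> res T V' ?W A') (restrict h ?W \<oplus>\<^bsub>sec H ?W\<^esub> restrict h' ?W)"
    using represents_add[OF W(1) represents_res[OF V(1) W(1,4) V(4)] represents_res[OF V'(1) W(1,5) V'(4)]] .
  then have "germ_value p (germ_add X T p (\<sigma> p) (\<tau> p)) = (restrict h ?W \<oplus>\<^bsub>sec H ?W\<^esub> restrict h' ?W) p"
    using germ_value_germ[OF W(1,2)] germ_add_germ[OF V(1,2,4) V'(1,2,4)] V(2,5) V'(2,5) by simp
  also have "restrict h ?W \<oplus>\<^bsub>sec H ?W\<^esub> restrict h' ?W =
      restrict (section_value U \<sigma>) ?W \<oplus>\<^bsub>sec H ?W\<^esub> restrict (section_value U \<tau>) ?W"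
    using section_value_local[OF W(3), of \<sigma> h] section_value_local[OF W(3), of \<tau> h'] V(6) V'(6) by simp
  also have "\<dots> = restrict (section_value U \<sigma> \<oplus>\<^bsub>sec H U\<^esub> section_value U \<tau>) ?W"
    by (rule H_restrict_add[OF U W(1,3) c, symmetric])
  finally show "section_value U (\<sigma> \<oplus>\<^bsub>sec (sheafify X OX T) U\<^esub> \<tau>) p =
      (section_value U \<sigma> \<oplus>\<^bsub>sec H U\<^esub> section_value U \<tau>) p"
    using p W(2) by (simp add: section_value_def[of U "restrict _ _"] sheafify_simps)
qed (simp add: section_value_def)

lemma section_value_smult:
  assumes U: "openin X U" and \<sigma>: "\<sigma> \<in> carrier (sec (sheafify X OX T) U)"
    and a: "a \<in> carrier (sec OX U)"
  shows "section_value U (a \<odot>\<^bsub>sec (sheafify X OX T) U\<^esub> \<sigma>) = a \<odot>\<^bsub>sec H U\<^esub> section_value U \<sigma>"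
proof (rule extensionalityI[of _ U])
  note c = section_value_closed[OF U \<sigma>]
  show "a \<odot>\<^bsub>sec H U\<^esub> section_value U \<sigma> \<in> extensional U" using H_ext[OF U H_smult_closed[OF U a c]] .
  fix p assume p: "p \<in> U"
  obtain V A h where V: "openin X V" "p \<in> V" "V \<subseteq> U" "represents V A h"
    "\<And>q. q \<in> V \<Longrightarrow> \<sigma> q = germ X T q V A"
    "\<And>q. q \<in> V \<Longrightarrow> germ_value q (\<sigma> q) = h q"
    using sheafify_section[OF \<sigma> p] by metis
  have "germ_value p (germ_smult X OX T p U a (\<sigma> p)) = (res OX U V a \<odot>\<^bsub>sec H V\<^esub> h) p"
    using germ_value_germ[OF V(1,2) represents_smult[OF V(1,4) OX_res[OF U V(1,3) a]]]
      germ_smult_germ[OF U V(1-4) a] V(2,5) by simp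
  also have "h = restrict h V"
    using H_ext[OF V(1) represents_closed[OF V(1,4)]] by (simp add: extensional_restrict)
  also have "restrict h V = restrict (section_value U \<sigma>) V"
    using section_value_local[OF V(3), of \<sigma> h] V(6) by simp
  also have "res OX U V a \<odot>\<^bsub>sec H V\<^esub> restrict (section_value U \<sigma>) V =
      restrict (a \<odot>\<^bsub>sec H U\<^esub> section_value U \<sigma>) V"
    by (rule H_restrict_smult[OF U V(1,3) a c, symmetric])
  finally show "section_value U (a \<odot>\<^bsub>sec (sheafify X OX T) U\<^esub> \<sigma>) p = (a \<odot>\<^bsub>sec H U\<^esub> section_value U \<sigma>) p"
    using p V(2) by (simp add: section_value_def[of U "restrict _ _"] sheafify_simps)
qed (simp add: section_value_def)

theorem tensor_sheaf_iso: "sheaf_iso X OX (tensor_sheaf X OX F G) H section_value"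
  unfolding tensor_sheaf_def
proof (rule sheaf_isoI)
  fix U assume U: "openin X U"
  show "bij_betw (section_value U) (carrier (sec (sheafify X OX T) U)) (carrier (sec H U))"
    using section_value_inj[OF U] section_value_closed[OF U] section_value_surj[OF U]
    by (auto simp: bij_betw_def)
  have "germ_value p (germ X T p U \<zero>\<^bsub>sec T U\<^esub>) = \<zero>\<^bsub>sec H U\<^esub> p" if "p \<in> U" for p
    using germ_value_germ[OF U that represents_zero[OF U]] .
  moreover have "\<zero>\<^bsub>sec H U\<^esub> \<in> extensional U"
    using H_ext[OF U] abelian_monoid.zero_closed[OF H_monoid[OF U]] by blast
  ultimately show "section_value U \<zero>\<^bsub>sec (sheafify X OX T) U\<^esub> = \<zero>\<^bsub>sec H U\<^esub>"
    by (intro extensionalityI[of _ U]) (auto simp: section_value_def sheafify_simps)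
  show "section_value V (res (sheafify X OX T) U V \<sigma>) = res H U V (section_value U \<sigma>)"
    if "V \<subseteq> U" for V \<sigma>
    using that by (auto simp: section_value_def sheafify_simps H_res restrict_def fun_eq_iff)
qed (use section_value_add section_value_smult H_smult_closed in auto)

end

section \<open>Products of sections\<close>

definition is_frac :: "'r::comm_semiring_1 set \<Rightarrow> ('r \<times> 'r) set \<Rightarrow> bool" where
  "is_frac S \<xi> \<longleftrightarrow> (\<exists>a. \<exists>f\<in>S. \<xi> = fr S a f)"

context mult_set
begin

lemma fr_add_assoc:
  "is_frac S \<xi> \<Longrightarrow> is_frac S \<eta> \<Longrightarrow> is_frac S \<zeta> \<Longrightarrow> fr_add S (fr_add S \<xi> \<eta>) \<zeta> = fr_add S \<xi> (fr_add S \<eta> \<zeta>)"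
  by (auto simp: is_frac_def fr_add_eq mult_S algebra_simps)

lemma fr_add_commute: "is_frac S \<xi> \<Longrightarrow> is_frac S \<eta> \<Longrightarrow> fr_add S \<xi> \<eta> = fr_add S \<eta> \<xi>"
  by (auto simp: is_frac_def fr_add_eq algebra_simps)

lemma fr_add_zero: "is_frac S \<xi> \<Longrightarrow> fr_add S (fr S 0 1) \<xi> = \<xi>"
  by (auto simp: is_frac_def fr_add_eq one_S)

lemma fr_mult_assoc:
  "is_frac S \<xi> \<Longrightarrow> is_frac S \<eta> \<Longrightarrow> is_frac S \<zeta> \<Longrightarrow> fr_mult S (fr_mult S \<xi> \<eta>) \<zeta> = fr_mult S \<xi> (fr_mult S \<eta> \<zeta>)"
  by (auto simp: is_frac_def fr_mult_eq mult_S algebra_simps)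

lemma fr_mult_commute: "is_frac S \<xi> \<Longrightarrow> is_frac S \<eta> \<Longrightarrow> fr_mult S \<xi> \<eta> = fr_mult S \<eta> \<xi>"
  by (auto simp: is_frac_def fr_mult_eq algebra_simps)

lemma fr_mult_one: "is_frac S \<xi> \<Longrightarrow> fr_mult S \<xi> (fr S 1 1) = \<xi>"
  by (auto simp: is_frac_def fr_mult_eq one_S)

lemma fr_mult_zero:
  assumes "is_frac S \<xi>" shows "fr_mult S \<xi> (fr S 0 1) = fr S 0 1"
proof -
  obtain a f where f: "f \<in> S" "\<xi> = fr S a f" using assms by (auto simp: is_frac_def)
  have "fr S 0 f = fr S 0 1" by (rule fr_eqI[of _ _ 1]) (auto simp: f one_S)
  then show ?thesis by (simp add: f fr_mult_eq one_S)
qed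

lemma fr_mult_add:
  assumes "is_frac S \<xi>" "is_frac S \<eta>" "is_frac S \<zeta>"
  shows "fr_mult S \<xi> (fr_add S \<eta> \<zeta>) = fr_add S (fr_mult S \<xi> \<eta>) (fr_mult S \<xi> \<zeta>)"
proof -
  obtain a f where f: "f \<in> S" "\<xi> = fr S a f" using assms(1) by (auto simp: is_frac_def)
  obtain b g where g: "g \<in> S" "\<eta> = fr S b g" using assms(2) by (auto simp: is_frac_def)
  obtain c h where h: "h \<in> S" "\<zeta> = fr S c h" using assms(3) by (auto simp: is_frac_def)
  have "fr S (f * (a * (h * b + g * c))) (f * (f * (g * h))) = fr S (a * (h * b + g * c)) (f * (g * h))"
    by (rule fr_expand) (auto simp: f g h mult_S)
  moreover have "f * (a * (h * b + g * c)) = f * h * (a * b) + f * g * (a * c)"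
    "f * (f * (g * h)) = f * g * (f * h)" by (simp_all add: algebra_simps)
  ultimately show ?thesis by (simp add: f g h fr_add_eq fr_mult_eq mult_S)
qed

end

abbreviation fsum :: "nat \<Rightarrow> 'm::comm_semiring_1 ppoint set \<Rightarrow> 'm fsection \<Rightarrow> 'm fsection \<Rightarrow> 'm fsection" where
  "fsum n U s t \<equiv> \<lambda>p\<in>U. fr_add (denoms n p) (s p) (t p)"

abbreviation fprod :: "nat \<Rightarrow> 'm::comm_semiring_1 ppoint set \<Rightarrow> 'm fsection \<Rightarrow> 'm fsection \<Rightarrow> 'm fsection" where
  "fprod n U s t \<equiv> \<lambda>p\<in>U. fr_mult (denoms n p) (s p) (t p)"

abbreviation fzero :: "nat \<Rightarrow> 'm::comm_semiring_1 ppoint set \<Rightarrow> 'm fsection" where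
  "fzero n U \<equiv> \<lambda>p\<in>U. fr (denoms n p) 0 1"

lemma fsections_ext: "s \<in> fsections n d U \<Longrightarrow> s \<in> extensional U"
  by (simp add: fsections_def)

lemma denoms_mult_set:
  "openin (proj_space n) U \<Longrightarrow> p \<in> U \<Longrightarrow> mult_set (denoms n p)"
  by (rule hprime.mult_set_sat[OF hprime_nonzero_at[OF open_points]])

lemma fsections_is_frac:
  assumes "openin (proj_space n) U" "s \<in> fsections n d U" "p \<in> U"
  shows "is_frac (denoms n p) (s p)"
proof -
  interpret hprime n "nonzero_at n p" by (rule hprime_nonzero_at[OF open_points[OF assms(1,3)]])
  show ?thesis using fsections_degree_frac[OF assms(2,3)] mem_sat
    by (auto simp: is_frac_def degree_frac_def)
qed

context
  fixes n :: nat and U :: "'m::comm_semiring_1 ppoint set"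
  assumes U: "openin (proj_space n) U"
begin

lemma fsum_assoc:
  "s \<in> fsections n d U \<Longrightarrow> t \<in> fsections n d' U \<Longrightarrow> v \<in> fsections n d'' U \<Longrightarrow>
    fsum n U (fsum n U s t) v = fsum n U s (fsum n U t v)"
  by (intro restrict_ext) (simp add: mult_set.fr_add_assoc[OF denoms_mult_set[OF U]] fsections_is_frac[OF U])

lemma fsum_commute:
  "s \<in> fsections n d U \<Longrightarrow> t \<in> fsections n d' U \<Longrightarrow> fsum n U s t = fsum n U t s"
  by (intro restrict_ext) (metis mult_set.fr_add_commute denoms_mult_set[OF U] fsections_is_frac[OF U])

lemma fsum_zero: "s \<in> fsections n d U \<Longrightarrow> fsum n U (fzero n U) s = s"
  by (rule extensionalityI[of _ U])
    (simp_all add: mult_set.fr_add_zero[OF denoms_mult_set[OF U]] fsections_is_frac[OF U] fsections_ext)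

lemma fprod_assoc:
  "s \<in> fsections n d U \<Longrightarrow> t \<in> fsections n d' U \<Longrightarrow> v \<in> fsections n d'' U \<Longrightarrow>
    fprod n U (fprod n U s t) v = fprod n U s (fprod n U t v)"
  by (intro restrict_ext) (simp add: mult_set.fr_mult_assoc[OF denoms_mult_set[OF U]] fsections_is_frac[OF U])

lemma fprod_commute:
  "s \<in> fsections n d U \<Longrightarrow> t \<in> fsections n d' U \<Longrightarrow> fprod n U s t = fprod n U t s"
  by (intro restrict_ext) (metis mult_set.fr_mult_commute denoms_mult_set[OF U] fsections_is_frac[OF U])

lemma fprod_one: "s \<in> fsections n d U \<Longrightarrow> fprod n U s (\<lambda>p\<in>U. fr (denoms n p) 1 1) = s"
  by (rule extensionalityI[of _ U])
    (simp_all add: mult_set.fr_mult_one[OF denoms_mult_set[OF U]] fsections_is_frac[OF U] fsections_ext)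

lemma fprod_zero: "s \<in> fsections n d U \<Longrightarrow> fprod n U s (fzero n U) = fzero n U"
  by (intro restrict_ext) (simp add: mult_set.fr_mult_zero[OF denoms_mult_set[OF U]] fsections_is_frac[OF U])

lemma fprod_add:
  "s \<in> fsections n d U \<Longrightarrow> t \<in> fsections n d' U \<Longrightarrow> v \<in> fsections n d'' U \<Longrightarrow>
    fprod n U s (fsum n U t v) = fsum n U (fprod n U s t) (fprod n U s v)"
  by (intro restrict_ext) (simp add: mult_set.fr_mult_add[OF denoms_mult_set[OF U]] fsections_is_frac[OF U])

lemma fprod_add_right:
  assumes "t \<in> fsections n d U" "v \<in> fsections n d U" "s \<in> fsections n d' U"
  shows "fprod n U (fsum n U t v) s = fsum n U (fprod n U t s) (fprod n U v s)"
  using fprod_commute[OF fsections_add[OF assms(1,2)] assms(3)] fprod_add[OF assms(3,1,2)]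
    fprod_commute[OF assms(1,3)] fprod_commute[OF assms(2,3)] by simp

lemma fprod_zero_left: "s \<in> fsections n d U \<Longrightarrow> fprod n U (fzero n U) s = fzero n U"
  using fprod_commute[OF fsections_zero[OF U]] fprod_zero by simp

lemma fprod_left_commute:
  assumes "s \<in> fsections n d U" "t \<in> fsections n d' U" "v \<in> fsections n d'' U"
  shows "fprod n U s (fprod n U t v) = fprod n U t (fprod n U s v)"
  unfolding fprod_assoc[OF assms, symmetric] fprod_assoc[OF assms(2,1,3), symmetric]
  using fprod_commute[OF assms(1,2)] by simp

lemma from_charts_zero: "from_charts n U \<zero>\<^bsub>sec (twisting_sheaf n d) U\<^esub> = fzero n U"
  using from_to_charts[OF U fsections_zero[OF U]] to_charts_zero[OF U] by metis

lemma from_charts_add: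
  assumes "s \<in> glued_sections n (chart_module n d) U" "t \<in> glued_sections n (chart_module n d) U"
  shows "s \<oplus>\<^bsub>sec (twisting_sheaf n d) U\<^esub> t \<in> glued_sections n (chart_module n d) U"
    and "from_charts n U (s \<oplus>\<^bsub>sec (twisting_sheaf n d) U\<^esub> t) = fsum n U (from_charts n U s) (from_charts n U t)"
proof -
  note f = from_charts_fsections[OF U assms(1)] from_charts_fsections[OF U assms(2)]
  have "s \<oplus>\<^bsub>sec (twisting_sheaf n d) U\<^esub> t = to_charts n d U (fsum n U (from_charts n U s) (from_charts n U t))"
    using to_charts_add[OF U f] to_from_charts[OF U assms(1)] to_from_charts[OF U assms(2)] by simp
  then show "s \<oplus>\<^bsub>sec (twisting_sheaf n d) U\<^esub> t \<in> glued_sections n (chart_module n d) U"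
    "from_charts n U (s \<oplus>\<^bsub>sec (twisting_sheaf n d) U\<^esub> t) = fsum n U (from_charts n U s) (from_charts n U t)"
    using to_charts_glued[OF U fsections_add[OF f]] from_to_charts[OF U fsections_add[OF f]] by simp_all
qed

lemma from_charts_smult:
  assumes "a \<in> glued_sections n (chart_module n 0) U" "t \<in> glued_sections n (chart_module n d) U"
  shows "a \<odot>\<^bsub>sec (twisting_sheaf n d) U\<^esub> t \<in> glued_sections n (chart_module n d) U"
    and "from_charts n U (a \<odot>\<^bsub>sec (twisting_sheaf n d) U\<^esub> t) = fprod n U (from_charts n U a) (from_charts n U t)"
proof -
  note f = from_charts_fsections[OF U assms(1)] from_charts_fsections[OF U assms(2)]
  have m: "fprod n U (from_charts n U a) (from_charts n U t) \<in> fsections n d U"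
    using fsections_mult[OF f] by simp
  have "a \<odot>\<^bsub>sec (twisting_sheaf n d) U\<^esub> t = to_charts n d U (fprod n U (from_charts n U a) (from_charts n U t))"
    using to_charts_smult[OF U f] to_from_charts[OF U assms(1)] to_from_charts[OF U assms(2)] by simp
  then show "a \<odot>\<^bsub>sec (twisting_sheaf n d) U\<^esub> t \<in> glued_sections n (chart_module n d) U"
    "from_charts n U (a \<odot>\<^bsub>sec (twisting_sheaf n d) U\<^esub> t) = fprod n U (from_charts n U a) (from_charts n U t)"
    using to_charts_glued[OF U m] from_to_charts[OF U m] by simp_all
qed

lemma twisting_zero_closed: "\<zero>\<^bsub>sec (twisting_sheaf n d) U\<^esub> \<in> glued_sections n (chart_module n d) U"
  using to_charts_glued[OF U fsections_zero[OF U]] to_charts_zero[OF U] by metis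

lemma twisting_res_closed:
  assumes "openin (proj_space n) V" "V \<subseteq> U" "s \<in> glued_sections n (chart_module n d) U"
  shows "res (twisting_sheaf n d) U V s \<in> glued_sections n (chart_module n d) V"
  using to_charts_glued[OF assms(1) fsections_restrict[OF from_charts_fsections[OF U assms(3)] assms(1,2)]]
    to_charts_res[OF assms(2)] to_from_charts[OF U assms(3)] by metis

lemma fsheaf_abelian_monoid: "abelian_monoid (sec (fsheaf n d) U)"
proof (rule abelian_monoidI)
  fix x y z assume "x \<in> carrier (sec (fsheaf n d) U)" "y \<in> carrier (sec (fsheaf n d) U)"
    "z \<in> carrier (sec (fsheaf n d) U)"
  then have xyz: "x \<in> fsections n d U" "y \<in> fsections n d U" "z \<in> fsections n d U" by simp_all
  show "x \<oplus>\<^bsub>sec (fsheaf n d) U\<^esub> y \<oplus>\<^bsub>sec (fsheaf n d) U\<^esub> z =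
      x \<oplus>\<^bsub>sec (fsheaf n d) U\<^esub> (y \<oplus>\<^bsub>sec (fsheaf n d) U\<^esub> z)"
    unfolding fsheaf_simps using fsum_assoc[OF xyz] .
next
  fix x y assume "x \<in> carrier (sec (fsheaf n d) U)" "y \<in> carrier (sec (fsheaf n d) U)"
  then have "x \<in> fsections n d U" "y \<in> fsections n d U" by simp_all
  then show "x \<oplus>\<^bsub>sec (fsheaf n d) U\<^esub> y = y \<oplus>\<^bsub>sec (fsheaf n d) U\<^esub> x"
    unfolding fsheaf_simps by (rule fsum_commute)
next
  fix x assume "x \<in> carrier (sec (fsheaf n d) U)"
  then show "\<zero>\<^bsub>sec (fsheaf n d) U\<^esub> \<oplus>\<^bsub>sec (fsheaf n d) U\<^esub> x = x"
    unfolding fsheaf_simps by (rule fsum_zero)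
next
  fix x y assume "x \<in> carrier (sec (fsheaf n d) U)" "y \<in> carrier (sec (fsheaf n d) U)"
  then show "x \<oplus>\<^bsub>sec (fsheaf n d) U\<^esub> y \<in> carrier (sec (fsheaf n d) U)"
    unfolding fsheaf_simps by (rule fsections_add)
qed (unfold fsheaf_simps, rule fsections_zero[OF U])

end

lemma restrict_fsum: "V \<subseteq> U \<Longrightarrow> restrict (fsum n U s t) V = fsum n V (restrict s V) (restrict t V)"
  by (auto simp: restrict_def fun_eq_iff)

lemma restrict_fprod: "V \<subseteq> U \<Longrightarrow> restrict (fprod n U s t) V = fprod n V (restrict s V) (restrict t V)"
  by (auto simp: restrict_def fun_eq_iff)

lemma restrict_fzero: "V \<subseteq> U \<Longrightarrow> restrict (fzero n U) V = fzero n V"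
  by (auto simp: restrict_def fun_eq_iff)

text \<open>The section c x_i^k of O(k) over an open part of D(x_i). Since \<open>fr\<close> admits
  Laurent polynomials as numerators, negative k needs no separate formula.\<close>

definition msec :: "nat \<Rightarrow> 'm::comm_semiring_1 \<Rightarrow> nat \<Rightarrow> int \<Rightarrow> 'm ppoint set \<Rightarrow> 'm fsection" where
  "msec n c i k V = (\<lambda>p\<in>V. fr (denoms n p) (Poly_Mapping.single 0 c * xpow i k) 1)"

lemma restrict_msec: "V \<subseteq> U \<Longrightarrow> restrict (msec n c i k U) V = msec n c i k V"
  by (auto simp: msec_def restrict_def fun_eq_iff)

context
  fixes n :: nat and i :: nat and V :: "'m::comm_semiring_1 ppoint set"
  assumes V: "openin (proj_space n) V" and Vi: "V \<subseteq> standard_open n i"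
begin

lemma msec_point:
  assumes "p \<in> V" shows "hprime n (nonzero_at n p)" "i \<in> charts n (nonzero_at n p)" "i \<le> n"
  using assms Vi hprime_nonzero_at by (auto simp: standard_open_def charts_def)

lemma msec_fsections: "msec n c i k V \<in> fsections n k V"
proof (cases "V = {}")
  case True
  then show ?thesis by (simp add: fsections_def msec_def restrict_def)
next
  case False
  then have i: "i \<le> n" using msec_point by blast
  let ?c = "Poly_Mapping.single 0 c :: 'm laurent"
  have c: "?c \<in> hom_loc n {} 0" by (simp add: hom_loc_def)
  show ?thesis
  proof (cases "0 \<le> k")
    case True
    have "1 \<in> nonzero_at n q" if "q \<in> V" for q using hprime.one_mem[OF msec_point(1)[OF that]] .
    moreover have "?c * xpow i k \<in> hom_loc n {} k" using hom_loc_mult[OF c xpow_hom_loc[OF i]] True by simp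
    ultimately show ?thesis
      by (intro fraction_on_fsections[OF V, of _ k "?c * xpow i k" 1])
        (auto simp: fraction_on_def msec_def intro!: exI[of _ 0])
  next
    case False
    \<comment> \<open>Local fractions must have polynomials as numerator and denominator, so for
      negative k the negative power moves into the denominator.\<close>
    have "xpow i (- k) \<in> nonzero_at n q \<and> fr (denoms n q) (?c * xpow i k) 1 = fr (denoms n q) ?c (xpow i (- k))"
      if q: "q \<in> V" for q
    proof -
      interpret hprime n "nonzero_at n q" by (rule msec_point[OF q])
      have x: "xpow i (- k) \<in> nonzero_at n q" using xpow_mem[OF msec_point(2)[OF q]] False by simp
      have "xpow i (- k) * (?c * xpow i k) = ?c * (xpow i (- k) * xpow i k)" by (rule mult.left_commute)
      then have "fr (denoms n q) (?c * xpow i k) 1 = fr (denoms n q) ?c (xpow i (- k))"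
        by (intro sat.fr_eqI[of _ _ 1]) (simp_all add: one_sat mem_sat[OF x])
      with x show ?thesis ..
    qed
    then show ?thesis using xpow_hom_loc[OF i, of "{}" "- k"] False c
      by (intro fraction_on_fsections[OF V, of _ k ?c "xpow i (- k)"])
        (auto simp: fraction_on_def msec_def intro!: exI[of _ "- k"])
  qed
qed

lemma msec_inverse:
  assumes c: "c * c' = 1" and k: "k + k' = 0" and s: "s \<in> fsections n d V"
  shows "fprod n V (fprod n V s (msec n c i k V)) (msec n c' i k' V) = s"
proof (rule extensionalityI[of _ V])
  fix p assume p: "p \<in> V"
  interpret hprime n "nonzero_at n p" by (rule msec_point[OF p])
  obtain a f where f: "f \<in> denoms n p" "s p = fr (denoms n p) a f"
    using fsections_is_frac[OF V s p] by (auto simp: is_frac_def)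
  have "a * (Poly_Mapping.single 0 c * xpow i k) * (Poly_Mapping.single 0 c' * xpow i k') =
      a * (Poly_Mapping.single 0 c * Poly_Mapping.single 0 c') * (xpow i k * xpow i k')"
    by (simp only: ac_simps)
  also have "\<dots> = a" by (simp add: mult_single xpow_add c k)
  finally show "fprod n V (fprod n V s (msec n c i k V)) (msec n c' i k' V) p = s p"
    using p f by (simp add: msec_def sat.fr_mult_eq one_sat)
qed (simp_all add: fsections_ext[OF s])

lemma msec_bij:
  assumes c: "c * c' = 1"
  shows "bij_betw (\<lambda>a. fprod n V a (msec n c i k V)) (fsections n 0 V) (fsections n k V)"
proof (rule bij_betw_byWitness[where f' = "\<lambda>h. fprod n V h (msec n c' i (- k) V)"])
  show "\<forall>a\<in>fsections n 0 V. fprod n V (fprod n V a (msec n c i k V)) (msec n c' i (- k) V) = a"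
    using msec_inverse[OF c] by simp
  show "\<forall>h\<in>fsections n k V. fprod n V (fprod n V h (msec n c' i (- k) V)) (msec n c i k V) = h"
    using msec_inverse[of c' c "- k" k] c by (simp add: mult.commute)
  show "(\<lambda>a. fprod n V a (msec n c i k V)) ` fsections n 0 V \<subseteq> fsections n k V"
    by (rule image_subsetI) (rule fsections_mult[OF _ msec_fsections], assumption, simp)
  show "(\<lambda>h. fprod n V h (msec n c' i (- k) V)) ` fsections n k V \<subseteq> fsections n 0 V"
    by (rule image_subsetI) (rule fsections_mult[OF _ msec_fsections], assumption, simp)
qed

end

section \<open>Tensor products of twisting sheaves\<close>

definition twist_mult :: "nat \<Rightarrow> 'm::comm_semiring_1 ppoint set \<Rightarrow> 'm psection \<Rightarrow> 'm psection \<Rightarrow> 'm fsection" where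
  "twist_mult n V s t = fprod n V (from_charts n V s) (from_charts n V t)"

lemma carrier_fsheaf_restrict_res:
  "openin (proj_space n) U \<Longrightarrow> openin (proj_space n) V \<Longrightarrow> V \<subseteq> U \<Longrightarrow> a \<in> glued_sections n (chart_module n 0) U \<Longrightarrow>
    from_charts n V (res (proj_sheaf n) U V a) = restrict (from_charts n U a) V"
  by (simp add: proj_sheaf_twisting from_charts_res)

lemma twisting_res_res:
  assumes "W \<subseteq> V" "V \<subseteq> U"
  shows "res (twisting_sheaf n d) V W (res (twisting_sheaf n d) U V s) = res (twisting_sheaf n d) U W s"
proof -
  have "P \<in> chart_part n i V" if "P \<in> chart_part n i W" for i P
    using that chart_part_open_subset[OF assms(1)] by blast
  then show ?thesis by (auto simp: twisting_sheaf_def restrict_def fun_eq_iff)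
qed

text \<open>x_i^m generates O(m) over D(x_i). Dividing by it is multiplication with x_i^(-m), which
  inverts both the scalar action on the generator and the pairing with it.\<close>

lemma twisting_generator:
  fixes V :: "'m::comm_semiring_1 ppoint set" and m :: int
  assumes V: "openin (proj_space n) V" "V \<subseteq> standard_open n i"
  defines "y \<equiv> to_charts n m V (msec n 1 i m V)"
  shows "y \<in> glued_sections n (chart_module n m) V"
    and "t \<in> glued_sections n (chart_module n m) V \<Longrightarrow>
      \<exists>a\<in>glued_sections n (chart_module n 0) V. t = a \<odot>\<^bsub>sec (twisting_sheaf n m) V\<^esub> y"
    and "bij_betw (\<lambda>s. twist_mult n V s y) (glued_sections n (chart_module n l) V) (fsections n (l + m) V)"
proof -
  note x = msec_fsections[OF V, where c = 1]
  show y: "y \<in> glued_sections n (chart_module n m) V" unfolding y_def by (rule to_charts_glued[OF V(1) x])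
  have fy: "from_charts n V y = msec n 1 i m V" unfolding y_def by (rule from_to_charts[OF V(1) x])
  show "\<exists>a\<in>glued_sections n (chart_module n 0) V. t = a \<odot>\<^bsub>sec (twisting_sheaf n m) V\<^esub> y"
    if t: "t \<in> glued_sections n (chart_module n m) V"
  proof -
    note ft = from_charts_fsections[OF V(1) t]
    let ?a = "fprod n V (from_charts n V t) (msec n 1 i (- m) V)"
    have a: "?a \<in> fsections n 0 V" using fsections_mult[OF ft x[of "- m"], of 0] by simp
    have a': "to_charts n 0 V ?a \<in> glued_sections n (chart_module n 0) V" by (rule to_charts_glued[OF V(1) a])
    have "to_charts n 0 V ?a \<odot>\<^bsub>sec (twisting_sheaf n m) V\<^esub> y = to_charts n m V (fprod n V ?a (msec n 1 i m V))"
      unfolding y_def using to_charts_smult[OF V(1) a x] by simp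
    also have "\<dots> = t"
      by (subst msec_inverse[OF V _ _ ft]) (simp_all add: to_from_charts[OF V(1) t])
    finally show ?thesis by (intro bexI[OF _ a']) (rule HOL.sym)
  qed
  show "bij_betw (\<lambda>s. twist_mult n V s y) (glued_sections n (chart_module n l) V) (fsections n (l + m) V)"
  proof (rule bij_betw_byWitness[where f' = "\<lambda>h. to_charts n l V (fprod n V h (msec n 1 i (- m) V))"])
    show "\<forall>s\<in>glued_sections n (chart_module n l) V.
        to_charts n l V (fprod n V (twist_mult n V s y) (msec n 1 i (- m) V)) = s"
      using msec_inverse[OF V _ _ from_charts_fsections[OF V(1)], of 1 1 m "- m"] to_from_charts[OF V(1)]
      by (simp add: twist_mult_def fy)
    have h: "fprod n V h (msec n 1 i (- m) V) \<in> fsections n l V" if "h \<in> fsections n (l + m) V" for h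
      using fsections_mult[OF that x[of "- m"], of l] by simp
    show "\<forall>h\<in>fsections n (l + m) V. twist_mult n V (to_charts n l V (fprod n V h (msec n 1 i (- m) V))) y = h"
      using h msec_inverse[OF V, of 1 1 "- m" m] by (simp add: twist_mult_def fy from_to_charts[OF V(1)])
    show "(\<lambda>s. twist_mult n V s y) ` glued_sections n (chart_module n l) V \<subseteq> fsections n (l + m) V"
      using fsections_mult[OF from_charts_fsections[OF V(1)] x] by (auto simp: twist_mult_def fy)
    show "(\<lambda>h. to_charts n l V (fprod n V h (msec n 1 i (- m) V))) ` fsections n (l + m) V
        \<subseteq> glued_sections n (chart_module n l) V"
      using to_charts_glued[OF V(1)] h by auto
  qed
qed

text \<open>The pairing is pointwise multiplication of fractions. It takes values in
  \<open>fsheaf\<close> because the target of a \<open>tensor_pairing\<close> must consist of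
  functions on the points.\<close>

lemma twisting_tensor_pairing:
  "tensor_pairing (proj_space n :: 'm::comm_semiring_1 ppoint topology) (proj_sheaf n)
    (twisting_sheaf n l) (twisting_sheaf n m) (fsheaf n (l + m)) (twist_mult n)"
proof (rule tensor_pairing.intro, unfold carrier_proj_sheaf carrier_twisting_sheaf fsheaf_simps twist_mult_def, goal_cases)
  case (1 U V a)
  then show ?case using twisting_res_closed by (simp add: proj_sheaf_twisting)
next
  case (2 U V W a)
  then show ?case using twisting_res_res by (simp add: proj_sheaf_twisting)
next
  case (3 U) then show ?case by (rule twisting_zero_closed)
next
  case (4 U s s') then show ?case by (rule from_charts_add)
next
  case (5 U a s) then show ?case by (rule from_charts_smult)
next
  case (6 U V s) then show ?case by (rule twisting_res_closed)
next
  case (7 U) then show ?case by (rule twisting_zero_closed)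
next
  case (8 U s s') then show ?case by (rule from_charts_add)
next
  case (9 U a s) then show ?case by (rule from_charts_smult)
next
  case (10 U V s) then show ?case by (rule twisting_res_closed)
next
  case (11 U) then show ?case by (rule fsheaf_abelian_monoid)
next
  case (12 U a x) then show ?case using fsections_mult[OF from_charts_fsections[OF 12(1,2)] 12(3), of "l + m"] by simp
next
  case (13 U a x y) then show ?case by (intro fprod_add from_charts_fsections)
next
  case (14 U a) then show ?case by (intro fprod_zero from_charts_fsections)
next
  case (15 U x) then show ?case by (intro fsections_ext)
next
  case 16 show ?case by (rule HOL.refl)
next
  case (17 U V x) then show ?case by (intro fsections_restrict)
next
  case (18 U V) then show ?case by (intro restrict_fzero)
next
  case (19 U V x y) then show ?case by (intro restrict_fsum)
next
  case (20 U V a x) then show ?case by (simp only: restrict_fprod carrier_fsheaf_restrict_res)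
next
  case (21 U x) show ?case by (rule fsections_localI[OF 21(2,3)])
next
  case (22 U s t) then show ?case by (intro fsections_mult[OF _ _ HOL.refl] from_charts_fsections)
next
  case (23 U s s' t)
  then show ?case
    by (simp only: from_charts_add(2) fprod_add_right[OF 23(1) from_charts_fsections from_charts_fsections from_charts_fsections])
next
  case (24 U s t t')
  then show ?case
    by (simp only: from_charts_add(2) fprod_add[OF 24(1) from_charts_fsections from_charts_fsections from_charts_fsections])
next
  case (25 U t)
  then show ?case
    by (simp only: from_charts_zero fprod_zero_left[OF 25(1) from_charts_fsections])
next
  case (26 U s)
  then show ?case
    by (simp only: from_charts_zero fprod_zero[OF 26(1) from_charts_fsections])
next
  case (27 U a s t)
  then show ?case
    by (simp only: from_charts_smult(2) fprod_assoc[OF 27(1) from_charts_fsections from_charts_fsections from_charts_fsections])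
next
  case (28 U a s t)
  show ?case unfolding from_charts_smult(2)[OF 28(1,2,4)]
    by (rule fprod_left_commute[OF 28(1) from_charts_fsections[OF 28(1,3)]
          from_charts_fsections[OF 28(1,2)] from_charts_fsections[OF 28(1,4)]])
next
  case (29 U V s t) then show ?case by (simp only: from_charts_res restrict_fprod)
next
  case (30 p)
  then obtain i where i: "i \<in> charts n (nonzero_at n p)"
    using hprime.charts_nonempty[OF hprime_nonzero_at] by blast
  show ?case
  proof (intro exI[of _ "standard_open n i"] conjI allI impI)
    show "openin (proj_space n) (standard_open n i :: 'm ppoint set)" by (rule openin_standard_open)
    show "p \<in> standard_open n i" using 30 i by (simp add: standard_open_def)
    fix V :: "'m ppoint set" assume V: "openin (proj_space n) V" "V \<subseteq> standard_open n i"
    let ?y = "to_charts n m V (msec n 1 i m V)"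
    show "\<exists>y\<in>glued_sections n (chart_module n m) V.
        (\<forall>t\<in>glued_sections n (chart_module n m) V. \<exists>a\<in>glued_sections n (chart_module n 0) V.
          t = a \<odot>\<^bsub>sec (twisting_sheaf n m) V\<^esub> y) \<and>
        bij_betw (\<lambda>s. fprod n V (from_charts n V s) (from_charts n V y))
          (glued_sections n (chart_module n l) V) (fsections n (l + m) V)"
      using twisting_generator(1,2)[OF V, where m = m] twisting_generator(3)[OF V, where m = m and l = l] unfolding twist_mult_def by (intro bexI[of _ ?y]) auto
  qed
qed

corollary twisting_tensor_twisting:
  "sheaf_isomorphic (proj_space n) (proj_sheaf n)
    (tensor_sheaf (proj_space n) (proj_sheaf n) (twisting_sheaf n l) (twisting_sheaf n m))
    (twisting_sheaf n (l + m))"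
  using sheaf_iso_trans[OF tensor_pairing.tensor_sheaf_iso[OF twisting_tensor_pairing] fsheaf_iso_twisting]
  unfolding sheaf_isomorphic_iff by blast

section \<open>Monomials over an idempotent semifield\<close>

text \<open>
  Over a semifield in which sums vanish only trivially, the monomials in the variables with index in
  \<open>I\<close> are the homogeneous polynomials outside a homogeneous prime ideal, and all points at which
  these variables are invertible are generizations of the corresponding point.
\<close>

definition monomials :: "nat set \<Rightarrow> 'm::comm_semiring_1 laurent set" where
  "monomials I = {f. \<exists>a. Poly_Mapping.keys f = {a} \<and> Poly_Mapping.keys a \<subseteq> I \<and> (\<forall>k. 0 \<le> Poly_Mapping.lookup a k)}"

lemma single_of_keys:
  assumes "Poly_Mapping.keys f = {a}"
  shows "f = Poly_Mapping.single a (Poly_Mapping.lookup f a)"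
proof (rule poly_mapping_eqI)
  fix b
  show "Poly_Mapping.lookup f b = Poly_Mapping.lookup (Poly_Mapping.single a (Poly_Mapping.lookup f a)) b"
    using assms in_keys_iff[of b f] by (cases "a = b") (auto simp: lookup_single)
qed

lemma poly_mapping_split:
  obtains g where "f = Poly_Mapping.single a (Poly_Mapping.lookup f a) + g"
proof
  show "f = Poly_Mapping.single a (Poly_Mapping.lookup f a) + Poly_Mapping.update a 0 f"
    by (rule poly_mapping_eqI) (auto simp: lookup_add lookup_single lookup_update when_def)
qed

lemma single_as_product:
  assumes "finite I" "Poly_Mapping.keys a \<subseteq> I"
  shows "Poly_Mapping.single a (1::'m::comm_semiring_1) = (\<Prod>i\<in>I. xpow i (Poly_Mapping.lookup a i))"
proof -
  have "(\<Prod>i\<in>I. xpow i (h i)) = Poly_Mapping.single (\<Sum>i\<in>I. Poly_Mapping.single i (h i)) (1::'m)" for h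
    using assms(1) by (induction I rule: finite_induct) (simp_all add: xpow_def mult_single)
  moreover have "(\<Sum>i\<in>I. Poly_Mapping.single i (Poly_Mapping.lookup a i)) = a"
  proof (rule poly_mapping_eqI)
    fix k
    have "k \<notin> I \<Longrightarrow> Poly_Mapping.lookup a k = 0" using assms(2) by (metis in_keys_iff subsetD)
    then show "Poly_Mapping.lookup (\<Sum>i\<in>I. Poly_Mapping.single i (Poly_Mapping.lookup a i)) k = Poly_Mapping.lookup a k"
      using assms(1) by (simp add: lookup_sum lookup_single when_def)
  qed
  ultimately show ?thesis by simp
qed

locale idempotent_semifield =
  fixes m :: "'m::comm_semiring_1 itself"
  assumes unit: "(c::'m) \<noteq> 0 \<Longrightarrow> \<exists>d. c * d = 1" and idem: "(c::'m) + c = c"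
begin

text \<open>Idempotency gives c = c + (c + d) = c + d = 0 as soon as c + d = 0. Consequently terms
  of polynomials never cancel against each other.\<close>

lemma add_eq_0_iff: "(c::'m) + d = 0 \<longleftrightarrow> c = 0 \<and> d = 0"
proof
  assume 0: "c + d = 0"
  have "c = c + (c + d)" using 0 by simp
  also have "\<dots> = c + d" by (simp add: idem flip: add.assoc)
  finally have "c = 0" using 0 by simp
  then show "c = 0 \<and> d = 0" using 0 by simp
qed simp

lemma mult_nonzero: assumes "(c::'m) \<noteq> 0" "d \<noteq> 0" shows "c * d \<noteq> 0"
proof
  assume 0: "c * d = 0"
  obtain c' where "c * c' = 1" using unit[OF assms(1)] by blast
  have "d = (c * c') * d" by (simp add: \<open>c * c' = 1\<close>)
  also have "\<dots> = c' * (c * d)" by (simp only: ac_simps)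
  finally have "d = c' * (c * d)" .
  then show False using 0 assms(2) by simp
qed

lemma keys_add_eq: "Poly_Mapping.keys (f + g) = Poly_Mapping.keys f \<union> Poly_Mapping.keys (g :: 'm laurent)"
  by (auto simp: in_keys_iff lookup_add add_eq_0_iff)

text \<open>Splitting off the term at a and the term at b, their product has a nonzero coefficient,
  and the remaining summands cannot annihilate it.\<close>

lemma keys_mult_sup:
  assumes "a \<in> Poly_Mapping.keys (f :: 'm laurent)" "b \<in> Poly_Mapping.keys g"
  shows "a + b \<in> Poly_Mapping.keys (f * g)"
proof -
  obtain f' where f: "f = Poly_Mapping.single a (Poly_Mapping.lookup f a) + f'" using poly_mapping_split .
  obtain g' where g: "g = Poly_Mapping.single b (Poly_Mapping.lookup g b) + g'" using poly_mapping_split .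
  have "Poly_Mapping.lookup f a * Poly_Mapping.lookup g b \<noteq> 0"
    using assms mult_nonzero by (simp add: in_keys_iff)
  then have "a + b \<in> Poly_Mapping.keys (Poly_Mapping.single a (Poly_Mapping.lookup f a) * Poly_Mapping.single b (Poly_Mapping.lookup g b))"
    by (simp add: mult_single)
  then show ?thesis
    by (subst f, subst g) (simp add: distrib_left distrib_right keys_add_eq del: mult_single)
qed

text \<open>The support of a product contains all sums of exponents of the factors. If it is a
  single exponent, cancellation among exponents leaves one exponent in each factor.\<close>

lemma keys_mult_single:
  assumes "Poly_Mapping.keys (f * g :: 'm laurent) = {a}"
  obtains b c where "Poly_Mapping.keys f = {b}" "Poly_Mapping.keys g = {c}" "b + c = a"
proof -
  have "f \<noteq> 0" "g \<noteq> 0" using assms by auto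
  then obtain b c where bc: "b \<in> Poly_Mapping.keys f" "c \<in> Poly_Mapping.keys g"
    by (metis ex_in_conv keys_eq_empty)
  have sum: "b' + c' = a" if "b' \<in> Poly_Mapping.keys f" "c' \<in> Poly_Mapping.keys g" for b' c'
    using keys_mult_sup[OF that] assms by simp
  have "b' = b" if "b' \<in> Poly_Mapping.keys f" for b'
    using sum[OF that bc(2)] sum[OF bc] by (metis add_right_cancel)
  then have "Poly_Mapping.keys f = {b}" using bc(1) by blast
  moreover have "c' = c" if "c' \<in> Poly_Mapping.keys g" for c'
    using sum[OF bc(1) that] sum[OF bc] by (metis add_left_cancel)
  then have "Poly_Mapping.keys g = {c}" using bc(2) by blast
  ultimately show ?thesis using that sum[OF bc] by blast
qed

lemma monomials_mult_iff:
  assumes f: "f \<in> hom_loc n {} d" and g: "(g :: 'm laurent) \<in> hom_loc n {} e"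
  shows "f * g \<in> monomials I \<longleftrightarrow> f \<in> monomials I \<and> g \<in> monomials I"
proof
  assume "f * g \<in> monomials I"
  then obtain a where a: "Poly_Mapping.keys (f * g) = {a}" "Poly_Mapping.keys a \<subseteq> I"
    by (auto simp: monomials_def)
  obtain b c where bc: "Poly_Mapping.keys f = {b}" "Poly_Mapping.keys g = {c}" "b + c = a"
    by (rule keys_mult_single[OF a(1)])
  have nn: "0 \<le> Poly_Mapping.lookup b k" "0 \<le> Poly_Mapping.lookup c k" for k
    using f g bc by (auto simp: hom_loc_def)
  have "Poly_Mapping.lookup a k = Poly_Mapping.lookup b k + Poly_Mapping.lookup c k" for k
    using bc(3) by (auto simp: lookup_add)
  \<comment> \<open>Exponents of polynomials are nonnegative, so a variable absent from the product
    is absent from both factors.\<close>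
  then have "Poly_Mapping.lookup b k = 0 \<and> Poly_Mapping.lookup c k = 0" if "Poly_Mapping.lookup a k = 0" for k
    using nn[of k] that by (simp add: add_nonneg_eq_0_iff)
  then have "Poly_Mapping.keys b \<subseteq> I" "Poly_Mapping.keys c \<subseteq> I"
    using a(2) by (auto simp: in_keys_iff subset_iff)
  then show "f \<in> monomials I \<and> g \<in> monomials I"
    using bc nn by (auto simp: monomials_def)
next
  assume "f \<in> monomials I \<and> g \<in> monomials I"
  then obtain a b where a: "Poly_Mapping.keys f = {a}" "Poly_Mapping.keys a \<subseteq> I" "\<forall>k. 0 \<le> Poly_Mapping.lookup a k"
    and b: "Poly_Mapping.keys g = {b}" "Poly_Mapping.keys b \<subseteq> I" "\<forall>k. 0 \<le> Poly_Mapping.lookup b k"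
    by (auto simp: monomials_def)
  have "Poly_Mapping.keys (f * g) = {a + b}"
    using keys_mult[of f g] keys_mult_sup[of a f b g] a(1) b(1) by auto
  moreover have "Poly_Mapping.keys (a + b) \<subseteq> I" using keys_add[of a b] a(2) b(2) by blast
  ultimately show "f * g \<in> monomials I" using a(3) b(3) by (auto simp: monomials_def lookup_add)
qed

lemma hprime_monomials:
  assumes I: "I \<subseteq> {..n}" "I \<noteq> {}"
  shows "hprime n (monomials I :: 'm laurent set)"
proof
  show "\<exists>e. f \<in> hom_loc n {} e" if "f \<in> monomials I" for f :: "'m laurent"
    using that I(1) by (fastforce simp: monomials_def hom_loc_def)
  show "(1 :: 'm laurent) \<in> monomials I" by (auto simp: monomials_def)
  show "(0 :: 'm laurent) \<notin> monomials I" by (auto simp: monomials_def)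
  show "f \<in> monomials I \<or> g \<in> monomials I" if "f + g \<in> monomials I" for f g :: "'m laurent"
    using that by (force simp: monomials_def keys_add_eq Un_singleton_iff)
  obtain i where "i \<in> I" using I(2) by blast
  then show "\<exists>i\<le>n. xpow i 1 \<in> (monomials I :: 'm laurent set)"
    using I(1) by (intro exI[of _ i]) (auto simp: monomials_def xpow_def lookup_single when_def)
qed (rule monomials_mult_iff)

lemma monomial_point:
  assumes I: "I \<subseteq> {..n}" "I \<noteq> {}"
  obtains p :: "'m ppoint" where "p \<in> topspace (proj_space n)" "nonzero_at n p = monomials I"
    "\<forall>i\<in>I. p \<in> standard_open n i"
proof -
  interpret hprime n "monomials I :: 'm laurent set" by (rule hprime_monomials[OF I])
  obtain i where i: "i \<in> charts n (monomials I :: 'm laurent set)" using charts_nonempty by blast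
  let ?p = "ppoint n (i, prime_of n (monomials I :: 'm laurent set) {i})"
  have "j \<in> charts n (monomials I :: 'm laurent set)" if "j \<in> I" for j
    using that I(1) by (auto simp: monomials_def charts_def xpow_def lookup_single when_def)
  then show ?thesis
    using that[of ?p] ppoint_prime_of[OF i] by (simp add: standard_open_def)
qed

lemma (in hprime) constant_mem:
  assumes "c * d = 1" shows "Poly_Mapping.single 0 c \<in> T"
proof -
  have h: "Poly_Mapping.single 0 e \<in> hom_loc n {} 0" for e :: 'm by (simp add: hom_loc_def)
  have "Poly_Mapping.single 0 c * Poly_Mapping.single 0 d = (1 :: 'm laurent)" using assms by (simp add: mult_single)
  then show ?thesis using mult_iff[OF h h, of c d] one_mem by simp
qed

text \<open>A nonzero coefficient is a unit and therefore lies in every such T; the rest of a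
  monomial is a product of powers of variables in T.\<close>

lemma monomials_subset:
  assumes "hprime n (T :: 'm laurent set)" "I \<subseteq> charts n T"
  shows "monomials I \<subseteq> T"
proof
  interpret hprime n T by fact
  fix f :: "'m laurent" assume "f \<in> monomials I"
  then obtain a where a: "Poly_Mapping.keys f = {a}" "Poly_Mapping.keys a \<subseteq> I" "\<forall>k. 0 \<le> Poly_Mapping.lookup a k"
    by (auto simp: monomials_def)
  have "Poly_Mapping.lookup f a \<noteq> 0" using a(1) by (auto simp: in_keys_iff)
  then have c: "Poly_Mapping.single 0 (Poly_Mapping.lookup f a) \<in> T" using unit constant_mem by blast
  have fin: "finite I" by (rule finite_charts[OF assms(2)])
  have "(\<Prod>i\<in>J. xpow i (Poly_Mapping.lookup a i)) \<in> T" if "finite J" "J \<subseteq> I" for J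
    using that
  proof (induction J rule: finite_induct)
    case (insert i J)
    then show ?case using a(3) assms(2) by (auto intro!: mult_mem xpow_mem)
  qed (simp add: one_mem)
  then have "Poly_Mapping.single a (1::'m) \<in> T" unfolding single_as_product[OF fin a(2)] using fin by blast
  with c have "Poly_Mapping.single 0 (Poly_Mapping.lookup f a) * Poly_Mapping.single a 1 \<in> T" by (rule mult_mem)
  then show "f \<in> T" using single_of_keys[OF a(1)] by (simp add: mult_single)
qed

text \<open>A multiple of u is a monomial with invertible coefficient, hence a unit among the
  Laurent polynomials. So at the point of \<open>I\<close> equality of fractions with denominator 1
  is equality of Laurent polynomials.\<close>

lemma monomial_cancel:
  assumes I: "I \<subseteq> {..n}" "I \<noteq> {}" and u: "(u :: 'm laurent) \<in> sat (monomials I)" and eq: "u * x = u * y"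
  shows "x = y"
proof -
  obtain t where "t * u \<in> monomials I" using u by (auto simp: sat_def)
  then obtain a where a: "Poly_Mapping.keys (t * u) = {a}" by (auto simp: monomials_def)
  obtain d where d: "Poly_Mapping.lookup (t * u) a * d = 1" using unit a by (auto simp: in_keys_iff)
  have v: "Poly_Mapping.single (- a) d * (t * u) = 1"
    by (subst single_of_keys[OF a]) (simp add: mult_single d mult.commute[of d])
  have "x = Poly_Mapping.single (- a) d * (t * u) * x" by (simp add: v)
  also have "\<dots> = Poly_Mapping.single (- a) d * t * (u * x)" by (simp only: mult.assoc)
  also have "\<dots> = Poly_Mapping.single (- a) d * t * (u * y)" by (simp only: eq)
  also have "\<dots> = Poly_Mapping.single (- a) d * (t * u) * y" by (simp only: mult.assoc)
  also have "\<dots> = y" by (simp add: v)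
  finally show ?thesis .
qed

section \<open>Invertible functions on the intersection of two standard open sets\<close>

lemma fsection_constant_fraction:
  assumes s: "s \<in> fsections n d U" and p: "p \<in> U" "nonzero_at n p = monomials I"
    and U: "U \<subseteq> topspace (proj_space n)" "\<And>q i. q \<in> U \<Longrightarrow> i \<in> I \<Longrightarrow> q \<in> standard_open n i"
  obtains a f where "fraction_on n d U a (f :: 'm laurent) s"
proof -
  obtain V a f where V: "openin (proj_space n) V" "p \<in> V" "fraction_on n d V a f s"
    using s p(1) unfolding fsections_def by blast
  have "U \<subseteq> V"
  proof
    fix q assume q: "q \<in> U"
    then have qt: "q \<in> topspace (proj_space n)" using U(1) by blast
    have "I \<subseteq> charts n (nonzero_at n q)" using U(2)[OF q] by (auto simp: standard_open_def)
    then have "monomials I \<subseteq> nonzero_at n q" using monomials_subset hprime_nonzero_at[OF qt] by blast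
    then show "q \<in> V" using open_specialization[OF V(1,2) qt] p(2) by simp
  qed
  then show ?thesis using that fraction_on_subset[OF V(3)] by blast
qed

definition ratio :: "'m \<Rightarrow> nat \<Rightarrow> nat \<Rightarrow> int \<Rightarrow> 'm laurent" where
  "ratio c i j k = Poly_Mapping.single 0 c * (xpow i k * xpow j (- k))"

lemma single_pair:
  assumes "Poly_Mapping.keys a \<subseteq> {i, j}" "i \<noteq> j"
  shows "Poly_Mapping.single a (c::'m) = Poly_Mapping.single 0 c * (xpow i (Poly_Mapping.lookup a i) * xpow j (Poly_Mapping.lookup a j))"
proof -
  have "Poly_Mapping.single a (1::'m) = xpow i (Poly_Mapping.lookup a i) * xpow j (Poly_Mapping.lookup a j)"
    using single_as_product[of "{i, j}" a] assms by simp
  moreover have "Poly_Mapping.single a c = Poly_Mapping.single 0 c * Poly_Mapping.single a 1" by (simp add: mult_single)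
  ultimately show ?thesis by simp
qed

text \<open>Write s = a/f and t = b/g on the whole intersection. At the point of {i, j} the relation
  s t = 1 becomes a b = f g, a monomial, so a is a monomial like f. Both involve only x_i and x_j
  and have the same degree, which leaves c (x_i/x_j)^k as their quotient.\<close>

lemma unit_section_is_ratio:
  fixes s t :: "'m fsection"
  assumes ij: "i \<le> n" "j \<le> n" "i \<noteq> j"
    and s: "s \<in> fsections n 0 (standard_open n i \<inter> standard_open n j)"
    and t: "t \<in> fsections n 0 (standard_open n i \<inter> standard_open n j)"
    and inv: "fprod n (standard_open n i \<inter> standard_open n j) s t =
      (\<lambda>p\<in>standard_open n i \<inter> standard_open n j. fr (denoms n p) 1 1)"
  shows "\<exists>c k. c \<noteq> 0 \<and> (\<forall>q\<in>standard_open n i \<inter> standard_open n j. s q = fr (denoms n q) (ratio c i j k) 1)"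
proof -
  let ?U = "standard_open n i \<inter> standard_open n j" and ?T = "monomials {i, j} :: 'm laurent set"
  have I: "{i, j} \<subseteq> {..n}" "{i, j} \<noteq> {}" using ij by auto
  obtain p :: "'m ppoint" where p: "p \<in> topspace (proj_space n)" "nonzero_at n p = ?T"
    "\<forall>l\<in>{i, j}. p \<in> standard_open n l" by (rule monomial_point[OF I])
  have pU: "p \<in> ?U" using p(3) by simp
  have Ut: "?U \<subseteq> topspace (proj_space n)" by (auto simp: standard_open_def)
  obtain a f where af: "fraction_on n 0 ?U a f s"
    by (rule fsection_constant_fraction[OF s pU p(2) Ut]) auto
  obtain b g where bg: "fraction_on n 0 ?U b g t"
    by (rule fsection_constant_fraction[OF t pU p(2) Ut]) auto
  obtain e where e: "a \<in> hom_loc n {} e" "f \<in> hom_loc n {} e" using af by (auto simp: fraction_on_def)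
  obtain e' where e': "b \<in> hom_loc n {} e'" "g \<in> hom_loc n {} e'" using bg by (auto simp: fraction_on_def)
  interpret hprime n ?T by (rule hprime_monomials[OF I])
  have fg: "f \<in> ?T" "g \<in> ?T" using af bg pU p(2) by (auto simp: fraction_on_def)
  have fgs: "f \<in> sat ?T" "g \<in> sat ?T" using fg by (auto intro: mem_sat)
  have "fr_mult (denoms n p) (s p) (t p) = fr (denoms n p) 1 1"
    using fun_cong[OF inv, of p] pU by simp
  then have "fr (sat ?T) (a * b) (f * g) = fr (sat ?T) 1 1"
    using af bg pU sat.fr_mult_eq[OF fgs] by (auto simp: fraction_on_def p(2))
  then obtain u where u: "u \<in> sat ?T" "u * 1 * (a * b) = u * (f * g) * 1"
    using sat.fr_eq_iff[OF sat_mult[OF fgs] one_sat] by blast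
  \<comment> \<open>Here the witness u disappears, which is possible only because the fractions are
    read at the monomial point.\<close>
  then have "a * b = f * g" using monomial_cancel[OF I u(1)] by simp
  then have "a * b \<in> ?T" using mult_mem[OF fg] by simp
  then have "a \<in> ?T" using mult_iff[OF e(1) e'(1)] by simp
  then obtain \<alpha> where \<alpha>: "Poly_Mapping.keys a = {\<alpha>}" "Poly_Mapping.keys \<alpha> \<subseteq> {i, j}" by (auto simp: monomials_def)
  obtain \<gamma> where \<gamma>: "Poly_Mapping.keys f = {\<gamma>}" "Poly_Mapping.keys \<gamma> \<subseteq> {i, j}" using fg(1) by (auto simp: monomials_def)
  define x where "x = Poly_Mapping.lookup a \<alpha>"
  define y where "y = Poly_Mapping.lookup f \<gamma>"
  have xy: "x \<noteq> 0" "y \<noteq> 0" using \<alpha>(1) \<gamma>(1) by (auto simp: x_def y_def in_keys_iff)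
  obtain z where z: "y * z = 1" using unit[OF xy(2)] by blast
  have deg: "(\<Sum>l\<le>n. Poly_Mapping.lookup \<beta> l) = Poly_Mapping.lookup \<beta> i + Poly_Mapping.lookup \<beta> j"
    if "Poly_Mapping.keys \<beta> \<subseteq> {i, j}" for \<beta> :: "nat \<Rightarrow>\<^sub>0 int"
  proof -
    have "(\<Sum>l\<le>n. Poly_Mapping.lookup \<beta> l) = (\<Sum>l\<in>{i, j}. Poly_Mapping.lookup \<beta> l)"
      using that I(1) by (intro sum.mono_neutral_right) (auto simp: in_keys_iff)
    then show ?thesis using ij(3) by simp
  qed
  \<comment> \<open>Equal total degrees force the exponent of x_j to change by -k when that of x_i
    changes by k.\<close>
  define k where "k = Poly_Mapping.lookup \<alpha> i - Poly_Mapping.lookup \<gamma> i"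
  have "Poly_Mapping.lookup \<alpha> i + Poly_Mapping.lookup \<alpha> j = e" "Poly_Mapping.lookup \<gamma> i + Poly_Mapping.lookup \<gamma> j = e"
    using e \<alpha> \<gamma> deg[OF \<alpha>(2)] deg[OF \<gamma>(2)] by (auto simp: hom_loc_def)
  then have k: "Poly_Mapping.lookup \<alpha> i = Poly_Mapping.lookup \<gamma> i + k" "Poly_Mapping.lookup \<alpha> j = Poly_Mapping.lookup \<gamma> j + - k"
    by (simp_all add: k_def)
  have "a = Poly_Mapping.single \<alpha> x" using single_of_keys[OF \<alpha>(1)] by (simp add: x_def)
  also have "\<dots> = Poly_Mapping.single 0 x *
      (xpow i (Poly_Mapping.lookup \<gamma> i + k) * xpow j (Poly_Mapping.lookup \<gamma> j + - k))"
    unfolding single_pair[OF \<alpha>(2) ij(3)] k ..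
  \<comment> \<open>The factor y z = 1 is inserted so that f, with its coefficient y, can be split
    off from a.\<close>
  also have "\<dots> = Poly_Mapping.single 0 (y * (z * x)) *
      (xpow i (Poly_Mapping.lookup \<gamma> i + k) * xpow j (Poly_Mapping.lookup \<gamma> j + - k))"
    using z by (simp flip: mult.assoc)
  also have "\<dots> = (Poly_Mapping.single 0 y * (xpow i (Poly_Mapping.lookup \<gamma> i) * xpow j (Poly_Mapping.lookup \<gamma> j))) * ratio (z * x) i j k"
  proof -
    have "Poly_Mapping.single 0 (y * (z * x)) = (Poly_Mapping.single 0 y * Poly_Mapping.single 0 (z * x) :: 'm laurent)"
      by (simp add: mult_single)
    then show ?thesis unfolding ratio_def xpow_add[symmetric] by (simp only: mult.assoc mult.left_commute)
  qed
  also have "\<dots> = f * ratio (z * x) i j k"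
    using single_of_keys[OF \<gamma>(1)] single_pair[OF \<gamma>(2) ij(3), of y] by (simp add: y_def)
  finally have a: "a = f * ratio (z * x) i j k" .
  have "z * x \<noteq> 0" using z xy(1) mult_nonzero by (metis mult_zero_right zero_neq_one)
  moreover have "s q = fr (denoms n q) (ratio (z * x) i j k) 1" if q: "q \<in> ?U" for q
  proof -
    interpret q: hprime n "nonzero_at n q" using q Ut hprime_nonzero_at by blast
    have "f \<in> denoms n q" "s q = fr (denoms n q) a f" using af q q.mem_sat by (auto simp: fraction_on_def)
    then show ?thesis using q.sat.fr_expand[OF q.one_sat, of f "ratio (z * x) i j k"] by (simp add: a)
  qed
  ultimately show ?thesis by blast
qed

end

section \<open>Sheaves that are free of rank one on the standard open sets\<close>

abbreviation fone :: "nat \<Rightarrow> 'm::comm_semiring_1 ppoint set \<Rightarrow> 'm fsection" where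
  "fone n U \<equiv> \<lambda>p\<in>U. fr (denoms n p) 1 1"

lemma fsections_one:
  assumes U: "openin (proj_space n) U" shows "fone n U \<in> fsections n 0 U"
proof -
  have "1 \<in> nonzero_at n q" if "q \<in> U" for q
    using hprime.one_mem[OF hprime_nonzero_at[OF open_points[OF U that]]] .
  then show ?thesis
    by (intro fraction_on_fsections[OF U, of _ 0 1 1]) (auto simp: fraction_on_def intro!: exI[of _ 0])
qed

lemma to_charts_one:
  assumes U: "openin (proj_space n) U"
  shows "to_charts n 0 U (fone n U) = \<one>\<^bsub>sec (proj_sheaf n) U\<^esub>"
proof -
  have "fone n U (ppoint n (i, P)) \<inter> chart_pairs n {i} 0 P = \<one>\<^bsub>loc_ring (chart_ring n {i}) (hom_loc n {i} 0 - P)\<^esub>"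
    if i: "i \<le> n" "P \<in> chart_part n i U" for i P
  proof -
    note c = chart_partD[OF i]
    interpret hprime n "nonzero_at n (ppoint n (i, P))" by (rule c(4))
    have "frac (chart_ring n {i}) T (regular (chart_ring n {i})) = frac (chart_ring n {i}) T (chart_module n 0 {i})"
      for T :: "'a laurent set"
      by (simp add: frac_def regular_def chart_ring_def chart_module_def fun_eq_iff)
    then show ?thesis
      using frac_eq_fr[OF c(5), of 1 1 0] c(1) chart_pairs_iff[of 1 1 "{i}" 0] one_sat unfolding c(6)
      by (simp add: loc_ring_def Let_def)
  qed
  then show ?thesis
    by (auto simp: to_charts_def proj_sheaf_def Spec_sheaf_def Let_def intro!: restrict_ext)
qed

lemma proj_sheaf_res_one:
  assumes "V \<subseteq> U" shows "res (proj_sheaf n) U V \<one>\<^bsub>sec (proj_sheaf n) U\<^esub> = \<one>\<^bsub>sec (proj_sheaf n) V\<^esub>"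
proof -
  have "P \<in> chart_part n i U" if "P \<in> chart_part n i V" for i P
    using that chart_part_open_subset[OF assms] by blast
  then show ?thesis by (auto simp: proj_sheaf_def Spec_sheaf_def Let_def restrict_def fun_eq_iff)
qed

text \<open>The generator \<open>e i\<close> over D(x_i) is required to remain a generator over
  every smaller open set, so that coordinates exist uniquely there and commute with
  restriction.\<close>

locale trivialized_sheaf =
  fixes n :: nat and L :: "('m::comm_semiring_1 ppoint, 'm psection, 's) mod_presheaf" and e :: "nat \<Rightarrow> 's"
  assumes L: "sheaf_of_semimodules (proj_space n) (proj_sheaf n) L"
    and e: "i \<le> n \<Longrightarrow> e i \<in> carrier (sec L (standard_open n i))"
    and free: "\<lbrakk>i \<le> n; openin (proj_space n) V; V \<subseteq> standard_open n i\<rbrakk> \<Longrightarrow>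
      bij_betw (\<lambda>a. a \<odot>\<^bsub>sec L V\<^esub> res L (standard_open n i) V (e i))
        (carrier (sec (proj_sheaf n) V)) (carrier (sec L V))"
begin

text \<open>The section of \<open>L\<close> with coordinate \<open>a\<close> with respect to
  \<open>e i\<close>. Coordinates are functions, so those of sections of \<open>L\<close> and those
  of sections of O(d) can be compared directly.\<close>

definition act :: "'m ppoint set \<Rightarrow> nat \<Rightarrow> 'm fsection \<Rightarrow> 's" where
  "act V i a = to_charts n 0 V a \<odot>\<^bsub>sec L V\<^esub> res L (standard_open n i) V (e i)"

lemma L_semimodule: "openin (proj_space n) V \<Longrightarrow> semimodule (sec (proj_sheaf n) V) (sec L V)"
  and L_res_zero: "\<lbrakk>openin (proj_space n) U; openin (proj_space n) V; V \<subseteq> U\<rbrakk> \<Longrightarrow> res L U V \<zero>\<^bsub>sec L U\<^esub> = \<zero>\<^bsub>sec L V\<^esub>"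
  and L_res_add: "\<lbrakk>openin (proj_space n) U; openin (proj_space n) V; V \<subseteq> U; s \<in> carrier (sec L U); t \<in> carrier (sec L U)\<rbrakk> \<Longrightarrow>
    res L U V (s \<oplus>\<^bsub>sec L U\<^esub> t) = res L U V s \<oplus>\<^bsub>sec L V\<^esub> res L U V t"
  and L_res_smult: "\<lbrakk>openin (proj_space n) U; openin (proj_space n) V; V \<subseteq> U; a \<in> carrier (sec (proj_sheaf n) U);
    s \<in> carrier (sec L U)\<rbrakk> \<Longrightarrow> res L U V (a \<odot>\<^bsub>sec L U\<^esub> s) = res (proj_sheaf n) U V a \<odot>\<^bsub>sec L V\<^esub> res L U V s"
  and L_sheaf: "is_sheaf (proj_space n) L"
  using L unfolding sheaf_of_semimodules_def by simp_all

lemma L_res: "\<lbrakk>openin (proj_space n) U; openin (proj_space n) V; V \<subseteq> U; s \<in> carrier (sec L U)\<rbrakk> \<Longrightarrow>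
    res L U V s \<in> carrier (sec L V)"
  and L_res_res: "\<lbrakk>openin (proj_space n) U; openin (proj_space n) V; openin (proj_space n) W; W \<subseteq> V; V \<subseteq> U;
    s \<in> carrier (sec L U)\<rbrakk> \<Longrightarrow> res L V W (res L U V s) = res L U W s"
  using L_sheaf by (auto simp: is_sheaf_def is_presheaf_def Pi_iff)

lemma L_glue:
  assumes "\<forall>U\<in>\<U>. openin (proj_space n) U" "\<forall>U\<in>\<U>. s U \<in> carrier (sec L U)"
    "\<forall>U\<in>\<U>. \<forall>V\<in>\<U>. res L U (U \<inter> V) (s U) = res L V (U \<inter> V) (s V)"
  shows "\<exists>!t. t \<in> carrier (sec L (\<Union>\<U>)) \<and> (\<forall>U\<in>\<U>. res L (\<Union>\<U>) U t = s U)"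
  using conjunct2[OF L_sheaf[unfolded is_sheaf_def]] assms by (elim allE impE) assumption+

lemma e_res: "i \<le> n \<Longrightarrow> openin (proj_space n) V \<Longrightarrow> V \<subseteq> standard_open n i \<Longrightarrow>
    res L (standard_open n i) V (e i) \<in> carrier (sec L V)"
  using L_res openin_standard_open e by blast

lemma to_charts_closed: "openin (proj_space n) V \<Longrightarrow> a \<in> fsections n 0 V \<Longrightarrow> to_charts n 0 V a \<in> carrier (sec (proj_sheaf n) V)"
  by (simp add: carrier_proj_sheaf to_charts_glued)

lemma act_bij:
  assumes "i \<le> n" "openin (proj_space n) V" "V \<subseteq> standard_open n i"
  shows "bij_betw (act V i) (fsections n 0 V) (carrier (sec L V))"
  using bij_betw_trans[OF to_charts_bij[OF assms(2), of 0] free[OF assms, unfolded carrier_proj_sheaf]]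
  by (simp add: act_def[abs_def] comp_def)

context
  fixes i :: nat and V :: "'m ppoint set"
  assumes i: "i \<le> n" and V: "openin (proj_space n) V" "V \<subseteq> standard_open n i"
begin

interpretation M: semimodule "sec (proj_sheaf n) V" "sec L V" by (rule L_semimodule[OF V(1)])

lemma act_closed: "a \<in> fsections n 0 V \<Longrightarrow> act V i a \<in> carrier (sec L V)"
  using bij_betwE[OF act_bij[OF i V]] by blast

lemma act_inj: "act V i a = act V i b \<Longrightarrow> a \<in> fsections n 0 V \<Longrightarrow> b \<in> fsections n 0 V \<Longrightarrow> a = b"
  using act_bij[OF i V] by (auto simp: bij_betw_def dest: inj_onD)

lemma act_surj: "s \<in> carrier (sec L V) \<Longrightarrow> \<exists>a\<in>fsections n 0 V. s = act V i a"
  using act_bij[OF i V] unfolding bij_betw_def by blast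

lemma act_add:
  assumes "a \<in> fsections n 0 V" "b \<in> fsections n 0 V"
  shows "act V i (fsum n V a b) = act V i a \<oplus>\<^bsub>sec L V\<^esub> act V i b"
  unfolding act_def to_charts_add[OF V(1) assms] proj_sheaf_twisting(2)[symmetric]
  by (rule M.smult_l_distr[OF to_charts_closed[OF V(1) assms(1)] to_charts_closed[OF V(1) assms(2)] e_res[OF i V]])

lemma act_zero: "act V i (fzero n V) = \<zero>\<^bsub>sec L V\<^esub>"
  unfolding act_def to_charts_zero[OF V(1)] proj_sheaf_twisting(3)[symmetric]
  by (rule M.smult_zero_left[OF e_res[OF i V]])

lemma smult_act:
  assumes "a \<in> fsections n 0 V" "b \<in> fsections n 0 V"
  shows "to_charts n 0 V a \<odot>\<^bsub>sec L V\<^esub> act V i b = act V i (fprod n V a b)"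
  unfolding act_def to_charts_smult[OF V(1) assms] proj_sheaf_twisting(1)[symmetric]
  by (rule M.smult_assoc[OF to_charts_closed[OF V(1) assms(1)] to_charts_closed[OF V(1) assms(2)] e_res[OF i V], symmetric])

lemma act_res:
  assumes W: "openin (proj_space n) W" "W \<subseteq> V" and a: "a \<in> fsections n 0 V"
  shows "res L V W (act V i a) = act W i (restrict a W)"
  using L_res_smult[OF V(1) W to_charts_closed[OF V(1) a] e_res[OF i V]] V(1)
    L_res_res[OF openin_standard_open V(1) W(1,2) V(2) e[OF i]] to_charts_res[OF W(2), of n 0 a]
  by (simp add: act_def proj_sheaf_twisting(4))

end

text \<open>The graph of the intended isomorphism, which sends a e_i to a g_i over D(x_i). As a
  relation it can be treated symmetrically in \<open>s\<close> and \<open>h\<close>.\<close>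

definition same_coords :: "int \<Rightarrow> (nat \<Rightarrow> 'm fsection) \<Rightarrow> 'm ppoint set \<Rightarrow> 's \<Rightarrow> 'm fsection \<Rightarrow> bool" where
  "same_coords d g U s h \<longleftrightarrow> s \<in> carrier (sec L U) \<and> h \<in> fsections n d U \<and>
    (\<forall>i\<le>n. \<exists>a\<in>fsections n 0 (U \<inter> standard_open n i).
      res L U (U \<inter> standard_open n i) s = act (U \<inter> standard_open n i) i a \<and>
      restrict h (U \<inter> standard_open n i) = fprod n (U \<inter> standard_open n i) a (g i))"

end

lemma standard_open_cover:
  assumes "openin (proj_space n) U" "p \<in> U"
  obtains i where "i \<le> n" "p \<in> standard_open n i"
proof -
  have pt: "p \<in> topspace (proj_space n)" by (rule open_points[OF assms])
  obtain i where "i \<in> charts n (nonzero_at n p)"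
    using hprime.charts_nonempty[OF hprime_nonzero_at[OF pt]] by blast
  then show ?thesis using that[of i] pt by (auto simp: standard_open_def charts_def)
qed

text \<open>The functions \<open>g i\<close> generate O(d) over D(x_i), and \<open>matching\<close>
  says that the families \<open>e\<close> and \<open>g\<close> have the same transition functions,
  expressed without naming these.\<close>

locale matching_generators = trivialized_sheaf n L e
  for n :: nat and L :: "('m::comm_semiring_1 ppoint, 'm psection, 's) mod_presheaf" and e :: "nat \<Rightarrow> 's" +
  fixes d :: int and g :: "nat \<Rightarrow> 'm fsection"
  assumes g: "i \<le> n \<Longrightarrow> g i \<in> fsections n d (standard_open n i)"
    and g_bij: "\<lbrakk>i \<le> n; openin (proj_space n) V; V \<subseteq> standard_open n i\<rbrakk> \<Longrightarrow>
      bij_betw (\<lambda>a. fprod n V a (g i)) (fsections n 0 V) (fsections n d V)"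
    and matching: "\<lbrakk>i \<le> n; j \<le> n; openin (proj_space n) V; V \<subseteq> standard_open n i; V \<subseteq> standard_open n j;
      a \<in> fsections n 0 V; b \<in> fsections n 0 V\<rbrakk> \<Longrightarrow>
      act V i a = act V j b \<longleftrightarrow> fprod n V a (g i) = fprod n V b (g j)"
begin

abbreviation coords where "coords \<equiv> same_coords d g"

lemma open_part: "openin (proj_space n) U \<Longrightarrow> openin (proj_space n) (U \<inter> standard_open n i)"
  using openin_standard_open by blast

lemma g_restrict: "i \<le> n \<Longrightarrow> openin (proj_space n) V \<Longrightarrow> V \<subseteq> standard_open n i \<Longrightarrow> restrict (g i) V \<in> fsections n d V"
  using fsections_restrict g by blast

lemma fprod_restrict_right: "fprod n V a (restrict b V) = fprod n V a b"
  by (intro restrict_ext) simp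

lemma g_inj: "\<lbrakk>i \<le> n; openin (proj_space n) V; V \<subseteq> standard_open n i; a \<in> fsections n 0 V; b \<in> fsections n 0 V;
    fprod n V a (g i) = fprod n V b (g i)\<rbrakk> \<Longrightarrow> a = b"
  using g_bij[of i V] by (auto simp: bij_betw_def dest: inj_onD)

lemma restrict_to: "W \<subseteq> V \<Longrightarrow> restrict h V = fprod n V a b \<Longrightarrow> restrict h W = fprod n W (restrict a W) b"
  by (smt (verit) restrict_apply' restrict_ext subsetD)

text \<open>The value of h at a point is computed with an arbitrarily selected chart;
  \<open>matching\<close> shows that every chart gives the same value, and being a section of O(d)
  is a local condition.\<close>

lemma coords_ex1_section:
  assumes U: "openin (proj_space n) U" and s: "s \<in> carrier (sec L U)"
  shows "\<exists>h. coords U s h"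
proof -
  have "\<exists>a\<in>fsections n 0 (U \<inter> standard_open n i). res L U (U \<inter> standard_open n i) s = act (U \<inter> standard_open n i) i a"
    if "i \<le> n" for i
    using act_surj[OF that open_part[OF U] _ L_res[OF U open_part[OF U] _ s]] by blast
  then have "\<forall>i. \<exists>a. i \<le> n \<longrightarrow> a \<in> fsections n 0 (U \<inter> standard_open n i) \<and>
      res L U (U \<inter> standard_open n i) s = act (U \<inter> standard_open n i) i a"
    by blast
  from choice[OF this] obtain a where "\<forall>i. i \<le> n \<longrightarrow> a i \<in> fsections n 0 (U \<inter> standard_open n i) \<and>
      res L U (U \<inter> standard_open n i) s = act (U \<inter> standard_open n i) i (a i)" ..
  then have a: "a i \<in> fsections n 0 (U \<inter> standard_open n i)"
    "res L U (U \<inter> standard_open n i) s = act (U \<inter> standard_open n i) i (a i)" if "i \<le> n" for i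
    using that by blast+
  define c where "c p = (SOME i. i \<le> n \<and> p \<in> standard_open n i)" for p :: "'m ppoint"
  have c: "c p \<le> n \<and> p \<in> standard_open n (c p)" if "p \<in> U" for p
    unfolding c_def using standard_open_cover[OF U that] by (rule someI_ex) blast
  define h where "h = (\<lambda>p\<in>U. fr_mult (denoms n p) (a (c p) p) (g (c p) p))"
  \<comment> \<open>Over the common part of both charts the two coordinates belong to the same
    section of \<open>L\<close>, so \<open>matching\<close> equates their products with the
    generators.\<close>
  have val: "h p = fr_mult (denoms n p) (a i p) (g i p)" if i: "i \<le> n" and p: "p \<in> U" "p \<in> standard_open n i" for i p
  proof -
    let ?j = "c p"
    have j: "?j \<le> n" "p \<in> standard_open n ?j" using c[OF p(1)] by auto
    let ?W = "U \<inter> standard_open n i \<inter> standard_open n ?j"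
    have W: "openin (proj_space n) ?W" "?W \<subseteq> standard_open n i" "?W \<subseteq> standard_open n ?j"
      "?W \<subseteq> U \<inter> standard_open n i" "?W \<subseteq> U \<inter> standard_open n ?j"
      using open_part[OF open_part[OF U]] by auto
    have "act ?W k (restrict (a k) ?W) = res L U ?W s" if k: "k = i \<or> k = ?j" for k
    proof -
      have k': "k \<le> n" "?W \<subseteq> U \<inter> standard_open n k" using k i j W by auto
      have "act ?W k (restrict (a k) ?W) = res L (U \<inter> standard_open n k) ?W (res L U (U \<inter> standard_open n k) s)"
        using act_res[OF k'(1) open_part[OF U] _ W(1) k'(2) a(1)[OF k'(1)]] a(2)[OF k'(1)] by simp
      also have "\<dots> = res L U ?W s" using L_res_res[OF U open_part[OF U] W(1) k'(2) _ s] by simp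
      finally show ?thesis .
    qed
    then have "act ?W i (restrict (a i) ?W) = act ?W ?j (restrict (a ?j) ?W)" by simp
    then have "fprod n ?W (restrict (a i) ?W) (g i) = fprod n ?W (restrict (a ?j) ?W) (g ?j)"
      using matching[OF i j(1) W(1-3) fsections_restrict[OF a(1)[OF i] W(1,4)] fsections_restrict[OF a(1)[OF j(1)] W(1,5)]]
      by simp
    from fun_cong[OF this, of p] show ?thesis using p j by (simp add: h_def)
  qed
  have loc: "restrict h (U \<inter> standard_open n i) = fprod n (U \<inter> standard_open n i) (a i) (g i)" if "i \<le> n" for i
    using val[OF that] by (intro restrict_ext) simp
  have "h \<in> fsections n d U"
  proof (rule fsections_localI)
    fix p assume p: "p \<in> U"
    obtain i where i: "i \<le> n" "p \<in> standard_open n i" by (rule standard_open_cover[OF U p])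
    have "restrict h (U \<inter> standard_open n i) \<in> fsections n d (U \<inter> standard_open n i)"
      unfolding loc[OF i(1)] using bij_betwE[OF g_bij[OF i(1) open_part[OF U]]] a(1)[OF i(1)] by simp
    then show "\<exists>V. openin (proj_space n) V \<and> p \<in> V \<and> V \<subseteq> U \<and> restrict h V \<in> fsections n d V"
      using open_part[OF U] p i by blast
  qed (simp add: h_def)
  then show ?thesis using s a loc unfolding same_coords_def by blast
qed

lemma coords_unique_section:
  assumes U: "openin (proj_space n) U" and h: "coords U s h" "coords U s h'"
  shows "h = h'"
proof (rule extensionalityI[of _ U])
  show "h \<in> extensional U" "h' \<in> extensional U" using h fsections_ext by (auto simp: same_coords_def)
  fix p assume p: "p \<in> U"
  obtain i where i: "i \<le> n" "p \<in> standard_open n i" by (rule standard_open_cover[OF U p])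
  let ?V = "U \<inter> standard_open n i"
  obtain a where a: "a \<in> fsections n 0 ?V" "res L U ?V s = act ?V i a" "restrict h ?V = fprod n ?V a (g i)"
    using h(1) i(1) unfolding same_coords_def by blast
  obtain b where b: "b \<in> fsections n 0 ?V" "res L U ?V s = act ?V i b" "restrict h' ?V = fprod n ?V b (g i)"
    using h(2) i(1) unfolding same_coords_def by blast
  have "a = b" using act_inj[OF i(1) open_part[OF U] _ _ a(1) b(1)] a(2) b(2) by simp
  then have "restrict h ?V = restrict h' ?V" using a(3) b(3) by simp
  then show "h p = h' p" using p i by (metis IntI restrict_apply')
qed

text \<open>In this direction the pieces a_i e_i are glued in \<open>L\<close>. They agree on
  overlaps because the products a_i g_i do, both being restrictions of h.\<close>

lemma coords_ex_preimage:
  assumes U: "openin (proj_space n) U" and h: "h \<in> fsections n d U"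
  shows "\<exists>s. coords U s h"
proof -
  let ?V = "\<lambda>i. U \<inter> standard_open n i"
  have "\<exists>a\<in>fsections n 0 (?V i). restrict h (?V i) = fprod n (?V i) a (g i)" if "i \<le> n" for i
  proof -
    have "restrict h (?V i) \<in> fsections n d (?V i)" using fsections_restrict[OF h open_part[OF U]] by simp
    then have "restrict h (?V i) \<in> (\<lambda>a. fprod n (?V i) a (g i)) ` fsections n 0 (?V i)"
      using g_bij[OF that open_part[OF U]] by (simp add: bij_betw_def)
    then show ?thesis by blast
  qed
  then have "\<forall>i. \<exists>a. i \<le> n \<longrightarrow> a \<in> fsections n 0 (?V i) \<and> restrict h (?V i) = fprod n (?V i) a (g i)"
    by blast
  from choice[OF this] obtain a where "\<forall>i. i \<le> n \<longrightarrow> a i \<in> fsections n 0 (?V i) \<and>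
      restrict h (?V i) = fprod n (?V i) (a i) (g i)" ..
  then have a: "a i \<in> fsections n 0 (?V i)" "restrict h (?V i) = fprod n (?V i) (a i) (g i)" if "i \<le> n" for i
    using that by blast+
  define S where "S = ?V ` {..n}"
  \<comment> \<open>The gluing axiom indexes sections by open sets, and different charts may meet U
    in the same set, so one index has to be fixed for each set.\<close>
  define c where "c W = (SOME i. i \<le> n \<and> W = ?V i)" for W
  have c: "c W \<le> n" "W = ?V (c W)" if "W \<in> S" for W
  proof -
    have "\<exists>i. i \<le> n \<and> W = ?V i" using that by (auto simp: S_def)
    then have "c W \<le> n \<and> W = ?V (c W)" unfolding c_def by (rule someI_ex)
    then show "c W \<le> n" "W = ?V (c W)" by auto
  qed
  define s where "s W = act W (c W) (a (c W))" for W
  have un: "\<Union>S = U" using standard_open_cover[OF U] by (auto simp: S_def)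
  have S: "openin (proj_space n) W" "s W \<in> carrier (sec L W)" if W: "W \<in> S" for W
  proof -
    show "openin (proj_space n) W" using W open_part[OF U] by (auto simp: S_def)
    have "act (?V (c W)) (c W) (a (c W)) \<in> carrier (sec L (?V (c W)))"
      using act_closed[OF c(1)[OF W] open_part[OF U] _ a(1)[OF c(1)[OF W]]] by simp
    then show "s W \<in> carrier (sec L W)" unfolding s_def using c(2)[OF W] by metis
  qed
  have ov: "res L W (W \<inter> W') (s W) = res L W' (W \<inter> W') (s W')" if W: "W \<in> S" "W' \<in> S" for W W'
  proof -
    let ?i = "c W" and ?j = "c W'"
    note i = c[OF W(1)] and j = c[OF W(2)]
    have o: "openin (proj_space n) (W \<inter> W')" "W \<inter> W' \<subseteq> standard_open n ?i" "W \<inter> W' \<subseteq> standard_open n ?j"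
      "W \<subseteq> standard_open n ?i" "W' \<subseteq> standard_open n ?j"
      using S(1)[OF W(1)] S(1)[OF W(2)] i j by auto
    have aW: "a ?i \<in> fsections n 0 W" "a ?j \<in> fsections n 0 W'"
      "restrict h W = fprod n W (a ?i) (g ?i)" "restrict h W' = fprod n W' (a ?j) (g ?j)"
      using a[OF i(1)] a[OF j(1)] i(2) j(2) by auto
    have r: "res L W (W \<inter> W') (s W) = act (W \<inter> W') ?i (restrict (a ?i) (W \<inter> W'))"
      "res L W' (W \<inter> W') (s W') = act (W \<inter> W') ?j (restrict (a ?j) (W \<inter> W'))"
      unfolding s_def
      using act_res[OF i(1) S(1)[OF W(1)] o(4,1) _ aW(1)] act_res[OF j(1) S(1)[OF W(2)] o(5,1) _ aW(2)] by auto
    have "fprod n (W \<inter> W') (restrict (a ?i) (W \<inter> W')) (g ?i) = fprod n (W \<inter> W') (restrict (a ?j) (W \<inter> W')) (g ?j)"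
      using restrict_to[OF _ aW(3), of "W \<inter> W'"] restrict_to[OF _ aW(4), of "W \<inter> W'"] by simp
    then show ?thesis
      unfolding r using matching[OF i(1) j(1) o(1-3) fsections_restrict[OF aW(1) o(1)] fsections_restrict[OF aW(2) o(1)]] by simp
  qed
  have "\<exists>!t. t \<in> carrier (sec L (\<Union>S)) \<and> (\<forall>W\<in>S. res L (\<Union>S) W t = s W)"
    using S ov by (intro L_glue) auto
  then obtain t where t: "t \<in> carrier (sec L U)" "\<And>W. W \<in> S \<Longrightarrow> res L U W t = s W" unfolding un by blast
  have "\<exists>b\<in>fsections n 0 (?V i). res L U (?V i) t = act (?V i) i b \<and> restrict h (?V i) = fprod n (?V i) b (g i)"
    if i: "i \<le> n" for i
  proof -
    have W: "?V i \<in> S" using i by (auto simp: S_def)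
    let ?W = "?V i"
    note j = c[OF W]
    have aj: "a (c ?W) \<in> fsections n 0 ?W" "restrict h ?W = fprod n ?W (a (c ?W)) (g (c ?W))"
      using a[OF j(1)] j(2) by simp_all
    have "?W \<subseteq> standard_open n (c ?W)" using j(2) by blast
    \<comment> \<open>The index selected for this set may differ from i; \<open>matching\<close>
      leads back to the coordinate in chart i.\<close>
    then have "act ?W i (a i) = act ?W (c ?W) (a (c ?W))"
      using matching[OF i j(1) open_part[OF U] _ _ a(1)[OF i] aj(1)] a(2)[OF i] aj(2) by simp
    then show ?thesis using t(2)[OF W] a[OF i] by (intro bexI[of _ "a i"]) (simp_all add: s_def)
  qed
  then show ?thesis using t(1) h unfolding same_coords_def by blast
qed

text \<open>Over each D(x_i) the product with g_i determines the coordinate, so the two sections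
  have equal restrictions and the uniqueness half of the gluing axiom applies.\<close>

lemma coords_unique_preimage:
  assumes U: "openin (proj_space n) U" and s: "coords U s h" "coords U t h"
  shows "s = t"
proof -
  let ?V = "\<lambda>i. U \<inter> standard_open n i"
  define S where "S = ?V ` {..n}"
  have un: "\<Union>S = U" using standard_open_cover[OF U] by (auto simp: S_def)
  have c: "s \<in> carrier (sec L U)" "t \<in> carrier (sec L U)" using s by (auto simp: same_coords_def)
  have eq: "res L U W s = res L U W t" if "W \<in> S" for W
  proof -
    obtain i where i: "i \<le> n" "W = ?V i" using \<open>W \<in> S\<close> by (auto simp: S_def)
    obtain a where a: "a \<in> fsections n 0 W" "res L U W s = act W i a" "restrict h W = fprod n W a (g i)"
      using s(1) i unfolding same_coords_def by blast
    obtain b where b: "b \<in> fsections n 0 W" "res L U W t = act W i b" "restrict h W = fprod n W b (g i)"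
      using s(2) i unfolding same_coords_def by blast
    have "a = b" using g_inj[OF i(1) _ _ a(1) b(1)] open_part[OF U] a(3) b(3) i(2) by simp
    then show ?thesis using a b by simp
  qed
  have o: "openin (proj_space n) W \<and> W \<subseteq> U" if "W \<in> S" for W using that open_part[OF U] by (auto simp: S_def)
  have "\<exists>!x. x \<in> carrier (sec L (\<Union>S)) \<and> (\<forall>W\<in>S. res L (\<Union>S) W x = res L U W s)"
  proof -
    have "res L W (W \<inter> W') (res L U W s) = res L W' (W \<inter> W') (res L U W' s)" if "W \<in> S" "W' \<in> S" for W W'
      using L_res_res[OF U _ _ _ _ c(1), of W "W \<inter> W'"] L_res_res[OF U _ _ _ _ c(1), of W' "W \<inter> W'"]
        o[OF that(1)] o[OF that(2)] openin_Int[of "proj_space n" W W'] by auto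
    moreover have "res L U W s \<in> carrier (sec L W)" if "W \<in> S" for W using L_res[OF U _ _ c(1)] o[OF that] by blast
    ultimately show ?thesis using o by (intro L_glue) auto
  qed
  then show ?thesis unfolding un using c eq by metis
qed

lemma coords_zero: assumes U: "openin (proj_space n) U" shows "coords U \<zero>\<^bsub>sec L U\<^esub> (fzero n U)"
  unfolding same_coords_def
proof (intro conjI allI impI)
  interpret M: semimodule "sec (proj_sheaf n) U" "sec L U" by (rule L_semimodule[OF U])
  show "\<zero>\<^bsub>sec L U\<^esub> \<in> carrier (sec L U)" by simp
  show "fzero n U \<in> fsections n d U" by (rule fsections_zero[OF U])
  fix i assume i: "i \<le> n"
  let ?V = "U \<inter> standard_open n i"
  note V = open_part[OF U, of i]
  show "\<exists>a\<in>fsections n 0 ?V. res L U ?V \<zero>\<^bsub>sec L U\<^esub> = act ?V i a \<and> restrict (fzero n U) ?V = fprod n ?V a (g i)"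
  proof (intro bexI[of _ "fzero n ?V"] conjI)
    show "res L U ?V \<zero>\<^bsub>sec L U\<^esub> = act ?V i (fzero n ?V)"
      using L_res_zero[OF U V] act_zero[OF i V] by simp
    have "fprod n ?V (fzero n ?V) (restrict (g i) ?V) = fzero n ?V"
      by (rule fprod_zero_left[OF V g_restrict[OF i V]]) simp
    then show "restrict (fzero n U) ?V = fprod n ?V (fzero n ?V) (g i)"
      unfolding fprod_restrict_right using restrict_fzero[of ?V U n] by simp
  qed (rule fsections_zero[OF V])
qed

lemma coords_add:
  assumes U: "openin (proj_space n) U" and s: "coords U s h" and t: "coords U t h'"
  shows "coords U (s \<oplus>\<^bsub>sec L U\<^esub> t) (fsum n U h h')"
  unfolding same_coords_def
proof (intro conjI allI impI)
  interpret M: semimodule "sec (proj_sheaf n) U" "sec L U" by (rule L_semimodule[OF U])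
  have c: "s \<in> carrier (sec L U)" "t \<in> carrier (sec L U)" "h \<in> fsections n d U" "h' \<in> fsections n d U"
    using s t by (auto simp: same_coords_def)
  show "s \<oplus>\<^bsub>sec L U\<^esub> t \<in> carrier (sec L U)" using c by simp
  show "fsum n U h h' \<in> fsections n d U" by (rule fsections_add[OF c(3,4)])
  fix i assume i: "i \<le> n"
  let ?V = "U \<inter> standard_open n i"
  note V = open_part[OF U, of i]
  obtain a where a: "a \<in> fsections n 0 ?V" "res L U ?V s = act ?V i a" "restrict h ?V = fprod n ?V a (g i)"
    using s i unfolding same_coords_def by blast
  obtain b where b: "b \<in> fsections n 0 ?V" "res L U ?V t = act ?V i b" "restrict h' ?V = fprod n ?V b (g i)"
    using t i unfolding same_coords_def by blast
  show "\<exists>a\<in>fsections n 0 ?V. res L U ?V (s \<oplus>\<^bsub>sec L U\<^esub> t) = act ?V i a \<and> restrict (fsum n U h h') ?V = fprod n ?V a (g i)"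
  proof (intro bexI[of _ "fsum n ?V a b"] conjI)
    show "res L U ?V (s \<oplus>\<^bsub>sec L U\<^esub> t) = act ?V i (fsum n ?V a b)"
      using L_res_add[OF U V _ c(1,2)] act_add[OF i V _ a(1) b(1)] a(2) b(2) by simp
    have "fprod n ?V (fsum n ?V a b) (restrict (g i) ?V) =
        fsum n ?V (fprod n ?V a (restrict (g i) ?V)) (fprod n ?V b (restrict (g i) ?V))"
      by (rule fprod_add_right[OF V a(1) b(1) g_restrict[OF i V]]) simp
    then show "restrict (fsum n U h h') ?V = fprod n ?V (fsum n ?V a b) (g i)"
      unfolding fprod_restrict_right using restrict_fsum[of ?V U n h h'] a(3) b(3) by simp
  qed (rule fsections_add[OF a(1) b(1)])
qed

lemma coords_smult:
  assumes U: "openin (proj_space n) U" and c: "c \<in> carrier (sec (proj_sheaf n) U)" and s: "coords U s h"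
  shows "coords U (c \<odot>\<^bsub>sec L U\<^esub> s) (fprod n U (from_charts n U c) h)"
  unfolding same_coords_def
proof (intro conjI allI impI)
  interpret M: semimodule "sec (proj_sheaf n) U" "sec L U" by (rule L_semimodule[OF U])
  have sh: "s \<in> carrier (sec L U)" "h \<in> fsections n d U" using s by (auto simp: same_coords_def)
  have c': "c \<in> glued_sections n (chart_module n 0) U" using c by (simp add: carrier_proj_sheaf)
  let ?c = "from_charts n U c"
  note fc = from_charts_fsections[OF U c']
  show "c \<odot>\<^bsub>sec L U\<^esub> s \<in> carrier (sec L U)" by (rule M.smult_closed[OF c sh(1)])
  show "fprod n U ?c h \<in> fsections n d U" using fsections_mult[OF fc sh(2)] by simp
  fix i assume i: "i \<le> n"
  let ?V = "U \<inter> standard_open n i"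
  note V = open_part[OF U, of i]
  obtain a where a: "a \<in> fsections n 0 ?V" "res L U ?V s = act ?V i a" "restrict h ?V = fprod n ?V a (g i)"
    using s i unfolding same_coords_def by blast
  have cV: "restrict ?c ?V \<in> fsections n 0 ?V" using fsections_restrict[OF fc V] by simp
  have tc: "to_charts n 0 ?V (restrict ?c ?V) = res (proj_sheaf n) U ?V c"
    using to_charts_res[of ?V U n 0 ?c] to_from_charts[OF U c'] by (simp add: proj_sheaf_twisting)
  show "\<exists>a\<in>fsections n 0 ?V. res L U ?V (c \<odot>\<^bsub>sec L U\<^esub> s) = act ?V i a \<and>
      restrict (fprod n U ?c h) ?V = fprod n ?V a (g i)"
  proof (intro bexI[of _ "fprod n ?V (restrict ?c ?V) a"] conjI)
    show "res L U ?V (c \<odot>\<^bsub>sec L U\<^esub> s) = act ?V i (fprod n ?V (restrict ?c ?V) a)"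
      using L_res_smult[OF U V _ c sh(1)] smult_act[OF i V _ cV a(1)] tc a(2) by simp
    have "restrict (fprod n U ?c h) ?V = fprod n ?V (restrict ?c ?V) (restrict h ?V)"
      by (rule restrict_fprod) simp
    also have "\<dots> = fprod n ?V (restrict ?c ?V) (fprod n ?V a (restrict (g i) ?V))"
      by (simp only: a(3) fprod_restrict_right)
    also have "\<dots> = fprod n ?V (fprod n ?V (restrict ?c ?V) a) (restrict (g i) ?V)"
      by (rule fprod_assoc[OF V cV a(1) g_restrict[OF i V], symmetric]) simp
    also have "\<dots> = fprod n ?V (fprod n ?V (restrict ?c ?V) a) (g i)" by (rule fprod_restrict_right)
    finally show "restrict (fprod n U ?c h) ?V = fprod n ?V (fprod n ?V (restrict ?c ?V) a) (g i)" .
  qed (use fsections_mult[OF cV a(1)] in simp)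
qed

lemma coords_res:
  assumes U: "openin (proj_space n) U" and W: "openin (proj_space n) W" "W \<subseteq> U" and s: "coords U s h"
  shows "coords W (res L U W s) (restrict h W)"
  unfolding same_coords_def
proof (intro conjI allI impI)
  have sh: "s \<in> carrier (sec L U)" "h \<in> fsections n d U" using s by (auto simp: same_coords_def)
  show "res L U W s \<in> carrier (sec L W)" by (rule L_res[OF U W sh(1)])
  show "restrict h W \<in> fsections n d W" by (rule fsections_restrict[OF sh(2) W])
  fix i assume i: "i \<le> n"
  let ?V = "U \<inter> standard_open n i" and ?V' = "W \<inter> standard_open n i"
  note V = open_part[OF U, of i] and V' = open_part[OF W(1), of i]
  have sub: "?V' \<subseteq> ?V" "?V' \<subseteq> W" "?V \<subseteq> U" "?V \<subseteq> standard_open n i" using W(2) by auto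
  obtain a where a: "a \<in> fsections n 0 ?V" "res L U ?V s = act ?V i a" "restrict h ?V = fprod n ?V a (g i)"
    using s i unfolding same_coords_def by blast
  show "\<exists>a\<in>fsections n 0 ?V'. res L W ?V' (res L U W s) = act ?V' i a \<and> restrict (restrict h W) ?V' = fprod n ?V' a (g i)"
  proof (intro bexI[of _ "restrict a ?V'"] conjI)
    have "res L W ?V' (res L U W s) = res L ?V ?V' (res L U ?V s)"
      using L_res_res[OF U W(1) V' sub(2) W(2) sh(1)] L_res_res[OF U V V' sub(1,3) sh(1)] by simp
    then show "res L W ?V' (res L U W s) = act ?V' i (restrict a ?V')"
      using act_res[OF i V sub(4) V' sub(1) a(1)] a(2) by simp
    have "restrict (restrict h W) ?V' = restrict h ?V'" using sub(2) by (simp add: Int_absorb1)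
    then show "restrict (restrict h W) ?V' = fprod n ?V' (restrict a ?V') (g i)"
      using restrict_to[OF sub(1) a(3)] by simp
  qed (rule fsections_restrict[OF a(1) V' sub(1)])
qed

text \<open>The relation is total and single-valued in both directions and respects zero, sums,
  scalars and restrictions, so the map defined by unique choice is an isomorphism.\<close>

theorem isomorphic_fsheaf: "sheaf_isomorphic (proj_space n) (proj_sheaf n) L (fsheaf n d)"
proof -
  define \<phi> where "\<phi> U s = (THE h. coords U s h)" for U s
  have \<phi>: "\<phi> U s = h" if "openin (proj_space n) U" "coords U s h" for U s h
    unfolding \<phi>_def using coords_unique_section[OF that(1)] that(2) by (intro the_equality) auto
  have c: "coords U s (\<phi> U s)" if U: "openin (proj_space n) U" "s \<in> carrier (sec L U)" for U s
    using coords_ex1_section[OF U] \<phi>[OF U(1)] by metis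
  have "sheaf_iso (proj_space n) (proj_sheaf n) L (fsheaf n d) \<phi>"
  proof (rule sheaf_isoI)
    fix U :: "'m ppoint set" assume U: "openin (proj_space n) U"
    show "bij_betw (\<phi> U) (carrier (sec L U)) (carrier (sec (fsheaf n d) U))"
      unfolding bij_betw_def
    proof
      show "inj_on (\<phi> U) (carrier (sec L U))"
        using c[OF U] coords_unique_preimage[OF U] by (intro inj_onI) metis
      show "\<phi> U ` carrier (sec L U) = carrier (sec (fsheaf n d) U)"
      proof (intro equalityI subsetI)
        fix h assume "h \<in> carrier (sec (fsheaf n d) U)"
        then obtain s where "coords U s h" using coords_ex_preimage[OF U] by auto
        then show "h \<in> \<phi> U ` carrier (sec L U)" using \<phi>[OF U] unfolding same_coords_def by blast
      next
        fix h assume "h \<in> \<phi> U ` carrier (sec L U)"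
        then show "h \<in> carrier (sec (fsheaf n d) U)" using c[OF U] by (auto simp: same_coords_def)
      qed
    qed
    show "\<phi> U \<zero>\<^bsub>sec L U\<^esub> = \<zero>\<^bsub>sec (fsheaf n d) U\<^esub>" using \<phi>[OF U coords_zero[OF U]] by simp
    show "\<phi> U (s \<oplus>\<^bsub>sec L U\<^esub> t) = \<phi> U s \<oplus>\<^bsub>sec (fsheaf n d) U\<^esub> \<phi> U t"
      if "s \<in> carrier (sec L U)" "t \<in> carrier (sec L U)" for s t
      using \<phi>[OF U coords_add[OF U c[OF U that(1)] c[OF U that(2)]]] by simp
    show "\<phi> U (a \<odot>\<^bsub>sec L U\<^esub> s) = a \<odot>\<^bsub>sec (fsheaf n d) U\<^esub> \<phi> U s"
      if "a \<in> carrier (sec (proj_sheaf n) U)" "s \<in> carrier (sec L U)" for a s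
      using \<phi>[OF U coords_smult[OF U that(1) c[OF U that(2)]]] by simp
    show "\<phi> V (res L U V s) = res (fsheaf n d) U V (\<phi> U s)"
      if "openin (proj_space n) V" "V \<subseteq> U" "s \<in> carrier (sec L U)" for V and s :: 's
      using \<phi>[OF that(1) coords_res[OF U that(1,2) c[OF U that(3)]]] by simp
  qed
  then show ?thesis unfolding sheaf_isomorphic_iff by blast
qed

end

section \<open>Invertible sheaves\<close>

context idempotent_semifield
begin

lemma sheaf_res_closed:
  assumes "sheaf_of_semimodules X OX F" "openin X U" "openin X V" "V \<subseteq> U" "s \<in> carrier (sec F U)"
  shows "res F U V s \<in> carrier (sec F V)"
  using assms by (simp add: sheaf_of_semimodules_def is_sheaf_def is_presheaf_def Pi_iff)

text \<open>A trivializing neighbourhood of the point at which just the powers of x_i survive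
  contains all of D(x_i). The section corresponding to 1 under the trivialization is the
  generator.\<close>

lemma invertible_generator:
  fixes L :: "('m ppoint, 'm psection, 's) mod_presheaf"
  assumes inv: "invertible_sheaf (proj_space n) (proj_sheaf n) L" and i: "i \<le> n"
  shows "\<exists>x\<in>carrier (sec L (standard_open n i)). \<forall>V. openin (proj_space n) V \<longrightarrow> V \<subseteq> standard_open n i \<longrightarrow>
      bij_betw (\<lambda>a. a \<odot>\<^bsub>sec L V\<^esub> res L (standard_open n i) V x)
        (carrier (sec (proj_sheaf n) V)) (carrier (sec L V))"
proof -
  let ?U = "standard_open n i :: 'm ppoint set"
  have L: "sheaf_of_semimodules (proj_space n) (proj_sheaf n) L" using inv by (simp add: invertible_sheaf_def)
  have I: "{i} \<subseteq> {..n}" "{i} \<noteq> {}" using i by auto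
  obtain p :: "'m ppoint" where p: "p \<in> topspace (proj_space n)" "nonzero_at n p = monomials {i}"
    by (rule monomial_point[OF I])
  obtain W where W: "openin (proj_space n) W" "p \<in> W"
    "sheaf_isomorphic (subtopology (proj_space n) W) (proj_sheaf n) L (regular_sheaf (proj_sheaf n))"
    using bspec[OF conjunct2[OF inv[unfolded invertible_sheaf_def]] p(1)] by (elim exE conjE) (rule that)
  have UW: "?U \<subseteq> W"
  proof
    fix q :: "'m ppoint" assume "q \<in> ?U"
    then have q: "q \<in> topspace (proj_space n)" "{i} \<subseteq> charts n (nonzero_at n q)" by (auto simp: standard_open_def)
    then have "monomials {i} \<subseteq> nonzero_at n q" using monomials_subset[OF hprime_nonzero_at] by blast
    then show "q \<in> W" using open_specialization[OF W(1,2) q(1)] p(2) by simp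
  qed
  obtain \<phi> where \<phi>: "sheaf_iso (subtopology (proj_space n) W) (proj_sheaf n) L (regular_sheaf (proj_sheaf n)) \<phi>"
    using W(3) unfolding sheaf_isomorphic_iff ..
  have oW: "openin (subtopology (proj_space n) W) V" if "openin (proj_space n) V" "V \<subseteq> ?U" for V
    using that UW openin_open_subtopology[OF W(1)] by blast
  note oU = oW[OF openin_standard_open subset_refl]
  have reg: "carrier (sec (regular_sheaf (proj_sheaf n)) V) = carrier (sec (proj_sheaf n) V)"
    "a \<odot>\<^bsub>sec (regular_sheaf (proj_sheaf n)) V\<^esub> b = a \<otimes>\<^bsub>sec (proj_sheaf n) V\<^esub> b"
    "res (regular_sheaf (proj_sheaf n)) V V' a = res (proj_sheaf n) V V' a" for V V' a b
    by (simp_all add: regular_sheaf_def regular_def)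
  have one: "\<one>\<^bsub>sec (proj_sheaf n) ?U\<^esub> \<in> carrier (sec (proj_sheaf n) ?U)"
    unfolding to_charts_one[OF openin_standard_open, symmetric] carrier_proj_sheaf
    by (rule to_charts_glued[OF openin_standard_open fsections_one[OF openin_standard_open]])
  have "\<one>\<^bsub>sec (proj_sheaf n) ?U\<^esub> \<in> \<phi> ?U ` carrier (sec L ?U)"
    using bij_betw_imp_surj_on[OF sheaf_isoD(1)[OF \<phi> oU, unfolded reg]] one by (simp only:)
  then obtain x where x: "x \<in> carrier (sec L ?U)" "\<phi> ?U x = \<one>\<^bsub>sec (proj_sheaf n) ?U\<^esub>"
    by (rule imageE) (rule that, assumption, rule HOL.sym)
  show ?thesis
  proof (intro bexI[OF _ x(1)] allI impI)
    fix V :: "'m ppoint set" assume V: "openin (proj_space n) V" "V \<subseteq> ?U"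
    interpret M: semimodule "sec (proj_sheaf n) V" "sec L V"
      using L V(1) by (simp add: sheaf_of_semimodules_def)
    let ?x = "res L ?U V x"
    have xV: "?x \<in> carrier (sec L V)"
      by (rule sheaf_res_closed[OF L openin_standard_open V x(1)])
    have "\<phi> V ?x = \<one>\<^bsub>sec (proj_sheaf n) V\<^esub>"
      using sheaf_isoD(5)[OF \<phi> oU oW[OF V] V(2) x(1)] proj_sheaf_res_one[OF V(2)] x(2) by (simp add: reg)
    \<comment> \<open>Linearity gives \<phi>(a x) = a \<phi>(x) = a, so the trivialization itself is
      the inverse of multiplying the generator by scalars.\<close>
    then have inverse: "\<phi> V (a \<odot>\<^bsub>sec L V\<^esub> ?x) = a" if "a \<in> carrier (sec (proj_sheaf n) V)" for a
      using sheaf_isoD(4)[OF \<phi> oW[OF V] that xV] that by (simp add: reg)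
    note bij = sheaf_isoD(1)[OF \<phi> oW[OF V], unfolded reg]
    have cl: "a \<odot>\<^bsub>sec L V\<^esub> ?x \<in> carrier (sec L V)" if "a \<in> carrier (sec (proj_sheaf n) V)" for a
      using that xV by (rule M.smult_closed)
    have "\<phi> V s \<odot>\<^bsub>sec L V\<^esub> ?x = s" if s: "s \<in> carrier (sec L V)" for s
    proof -
      have \<phi>s: "\<phi> V s \<in> carrier (sec (proj_sheaf n) V)" using bij s by (auto dest: bij_betwE)
      show ?thesis
        using inverse[OF \<phi>s] bij s cl[OF \<phi>s] by (auto simp: bij_betw_def dest: inj_onD)
    qed
    then show "bij_betw (\<lambda>a. a \<odot>\<^bsub>sec L V\<^esub> ?x) (carrier (sec (proj_sheaf n) V)) (carrier (sec L V))"
      using inverse cl bij by (intro bij_betw_byWitness[where f' = "\<phi> V"]) (auto dest: bij_betwE)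
  qed
qed

lemma invertible_trivialized:
  fixes L :: "('m ppoint, 'm psection, 's) mod_presheaf"
  assumes inv: "invertible_sheaf (proj_space n) (proj_sheaf n) L"
  shows "\<exists>e. trivialized_sheaf n L e"
proof -
  define Q where "Q i x \<longleftrightarrow> x \<in> carrier (sec L (standard_open n i)) \<and>
    (\<forall>V. openin (proj_space n) V \<longrightarrow> V \<subseteq> standard_open n i \<longrightarrow>
      bij_betw (\<lambda>a. a \<odot>\<^bsub>sec L V\<^esub> res L (standard_open n i) V x)
        (carrier (sec (proj_sheaf n) V)) (carrier (sec L V)))" for i x
  have "\<forall>i. \<exists>x. i \<le> n \<longrightarrow> Q i x" using invertible_generator[OF inv] unfolding Q_def by blast
  from choice[OF this] obtain e where e: "\<forall>i. i \<le> n \<longrightarrow> Q i (e i)" ..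
  have "trivialized_sheaf n L e"
    by unfold_locales (use e inv in \<open>simp_all add: Q_def invertible_sheaf_def\<close>)
  then show ?thesis by (rule exI[where x = e])
qed

lemma ratio_single: "ratio c i j k = Poly_Mapping.single (Poly_Mapping.single i k + Poly_Mapping.single j (- k)) c"
  by (simp add: ratio_def xpow_def mult_single)

end

locale line_bundle = idempotent_semifield m + trivialized_sheaf n L e
  for m :: "'m::comm_semiring_1 itself" and n :: nat
    and L :: "('m ppoint, 'm psection, 's) mod_presheaf" and e :: "nat \<Rightarrow> 's"
begin

abbreviation overlap :: "nat \<Rightarrow> nat \<Rightarrow> 'm ppoint set" where
  "overlap i j \<equiv> standard_open n i \<inter> standard_open n j"

lemma open_overlap: "openin (proj_space n) (overlap i j)"
  by (intro openin_Int openin_standard_open)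

text \<open>The transition function in the convention e_i = t_ij e_j: a coordinate with respect to
  e_i becomes one with respect to e_j by multiplication with t_ij.\<close>

definition trans :: "nat \<Rightarrow> nat \<Rightarrow> 'm fsection" where
  "trans i j = (SOME b. b \<in> fsections n 0 (overlap i j) \<and>
    act (overlap i j) i (fone n (overlap i j)) = act (overlap i j) j b)"

lemma trans:
  assumes "i \<le> n" "j \<le> n"
  shows "trans i j \<in> fsections n 0 (overlap i j)"
    and "act (overlap i j) i (fone n (overlap i j)) = act (overlap i j) j (trans i j)"
proof -
  have "act (overlap i j) i (fone n (overlap i j)) \<in> carrier (sec L (overlap i j))"
    by (rule act_closed[OF assms(1) open_overlap _ fsections_one[OF open_overlap]]) simp
  then have "\<exists>b. b \<in> fsections n 0 (overlap i j) \<and> act (overlap i j) i (fone n (overlap i j)) = act (overlap i j) j b"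
    using act_surj[OF assms(2) open_overlap] by blast
  then show "trans i j \<in> fsections n 0 (overlap i j)"
    "act (overlap i j) i (fone n (overlap i j)) = act (overlap i j) j (trans i j)"
    unfolding trans_def by (metis (mono_tags, lifting) someI_ex)+
qed

lemma act_fone:
  assumes ij: "i \<le> n" "j \<le> n" and V: "openin (proj_space n) V" "V \<subseteq> overlap i j"
  shows "act V i (fone n V) = act V j (restrict (trans i j) V)"
proof -
  have "restrict (fone n (overlap i j)) V = fone n V" using V(2) by (auto simp: restrict_def fun_eq_iff)
  then have "act V i (fone n V) = res L (overlap i j) V (act (overlap i j) i (fone n (overlap i j)))"
    using act_res[OF ij(1) open_overlap _ V fsections_one[OF open_overlap]] by simp
  also have "\<dots> = act V j (restrict (trans i j) V)"
    unfolding trans(2)[OF ij] using act_res[OF ij(2) open_overlap _ V trans(1)[OF ij]] by simp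
  finally show ?thesis .
qed

lemma trans_restrict:
  "i \<le> n \<Longrightarrow> j \<le> n \<Longrightarrow> openin (proj_space n) V \<Longrightarrow> V \<subseteq> overlap i j \<Longrightarrow> restrict (trans i j) V \<in> fsections n 0 V"
  using fsections_restrict trans(1) by blast

lemma act_trans:
  assumes ij: "i \<le> n" "j \<le> n" and V: "openin (proj_space n) V" "V \<subseteq> overlap i j" and a: "a \<in> fsections n 0 V"
  shows "act V i a = act V j (fprod n V a (restrict (trans i j) V))"
proof -
  have Vij: "V \<subseteq> standard_open n i" "V \<subseteq> standard_open n j" using V(2) by auto
  have "act V i a = act V i (fprod n V a (fone n V))" by (simp only: fprod_one[OF V(1) a])
  also have "\<dots> = to_charts n 0 V a \<odot>\<^bsub>sec L V\<^esub> act V i (fone n V)"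
    by (rule smult_act[OF ij(1) V(1) Vij(1) a fsections_one[OF V(1)], symmetric])
  also have "\<dots> = to_charts n 0 V a \<odot>\<^bsub>sec L V\<^esub> act V j (restrict (trans i j) V)"
    by (simp only: act_fone[OF ij V])
  also have "\<dots> = act V j (fprod n V a (restrict (trans i j) V))"
    by (rule smult_act[OF ij(2) V(1) Vij(2) a trans_restrict[OF ij V]])
  finally show ?thesis .
qed

text \<open>Both sides are the coordinate of e_i with respect to e_l, once computed through e_j, and
  coordinates are unique.\<close>

lemma trans_cocycle:
  assumes "i \<le> n" "j \<le> n" "l \<le> n" and V: "openin (proj_space n) V"
    "V \<subseteq> standard_open n i" "V \<subseteq> standard_open n j" "V \<subseteq> standard_open n l"
  shows "fprod n V (restrict (trans i j) V) (restrict (trans j l) V) = restrict (trans i l) V"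
proof -
  have o: "V \<subseteq> overlap i j" "V \<subseteq> overlap j l" "V \<subseteq> overlap i l" using V by auto
  note t = trans_restrict[OF assms(1,2) V(1) o(1)] trans_restrict[OF assms(2,3) V(1) o(2)]
    trans_restrict[OF assms(1,3) V(1) o(3)]
  have "act V l (fprod n V (restrict (trans i j) V) (restrict (trans j l) V)) = act V i (fone n V)"
    unfolding act_fone[OF assms(1,2) V(1) o(1)] by (rule act_trans[OF assms(2,3) V(1) o(2) t(1), symmetric])
  also have "\<dots> = act V l (restrict (trans i l) V)" by (rule act_fone[OF assms(1,3) V(1) o(3)])
  finally show ?thesis
    using act_inj[OF assms(3) V(1,4) _ _ t(3)] fsections_mult[OF t(1,2), of 0] by simp
qed

lemma trans_refl:
  assumes "i \<le> n" shows "trans i i = fone n (overlap i i)"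
  using act_inj[OF assms open_overlap _ trans(2)[OF assms assms] fsections_one[OF open_overlap] trans(1)[OF assms assms]]
  by simp

text \<open>Off the diagonal the inverse demanded by \<open>unit_section_is_ratio\<close> is t_ji.
  On the diagonal x_i/x_i leaves the exponent undetermined, so it is normalized to 0 there.\<close>

lemma trans_ratio:
  assumes ij: "i \<le> n" "j \<le> n"
  shows "\<exists>c k. c \<noteq> 0 \<and> (i = j \<longrightarrow> c = 1 \<and> k = 0) \<and>
    (\<forall>q\<in>overlap i j. trans i j q = fr (denoms n q) (ratio c i j k) 1)"
proof (cases "i = j")
  case True
  then show ?thesis using trans_refl[OF ij(1)]
    by (intro exI[of _ 1] exI[of _ 0]) (simp add: ratio_def)
next
  case False
  have eq: "overlap j i = overlap i j" by blast
  note t = trans(1)[OF ij] trans(1)[OF ij(2,1), unfolded eq]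
  have "restrict (trans i j) (overlap i j) = trans i j" "restrict (trans j i) (overlap i j) = trans j i"
    using t fsections_ext extensional_restrict by blast+
  then have "fprod n (overlap i j) (trans i j) (trans j i) = restrict (trans i i) (overlap i j)"
    using trans_cocycle[OF ij ij(1) open_overlap, of i j] by simp
  also have "\<dots> = fone n (overlap i j)"
    unfolding trans_refl[OF ij(1)] by (auto simp: restrict_def fun_eq_iff)
  finally show ?thesis
    using unit_section_is_ratio[OF ij False t] False by blast
qed

lemma transition_ratios:
  obtains c k where "\<And>i j. i \<le> n \<Longrightarrow> j \<le> n \<Longrightarrow> c i j \<noteq> 0"
    "\<And>i. i \<le> n \<Longrightarrow> c i i = 1 \<and> k i i = 0"
    "\<And>i j q. i \<le> n \<Longrightarrow> j \<le> n \<Longrightarrow> q \<in> overlap i j \<Longrightarrow>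
      trans i j q = fr (denoms n q) (ratio (c i j) i j (k i j)) 1"
proof -
  define Q where "Q i j x \<longleftrightarrow> fst x \<noteq> 0 \<and> (i = j \<longrightarrow> fst x = 1 \<and> snd x = 0) \<and>
    (\<forall>q\<in>overlap i j. trans i j q = fr (denoms n q) (ratio (fst x) i j (snd x)) 1)" for i j and x :: "'m \<times> int"
  have "\<forall>ij. \<exists>x. fst ij \<le> n \<longrightarrow> snd ij \<le> n \<longrightarrow> Q (fst ij) (snd ij) x"
    using trans_ratio unfolding Q_def by auto
  from choice[OF this] obtain f where
    "\<forall>ij. fst ij \<le> n \<longrightarrow> snd ij \<le> n \<longrightarrow> Q (fst ij) (snd ij) (f ij)" ..
  then have "Q i j (f (i, j))" if "i \<le> n" "j \<le> n" for i j using that by (metis fst_conv snd_conv)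
  then show ?thesis
    by (intro that[of "\<lambda>i j. fst (f (i, j))" "\<lambda>i j. snd (f (i, j))"]) (auto simp: Q_def)
qed

text \<open>The cocycle rule for fractions is evaluated at the monomial point of {i, j, l}, which
  lies in all three charts; there it becomes an identity of Laurent polynomials.\<close>

lemma laurent_cocycle:
  assumes ijl: "i \<le> n" "j \<le> n" "l \<le> n"
    and R: "\<And>i j q. i \<le> n \<Longrightarrow> j \<le> n \<Longrightarrow> q \<in> overlap i j \<Longrightarrow> trans i j q = fr (denoms n q) (R i j) 1"
  shows "R i j * R j l = R i l"
proof -
  have I: "{i, j, l} \<subseteq> {..n}" "{i, j, l} \<noteq> {}" using ijl by auto
  obtain p :: "'m ppoint" where p: "p \<in> topspace (proj_space n)" "nonzero_at n p = monomials {i, j, l}"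
    "\<forall>x\<in>{i, j, l}. p \<in> standard_open n x" by (rule monomial_point[OF I])
  interpret hprime n "monomials {i, j, l} :: 'm laurent set" by (rule hprime_monomials[OF I])
  let ?V = "overlap i j \<inter> standard_open n l"
  have V: "openin (proj_space n) ?V" "?V \<subseteq> standard_open n i" "?V \<subseteq> standard_open n j" "?V \<subseteq> standard_open n l"
    using openin_Int[OF open_overlap openin_standard_open] by auto
  have pV: "p \<in> ?V" "p \<in> overlap i j" "p \<in> overlap j l" "p \<in> overlap i l" using p(3) by auto
  have "fr_mult (denoms n p) (trans i j p) (trans j l p) = trans i l p"
    using fun_cong[OF trans_cocycle[OF ijl V], of p] pV(1) by simp
  then have "fr (sat (monomials {i, j, l})) (R i j * R j l) (1 * 1) = fr (sat (monomials {i, j, l})) (R i l) 1"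
    using R[OF ijl(1,2) pV(2)] R[OF ijl(2,3) pV(3)] R[OF ijl(1,3) pV(4)]
      sat.fr_mult_eq[OF one_sat one_sat] by (simp add: p(2))
  then obtain u where "u \<in> sat (monomials {i, j, l})" "u * 1 * (R i j * R j l) = u * (1 * 1) * R i l"
    using sat.fr_eq_iff[OF sat_mult[OF one_sat one_sat] one_sat] by blast
  then show ?thesis using monomial_cancel[OF I] by simp
qed

text \<open>Transporting the generator x_0^d from D(x_0) to D(x_i) by the transition function R i 0
  yields the g_i. The rule R i j * R j 0 = R i 0 then says that the g_i change exactly as the e_i
  do.\<close>

theorem ex_matching_generators: "\<exists>d g. matching_generators n L e d g"
proof -
  obtain c k where ck: "\<And>i j. i \<le> n \<Longrightarrow> j \<le> n \<Longrightarrow> c i j \<noteq> 0"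
    "\<And>i. i \<le> n \<Longrightarrow> c i i = 1 \<and> k i i = 0"
    "\<And>i j q. i \<le> n \<Longrightarrow> j \<le> n \<Longrightarrow> q \<in> overlap i j \<Longrightarrow>
      trans i j q = fr (denoms n q) (ratio (c i j) i j (k i j)) 1"
    using transition_ratios by metis
  define R where "R i j = ratio (c i j) i j (k i j)" for i j
  have R: "trans i j q = fr (denoms n q) (R i j) 1" if "i \<le> n" "j \<le> n" "q \<in> overlap i j" for i j q
    unfolding R_def by (rule ck(3)[OF that])
  have cocycle: "R i j * R j l = R i l" if "i \<le> n" "j \<le> n" "l \<le> n" for i j l
    by (rule laurent_cocycle[OF that R])
  \<comment> \<open>For n = 0 there is no chart 1 and this number is unspecified; with a single
    chart any degree will do.\<close>
  define d where "d = k 1 0"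
  have k: "k i 0 = d" if i: "i \<le> n" "i \<noteq> 0" for i
  proof (cases "i = 1")
    case False
    have n: "1 \<le> n" using i by linarith
    let ?a = "Poly_Mapping.single i (k i 1) + Poly_Mapping.single 1 (- k i 1) +
      (Poly_Mapping.single 1 (k 1 0) + Poly_Mapping.single 0 (- k 1 0))"
    let ?b = "Poly_Mapping.single i (k i 0) + Poly_Mapping.single 0 (- k i 0)"
    have "Poly_Mapping.single ?a (c i 1 * c 1 0) = Poly_Mapping.single ?b (c i 0)"
      using cocycle[OF i(1) n, of 0] by (simp add: R_def ratio_single mult_single)
    then have "Poly_Mapping.keys (Poly_Mapping.single ?a (c i 1 * c 1 0)) = Poly_Mapping.keys (Poly_Mapping.single ?b (c i 0))"
      by (rule arg_cong)
    moreover have "c i 1 * c 1 0 \<noteq> 0" "c i 0 \<noteq> 0" using ck(1) i n mult_nonzero by auto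
    ultimately have "?a = ?b" by simp
    \<comment> \<open>In R i 1 * R 1 0 = R i 0 the variable x_0 occurs with exponent - k 1 0 on the
      left and - k i 0 on the right, which makes the exponent independent of i.\<close>
    then have "Poly_Mapping.lookup ?a 0 = Poly_Mapping.lookup ?b 0" by (rule arg_cong)
    then show ?thesis using i(2) by (simp add: lookup_add lookup_single d_def)
  qed (simp add: d_def)
  \<comment> \<open>Since R i 0 contains x_0^(-d) for nonzero i, the powers of x_0 cancel and c_i0
    x_i^d remains, a section of O(d) without denominators other than x_i.\<close>
  define G where "G i = R i 0 * xpow 0 d" for i
  have G: "G i = Poly_Mapping.single 0 (c i 0) * xpow i d" if i: "i \<le> n" for i
  proof (cases "i = 0")
    case True
    then show ?thesis using ck(2)[of 0] by (simp add: G_def R_def ratio_def)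
  next
    case False
    then show ?thesis using k[OF i False] by (simp add: G_def R_def ratio_def mult.assoc)
  qed
  have RG: "R i j * G j = G i" if "i \<le> n" "j \<le> n" for i j
    using cocycle[OF that, of 0] by (simp add: G_def flip: mult.assoc)
  define g where "g i = msec n (c i 0) i d (standard_open n i)" for i
  have g_val: "g i q = fr (denoms n q) (G i) 1" if "i \<le> n" "q \<in> standard_open n i" for i q
    using that by (simp add: g_def msec_def G)
  have prod_g: "fprod n V a (g i) = fprod n V a (msec n (c i 0) i d V)" if "V \<subseteq> standard_open n i" for V a i
    using that by (intro restrict_ext) (auto simp: g_def msec_def)
  have g_bij: "bij_betw (\<lambda>a. fprod n V a (g i)) (fsections n 0 V) (fsections n d V)"
    if i: "i \<le> n" and V: "openin (proj_space n) V" "V \<subseteq> standard_open n i" for i V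
  proof -
    obtain c' where "c i 0 * c' = 1" using unit[OF ck(1)[OF i]] by auto
    then show ?thesis unfolding prod_g[OF V(2)] by (rule msec_bij[OF V])
  qed
  have "matching_generators n L e d g"
  proof
    show "g i \<in> fsections n d (standard_open n i)" if "i \<le> n" for i
      unfolding g_def by (rule msec_fsections[OF openin_standard_open subset_refl])
    show "bij_betw (\<lambda>a. fprod n V a (g i)) (fsections n 0 V) (fsections n d V)"
      if "i \<le> n" "openin (proj_space n) V" "V \<subseteq> standard_open n i" for i V
      by (rule g_bij[OF that])
    fix i j and V :: "'m ppoint set" and a b
    assume ij: "i \<le> n" "j \<le> n" and V: "openin (proj_space n) V" "V \<subseteq> standard_open n i" "V \<subseteq> standard_open n j"
      and a: "a \<in> fsections n 0 V" and b: "b \<in> fsections n 0 V"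
    have o: "V \<subseteq> overlap i j" using V by simp
    let ?t = "restrict (trans i j) V"
    note t = trans_restrict[OF ij V(1) o]
    have at: "fprod n V a ?t \<in> fsections n 0 V" using fsections_mult[OF a t] by simp
    have gj: "restrict (g j) V \<in> fsections n d V"
      unfolding g_def restrict_msec[OF V(3)] by (rule msec_fsections[OF V(1,3)])
    have "fprod n V ?t (restrict (g j) V) = restrict (g i) V"
    proof (rule restrict_ext)
      fix p assume p: "p \<in> V"
      then have po: "p \<in> overlap i j" "p \<in> standard_open n i" "p \<in> standard_open n j" using o by auto
      interpret hprime n "nonzero_at n p" by (rule hprime_nonzero_at[OF open_points[OF V(1) p]])
      show "fr_mult (denoms n p) (?t p) (restrict (g j) V p) = g i p"
        using p R[OF ij po(1)] g_val[OF ij(1) po(2)] g_val[OF ij(2) po(3)]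
          sat.fr_mult_eq[OF one_sat one_sat, of "R i j" "G j"] RG[OF ij] by simp
    qed
    then have "fprod n V (fprod n V a ?t) (restrict (g j) V) = fprod n V a (restrict (g i) V)"
      using fprod_assoc[OF V(1) a t gj] by (simp only:)
    moreover have rr: "fprod n V x (restrict y V) = fprod n V x y" for x y by (intro restrict_ext) simp
    ultimately have "fprod n V (fprod n V a ?t) (g j) = fprod n V a (g i)" by (simp only: rr)
    moreover have "inj_on (\<lambda>a. fprod n V a (g j)) (fsections n 0 V)"
      using g_bij[OF ij(2) V(1,3)] by (simp add: bij_betw_def)
    then have "fprod n V (fprod n V a ?t) (g j) = fprod n V b (g j) \<longleftrightarrow> fprod n V a ?t = b"
      using inj_on_eq_iff[of "\<lambda>a. fprod n V a (g j)" "fsections n 0 V" "fprod n V a ?t" b] at b by simp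
    \<comment> \<open>Both equivalences reduce their side to the same condition that b is the
      coordinate a t_ij.\<close>
    moreover have "act V i a = act V j b \<longleftrightarrow> fprod n V a ?t = b"
      using act_trans[OF ij V(1) o a] act_inj[OF ij(2) V(1,3) _ at b] by auto
    ultimately show "act V i a = act V j b \<longleftrightarrow> fprod n V a (g i) = fprod n V b (g j)" by simp
  qed
  then show ?thesis by blast
qed

end

lemma (in idempotent_semifield) invertible_isomorphic_twisting:
  fixes L :: "('m ppoint, 'm psection, 's) mod_presheaf"
  assumes "invertible_sheaf (proj_space n) (proj_sheaf n) L"
  shows "\<exists>d. sheaf_isomorphic (proj_space n) (proj_sheaf n) L (twisting_sheaf n d)"
proof -
  obtain e where "trivialized_sheaf n L e" using invertible_trivialized[OF assms] ..
  then interpret trivialized_sheaf n L e .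
  interpret line_bundle m n L e ..
  obtain d g where "matching_generators n L e d g" using ex_matching_generators by blast
  then have "sheaf_isomorphic (proj_space n) (proj_sheaf n) L (fsheaf n d)"
    by (rule matching_generators.isomorphic_fsheaf)
  then show ?thesis
    using sheaf_isomorphic_trans fsheaf_iso_twisting unfolding sheaf_isomorphic_iff by blast
qed

theorem corollary4p29:
  fixes n :: nat
  assumes semifield: "\<forall>x::'m::comm_semiring_1. x \<noteq> 0 \<longrightarrow> (\<exists>y. x * y = 1)"
    and idempotent: "\<forall>x::'m. x + x = x"
    and totally_ordered: "\<forall>x y::'m. idem_le x y \<or> idem_le y x"
  shows "(\<forall>l m. sheaf_isomorphic (proj_space n :: 'm ppoint topology) (proj_sheaf n)
            (tensor_sheaf (proj_space n) (proj_sheaf n) (twisting_sheaf n l) (twisting_sheaf n m))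
            (twisting_sheaf n (l + m)))
       \<and> (\<forall>\<L> :: ('m ppoint, 'm psection, 's) mod_presheaf.
            invertible_sheaf (proj_space n) (proj_sheaf n) \<L> \<longrightarrow>
            (\<exists>m. sheaf_isomorphic (proj_space n) (proj_sheaf n) \<L> (twisting_sheaf n m)))"
proof -
  interpret idempotent_semifield "TYPE('m)"
    by unfold_locales (use semifield idempotent in auto)
  show ?thesis
    using twisting_tensor_twisting invertible_isomorphic_twisting by blast
qed

end
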